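(* In the formal power series ring $\mathbb C[[\mathbf s,\mathbf t]]$, \[ \sum_{n\ge0}\sum_{\underline\lambda\vdash n}\sum_{\underline\mu\vdash n}\frac{\psi^{\underline\lambda}(\underline\mu)}{|Z_{\underline\mu}|}\,\mathbf s^{\mathbf c(\underline\lambda)}\mathbf t^{\mathbf c(\underline\mu)}=\exp\Big(\sum_{i,\varepsilon}\sum_{j,\theta}\sum_{e\mid\gcd(i,j)}\frac{K_{\varepsilon,\theta}(e)\,(s_{i,\varepsilon}t_{j,\theta})^{ij/e}}{2ij/e}\Big), \] where for $\varepsilon,\theta\in\{+1,-1\}$ and $e\ge1$, \[ K_{\varepsilon,\theta}(e)=\varepsilon\theta\,\mu(2e)+\frac{(1+\varepsilon)(1+\theta)}{2}\,\mu(e), \] $\mu$ being the arithmetic Möbius function.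
   Context: $B_n$ is the group of bijections $w$ of $\{\pm1,\dots,\pm n\}$ with $w(-i)=-w(i)$. Cycles: if $c=(a_1,\dots,a_\ell)$ is a cycle of $w$ on $\{\pm1,\dots,\pm n\}$ so is $\bar c$ (negated entries); if $c\ne\bar c$, $c\bar c$ is a cycle of length $\ell$ and $\mathbb Z_2$-class $+1$; if $c=\bar c$, a cycle of length $\ell/2$ and class $-1$. Conjugacy classes are indexed by bipartitions $\underline\lambda=(\lambda^+,\lambda^-)\vdash n$ ($\lambda^\varepsilon$ = lengths of cycles of class $\varepsilon$). If $\underline\lambda$ has $a_{i,\varepsilon}$ parts $i$ in $\lambda^\varepsilon$ and $\underline\mu$ has $b_{j,\theta}$ parts $j$ in $\mu^\theta$, then $\mathbf s^{\mathbf c(\underline\lambda)}=\prod s_{i,\varepsilon}^{ia_{i,\varepsilon}}$, $\mathbf t^{\mathbf c(\underline\mu)}=\prod t_{j,\theta}^{jb_{j,\theta}}$, indeterminates indexed by $i,j\ge1$, $\varepsilon,\theta\in\{\pm1\}$. $|Z_{\underline\mu}|$ is the centralizer order of an element of class $\underline\mu$ and $\psi^{\underline\lambda}(\underline\mu)$ is the value of $\psi^{\underline\lambda}$ at such an element. Higher Lie characters: for $x$ of type $\underline\lambda$, $Z_{B_n}(x)\cong\prod_{i,\varepsilon}G_{i,\varepsilon}\wr S_{a_{i,\varepsilon}}$, where $G_{i,+}\cong\mathbb Z_2\times\mathbb Z_i$ is the centralizer in $B_i$ of one cycle of length $i$ and class $+1$ ($\mathbb Z_2$ generated by $[-1,\dots,-i]$,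 $\mathbb Z_i$ by the cycle) and $G_{i,-}\cong\mathbb Z_{2i}$ is generated by one cycle of length $i$ and class $-1$. $\omega_{i,+}$ is the linear character of $G_{i,+}\wr S_a$ equal on the base group to the product over factors of (trivial on $\mathbb Z_2$)$\times$(faithful linear character of $\mathbb Z_i$) and trivial on the complement $S_a$; $\omega_{i,-}$ is the product over base factors of a faithful linear character of $\mathbb Z_{2i}$, trivial on $S_a$; $\omega^x=\bigotimes\omega_{i,\varepsilon}$ and $\psi^{\underline\lambda}=\mathrm{Ind}_{Z_{B_n}(x)}^{B_n}\omega^x$. *)

theory Defs
  imports
    Complex_Main
    "HOL-Library.Multiset"
    "HOL-Computational_Algebra.Primes"
    "HOL-Computational_Algebra.Squarefree"
    "HOL-Combinatorics.Permutations"
    "HOL-Combinatorics.Orbits"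
    "HOL-Algebra.Generated_Groups"
begin

section \<open>Formal power series in arbitrarily many indeterminates\<close>

text \<open>
  A monomial is a finitely supported exponent function on the indeterminates, i.e. a finite
  multiset of indeterminates; the product of monomials is the sum of multisets.
\<close>

typedef ('v, 'a) mps = "UNIV :: ('v multiset \<Rightarrow> 'a) set"
  morphisms mps_coeff Abs_mps
  by simp

lemma mps_coeff_Abs [simp]: "mps_coeff (Abs_mps f) = f"
  by (simp add: Abs_mps_inverse)

lemma mps_eqI: "(\<And>m. mps_coeff f m = mps_coeff g m) \<Longrightarrow> f = g"
  using mps_coeff_inject by blast

lemma finite_bounded_multisets:
  assumes "finite A"
  shows "finite {a. set_mset a \<subseteq> A \<and> size a \<le> k}"
proof -
  have "{a. set_mset a \<subseteq> A \<and> size a \<le> k} = (\<Union>j\<le>k. multisets_of_size A j)"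
    by (auto simp: multisets_of_size_def)
  then show ?thesis
    using assms by auto
qed

lemma finite_submultisets: "finite {a :: 'v multiset. a \<subseteq># m}"
  by (rule finite_subset[OF _ finite_bounded_multisets[of "set_mset m" "size m"]])
     (auto simp: size_mset_mono dest: set_mset_mono)

lemma finite_decompositions [simp]: "finite {(a, b). a + b = (m :: 'v multiset)}"
proof -
  have "{(a, b). a + b = m} \<subseteq> (\<lambda>a. (a, m - a)) ` {a. a \<subseteq># m}"
    by auto
  then show ?thesis
    by (rule finite_subset) (intro finite_imageI finite_submultisets)
qed

instantiation mps :: (type, comm_ring_1) comm_ring_1
begin

definition zero_mps :: "('a, 'b) mps" where
  "0 = Abs_mps (\<lambda>_. 0)"

definition one_mps :: "('a, 'b) mps" where
  "1 = Abs_mps (\<lambda>m. if m = {#} then 1 else 0)"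

definition plus_mps :: "('a, 'b) mps \<Rightarrow> ('a, 'b) mps \<Rightarrow> ('a, 'b) mps" where
  "f + g = Abs_mps (\<lambda>m. mps_coeff f m + mps_coeff g m)"

definition uminus_mps :: "('a, 'b) mps \<Rightarrow> ('a, 'b) mps" where
  "- f = Abs_mps (\<lambda>m. - mps_coeff f m)"

definition minus_mps :: "('a, 'b) mps \<Rightarrow> ('a, 'b) mps \<Rightarrow> ('a, 'b) mps" where
  "f - g = Abs_mps (\<lambda>m. mps_coeff f m - mps_coeff g m)"

definition times_mps :: "('a, 'b) mps \<Rightarrow> ('a, 'b) mps \<Rightarrow> ('a, 'b) mps" where
  "f * g = Abs_mps (\<lambda>m. \<Sum>(a, b)\<in>{(a, b). a + b = m}. mps_coeff f a * mps_coeff g b)"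

instance
proof
  fix f g h :: "('a, 'b) mps"
  show "f * g * h = f * (g * h)"
  proof (rule mps_eqI)
    fix m :: "'a multiset"
    let ?D = "\<lambda>m :: 'a multiset. {(a, b). a + b = m}"
    let ?F = "mps_coeff f" and ?G = "mps_coeff g" and ?H = "mps_coeff h"
    have "mps_coeff (f * g * h) m =
        (\<Sum>p\<in>?D m. \<Sum>q\<in>?D (fst p). ?F (fst q) * ?G (snd q) * ?H (snd p))"
      by (simp add: times_mps_def sum_distrib_right case_prod_unfold)
    also have "\<dots> = (\<Sum>(p, q)\<in>(SIGMA p:?D m. ?D (fst p)). ?F (fst q) * ?G (snd q) * ?H (snd p))"
      by (subst sum.Sigma) auto
    also have "\<dots> = (\<Sum>(p, q)\<in>(SIGMA p:?D m. ?D (snd p)). ?F (fst p) * (?G (fst q) * ?H (snd q)))"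
      by (rule sum.reindex_bij_witness
            [where j = "\<lambda>(p, q). ((fst q, snd q + snd p), (snd q, snd p))"
               and i = "\<lambda>(p, q). ((fst p + fst q, snd q), (fst p, fst q))"])
         (auto simp: ac_simps)
    also have "\<dots> = (\<Sum>p\<in>?D m. \<Sum>q\<in>?D (snd p). ?F (fst p) * (?G (fst q) * ?H (snd q)))"
      by (subst sum.Sigma) auto
    also have "\<dots> = mps_coeff (f * (g * h)) m"
      by (simp add: times_mps_def sum_distrib_left case_prod_unfold)
    finally show "mps_coeff (f * g * h) m = mps_coeff (f * (g * h)) m" .
  qed
  show "f * g = g * f"
  proof (rule mps_eqI)
    fix m
    show "mps_coeff (f * g) m = mps_coeff (g * f) m"
      unfolding times_mps_def mps_coeff_Abs
      by (rule sum.reindex_bij_witness[where i = prod.swap and j = prod.swap])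
         (auto simp: ac_simps)
  qed
  show "1 * f = f"
  proof (rule mps_eqI)
    fix m
    have "mps_coeff (1 * f) m =
        (\<Sum>p\<in>{(a, b). a + b = m}. if p = ({#}, m) then mps_coeff f m else 0)"
      unfolding times_mps_def one_mps_def mps_coeff_Abs
      by (rule sum.cong) (auto split: if_splits)
    then show "mps_coeff (1 * f) m = mps_coeff f m"
      by (simp add: sum.delta)
  qed
  show "(f + g) * h = f * h + g * h"
    by (rule mps_eqI) (simp add: times_mps_def plus_mps_def distrib_right sum.distrib
        case_prod_unfold)
  show "(0 :: ('a, 'b) mps) \<noteq> 1"
    by (auto simp: zero_mps_def one_mps_def Abs_mps_inject fun_eq_iff)
qed (auto intro!: mps_eqI simp: plus_mps_def zero_mps_def uminus_mps_def minus_mps_def ac_simps)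

end

lemma mps_coeff_sum: "mps_coeff (\<Sum>i\<in>I. F i) m = (\<Sum>i\<in>I. mps_coeff (F i) m)"
  by (induction I rule: infinite_finite_induct) (auto simp: zero_mps_def plus_mps_def)

definition mps_const :: "'a \<Rightarrow> ('v, 'a :: comm_ring_1) mps" where
  "mps_const c = Abs_mps (\<lambda>m. if m = {#} then c else 0)"

definition mps_var :: "'v \<Rightarrow> ('v, 'a :: comm_ring_1) mps" where
  "mps_var v = Abs_mps (\<lambda>m. if m = {#v#} then 1 else 0)"

definition mps_locally_finite :: "'i set \<Rightarrow> ('i \<Rightarrow> ('v, 'a :: comm_ring_1) mps) \<Rightarrow> bool" where
  "mps_locally_finite I F \<longleftrightarrow> (\<forall>m. finite {i \<in> I. mps_coeff (F i) m \<noteq> 0})"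

text \<open>
  The infinite sum of a locally finite family of power series. (For other families the value
  is meaningless; the families summed below are shown to be locally finite.)
\<close>

definition mps_sum :: "'i set \<Rightarrow> ('i \<Rightarrow> ('v, 'a :: comm_ring_1) mps) \<Rightarrow> ('v, 'a) mps" where
  "mps_sum I F = Abs_mps (\<lambda>m. \<Sum>i\<in>{i \<in> I. mps_coeff (F i) m \<noteq> 0}. mps_coeff (F i) m)"

text \<open>For series without constant term.\<close>

definition mps_exp :: "('v, complex) mps \<Rightarrow> ('v, complex) mps" where
  "mps_exp f = mps_sum UNIV (\<lambda>k :: nat. mps_const (1 / fact k) * f ^ k)"


section \<open>The hyperoctahedral groups\<close>

definition pm_set :: "nat \<Rightarrow> int set" where
  "pm_set n = {- int n..int n} - {0}"

text \<open>
  As in \<^const>\<open>permutes\<close>, a bijection of \<^term>\<open>pm_set n\<close> is extended by the identity to all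
  integers.
\<close>

definition hyperoctahedral :: "nat \<Rightarrow> (int \<Rightarrow> int) monoid" where
  "hyperoctahedral n =
     \<lparr>carrier = {w. w permutes pm_set n \<and> (\<forall>i. w (- i) = - w i)}, mult = (\<circ>), one = id\<rparr>"

datatype z2class = Pos | Neg

fun class_sign :: "z2class \<Rightarrow> int" where
  "class_sign Pos = 1"
| "class_sign Neg = - 1"

text \<open>
  A cycle \<open>c\<close> of \<open>w\<close> is given by its set of entries; the opposite cycle has
  entries \<open>uminus ` c\<close>. Because \<open>w\<close> commutes with negation, two cycles of \<open>w\<close>
  are equal iff their entry sets are.
\<close>

definition cycle_class :: "int set \<Rightarrow> z2class" where
  "cycle_class c = (if uminus ` c = c then Neg else Pos)"

text \<open>
  The supports of the signed cycles of \<open>w\<close> of a given class. A support is the disjoint union of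
  a cycle and its opposite (class \<open>Pos\<close>), or one self-opposite cycle (class \<open>Neg\<close>); in both
  cases the length of the signed cycle is half the size of its support.
\<close>

definition signed_cycles :: "nat \<Rightarrow> (int \<Rightarrow> int) \<Rightarrow> z2class \<Rightarrow> int set set" where
  "signed_cycles n w \<epsilon> =
     {c \<union> uminus ` c |c. c \<in> orbit w ` pm_set n \<and> cycle_class c = \<epsilon>}"

type_synonym bipartition = "z2class \<Rightarrow> nat multiset"

definition bipartitions :: "nat \<Rightarrow> bipartition set" where
  "bipartitions n =
     {lam. (\<forall>\<epsilon>. 0 \<notin># lam \<epsilon>) \<and> sum_mset (lam Pos) + sum_mset (lam Neg) = n}"

definition cycle_type :: "nat \<Rightarrow> (int \<Rightarrow> int) \<Rightarrow> bipartition" where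
  "cycle_type n w = (\<lambda>\<epsilon>. image_mset (\<lambda>D. card D div 2) (mset_set (signed_cycles n w \<epsilon>)))"


section \<open>Higher Lie characters\<close>

definition centralizer :: "('a, 'b) monoid_scheme \<Rightarrow> 'a \<Rightarrow> 'a set" where
  "centralizer G x = {z \<in> carrier G. z \<otimes>\<^bsub>G\<^esub> x = x \<otimes>\<^bsub>G\<^esub> z}"

definition complex_units :: "complex monoid" where
  "complex_units = \<lparr>carrier = UNIV - {0}, mult = (*), one = 1\<rparr>"

definition linear_character :: "('a, 'b) monoid_scheme \<Rightarrow> 'a set \<Rightarrow> ('a \<Rightarrow> complex) \<Rightarrow> bool" where
  "linear_character G H \<chi> \<longleftrightarrow> \<chi> \<in> hom (G\<lparr>carrier := H\<rparr>) complex_units"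

definition induced_char ::
    "('a, 'b) monoid_scheme \<Rightarrow> 'a set \<Rightarrow> ('a \<Rightarrow> complex) \<Rightarrow> 'a \<Rightarrow> complex" where
  "induced_char G H \<chi> g =
     (\<Sum>k\<in>{k \<in> carrier G. inv\<^bsub>G\<^esub> k \<otimes>\<^bsub>G\<^esub> g \<otimes>\<^bsub>G\<^esub> k \<in> H}. \<chi> (inv\<^bsub>G\<^esub> k \<otimes>\<^bsub>G\<^esub> g \<otimes>\<^bsub>G\<^esub> k))
       / of_nat (card H)"

text \<open>One chosen entry in every signed cycle of \<open>x\<close>.\<close>

definition cycle_transversal :: "nat \<Rightarrow> (int \<Rightarrow> int) \<Rightarrow> int set \<Rightarrow> bool" where
  "cycle_transversal n x T \<longleftrightarrow>
     T \<subseteq> pm_set n \<and> (\<forall>\<epsilon>. \<forall>D\<in>signed_cycles n x \<epsilon>. \<exists>!a. a \<in> T \<inter> D)"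

text \<open>
  The centralizer \<open>Z\<close> of \<open>x\<close> as an internal product of wreath products.
  The base group is generated by its factors, one for every signed cycle with support \<open>D\<close>, of
  length \<open>i\<close>: the factor is generated by \<^term>\<open>perm_restrict x D\<close> (of order \<open>i\<close>, resp. \<open>2 * i\<close>,
  for class \<open>Pos\<close>, resp. \<open>Neg\<close>) and, for class \<open>Pos\<close>, additionally by the negation
  \<^term>\<open>perm_restrict uminus D\<close> of \<open>D\<close>. The choice of a first entry in every signed cycle
  identifies all signed cycles of the same length and class with each other, and the
  corresponding complement, the product of the symmetric groups permuting these cycles, is the
  stabilizer in \<open>Z\<close> of the set \<open>T\<close> of first entries. Since \<open>\<omega>\<close> is trivial on this complement, it
  is the same character on the factors for all signed cycles of the same length and class.
\<close>

definition higher_lie_linear :: "nat \<Rightarrow> (int \<Rightarrow> int) \<Rightarrow> ((int \<Rightarrow> int) \<Rightarrow> complex) \<Rightarrow> bool" where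
  "higher_lie_linear n x \<omega> \<longleftrightarrow>
     linear_character (hyperoctahedral n) (centralizer (hyperoctahedral n) x) \<omega> \<and>
     (\<forall>D\<in>signed_cycles n x Pos. \<omega> (perm_restrict uminus D) = 1) \<and>
     (\<forall>\<epsilon>. \<forall>D\<in>signed_cycles n x \<epsilon>.
        inj_on \<omega> (generate (hyperoctahedral n) {perm_restrict x D})) \<and>
     (\<exists>T. cycle_transversal n x T \<and>
        (\<forall>z\<in>centralizer (hyperoctahedral n) x. z ` T = T \<longrightarrow> \<omega> z = 1))"

definition higher_lie_char ::
    "nat \<Rightarrow> (int \<Rightarrow> int) \<Rightarrow> ((int \<Rightarrow> int) \<Rightarrow> complex) \<Rightarrow> (int \<Rightarrow> int) \<Rightarrow> complex" where
  "higher_lie_char n x \<omega> =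
     induced_char (hyperoctahedral n) (centralizer (hyperoctahedral n) x) \<omega>"


section \<open>The two generating series\<close>

text \<open>Only the indeterminates with first index at least 1 are used.\<close>

datatype indet = S nat z2class | T nat z2class

definition s_monomial :: "bipartition \<Rightarrow> (indet, complex) mps" where
  "s_monomial lam =
     (\<Prod>\<epsilon>\<in>{Pos, Neg}. \<Prod>i\<in>set_mset (lam \<epsilon>). mps_var (S i \<epsilon>) ^ (i * count (lam \<epsilon>) i))"

definition t_monomial :: "bipartition \<Rightarrow> (indet, complex) mps" where
  "t_monomial mu =
     (\<Prod>\<theta>\<in>{Pos, Neg}. \<Prod>j\<in>set_mset (mu \<theta>). mps_var (T j \<theta>) ^ (j * count (mu \<theta>) j))"

definition moebius_mu :: "nat \<Rightarrow> int" where
  "moebius_mu n = (if squarefree n then (- 1) ^ card (prime_factors n) else 0)"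

definition K :: "z2class \<Rightarrow> z2class \<Rightarrow> nat \<Rightarrow> complex" where
  "K \<epsilon> \<theta> e =
     of_int (class_sign \<epsilon> * class_sign \<theta> * moebius_mu (2 * e)) +
     of_int ((1 + class_sign \<epsilon>) * (1 + class_sign \<theta>)) / 2 * of_int (moebius_mu e)"


section \<open>Well-definedness of the sums\<close>

lemma size_le_sum_mset: "0 \<notin># (M :: nat multiset) \<Longrightarrow> size M \<le> sum_mset M"
  by (induction M) auto

lemma finite_bipartitions: "finite (bipartitions n)"
proof -
  let ?M = "{a :: nat multiset. set_mset a \<subseteq> {..n} \<and> size a \<le> n}"
  have part: "M \<in> ?M" if "0 \<notin># M" "sum_mset M \<le> n" for M :: "nat multiset"
    using that size_le_sum_mset[of M] by (auto dest!: multi_member_split)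
  have "bipartitions n \<subseteq> (\<lambda>(a, b). case_z2class a b) ` (?M \<times> ?M)"
  proof
    fix lam assume lam: "lam \<in> bipartitions n"
    have "lam = case_z2class (lam Pos) (lam Neg)"
      by (rule ext) (auto split: z2class.split)
    moreover have "lam Pos \<in> ?M" "lam Neg \<in> ?M"
      using lam by (intro part; force simp: bipartitions_def)+
    ultimately show "lam \<in> (\<lambda>(a, b). case_z2class a b) ` (?M \<times> ?M)"
      by (intro image_eqI[where x = "(lam Pos, lam Neg)"]) auto
  qed
  then show ?thesis
    by (rule finite_subset) (intro finite_imageI finite_cartesian_product
        finite_bounded_multisets; simp)
qed

definition mps_homogeneous :: "nat \<Rightarrow> ('v, 'a :: comm_ring_1) mps \<Rightarrow> bool" where
  "mps_homogeneous d f \<longleftrightarrow> (\<forall>m. mps_coeff f m \<noteq> 0 \<longrightarrow> size m = d)"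

lemma mps_homogeneous_const: "mps_homogeneous 0 (mps_const c)"
  by (auto simp: mps_homogeneous_def mps_const_def)

lemma mps_homogeneous_one: "mps_homogeneous 0 1"
  by (auto simp: mps_homogeneous_def one_mps_def)

lemma mps_homogeneous_var: "mps_homogeneous (Suc 0) (mps_var v)"
  by (auto simp: mps_homogeneous_def mps_var_def)

lemma mps_homogeneous_mult:
  assumes "mps_homogeneous d f" "mps_homogeneous e g"
  shows "mps_homogeneous (d + e) (f * g)"
  unfolding mps_homogeneous_def
proof (intro allI impI)
  fix m assume "mps_coeff (f * g) m \<noteq> 0"
  then obtain p where "p \<in> {(a, b). a + b = m}"
      "(case p of (a, b) \<Rightarrow> mps_coeff f a * mps_coeff g b) \<noteq> 0"
    unfolding times_mps_def mps_coeff_Abs by (rule sum.not_neutral_contains_not_neutral)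
  then obtain a b where "a + b = m" "mps_coeff f a \<noteq> 0" "mps_coeff g b \<noteq> 0"
    by (auto split: prod.splits) (metis mult_zero_left mult_zero_right)
  then show "size m = d + e"
    using assms by (auto simp: mps_homogeneous_def)
qed

lemma mps_homogeneous_power: "mps_homogeneous d f \<Longrightarrow> mps_homogeneous (k * d) (f ^ k)"
  by (induction k) (auto intro: mps_homogeneous_one mps_homogeneous_mult)

lemma mps_homogeneous_prod:
  "(\<And>i. i \<in> I \<Longrightarrow> mps_homogeneous (d i) (F i)) \<Longrightarrow> mps_homogeneous (\<Sum>i\<in>I. d i) (\<Prod>i\<in>I. F i)"
  by (induction I rule: infinite_finite_induct)
     (auto intro: mps_homogeneous_one mps_homogeneous_mult)

lemma mps_homogeneous_sum:
  "(\<And>i. i \<in> I \<Longrightarrow> mps_homogeneous d (F i)) \<Longrightarrow> mps_homogeneous d (\<Sum>i\<in>I. F i)"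
proof (induction I rule: infinite_finite_induct)
  case (insert i I)
  then have "mps_homogeneous d (F i)" "mps_homogeneous d (\<Sum>i\<in>I. F i)"
    by auto
  then show ?case
    using insert.hyps by (auto simp: mps_homogeneous_def plus_mps_def) (metis add_0)
qed (auto simp: mps_homogeneous_def zero_mps_def)

lemma sum_mset_eq_sum_count: "sum_mset M = (\<Sum>i\<in>set_mset M. i * count M i)" for M :: "nat multiset"
proof -
  have "sum_mset N = (\<Sum>i\<in>set_mset M. i * count N i)" if "set_mset N \<subseteq> set_mset M" for N
    using that
  proof (induction N)
    case (add k N)
    have "(\<Sum>i\<in>set_mset M. i * count (add_mset k N) i) =
        (\<Sum>i\<in>set_mset M. i * count N i + (if i = k then i else 0))"
      by (rule sum.cong) auto
    with add show ?case
      by (simp add: sum.distrib)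
  qed simp
  then show ?thesis
    by simp
qed

lemma mps_homogeneous_s_monomial:
  assumes "lam \<in> bipartitions n"
  shows "mps_homogeneous n (s_monomial lam)"
proof -
  have "mps_homogeneous
      (\<Sum>\<epsilon>\<in>{Pos, Neg}. \<Sum>i\<in>set_mset (lam \<epsilon>). (i * count (lam \<epsilon>) i) * Suc 0) (s_monomial lam)"
    unfolding s_monomial_def
    by (intro mps_homogeneous_prod mps_homogeneous_power mps_homogeneous_var)
  then show ?thesis
    using assms by (simp add: bipartitions_def sum_mset_eq_sum_count)
qed

lemma mps_homogeneous_t_monomial:
  assumes "mu \<in> bipartitions n"
  shows "mps_homogeneous n (t_monomial mu)"
proof -
  have "mps_homogeneous
      (\<Sum>\<theta>\<in>{Pos, Neg}. \<Sum>j\<in>set_mset (mu \<theta>). (j * count (mu \<theta>) j) * Suc 0) (t_monomial mu)"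
    unfolding t_monomial_def
    by (intro mps_homogeneous_prod mps_homogeneous_power mps_homogeneous_var)
  then show ?thesis
    using assms by (simp add: bipartitions_def sum_mset_eq_sum_count)
qed

lemma lhs_locally_finite:
  "mps_locally_finite UNIV (\<lambda>n. \<Sum>lam\<in>bipartitions n. \<Sum>mu\<in>bipartitions n.
     mps_const (c n lam mu) * s_monomial lam * t_monomial mu)"
  (is "mps_locally_finite UNIV ?F")
  unfolding mps_locally_finite_def
proof
  fix m
  have hom: "mps_homogeneous (0 + n + n) (?F n)" for n
    by (intro mps_homogeneous_sum mps_homogeneous_mult mps_homogeneous_const
        mps_homogeneous_s_monomial mps_homogeneous_t_monomial)
  have "{n \<in> UNIV. mps_coeff (?F n) m \<noteq> 0} \<subseteq> {..size m}"
    using hom by (fastforce simp: mps_homogeneous_def)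
  then show "finite {n \<in> UNIV. mps_coeff (?F n) m \<noteq> 0}"
    by (rule finite_subset) simp
qed

lemma rhs_degree:
  assumes nz: "mps_coeff (\<Sum>e | e dvd gcd i j. mps_const (c i \<epsilon> j \<theta> e)
       * (mps_var (S i \<epsilon>) * mps_var (T j \<theta>)) ^ (i * j div e)) m \<noteq> 0"
    (is "mps_coeff ?F m \<noteq> 0")
    and ij: "1 \<le> i" "1 \<le> j"
  shows "max i j \<le> size m"
proof (rule ccontr)
  assume less: "\<not> max i j \<le> size m"
  have "mps_coeff (mps_const (c i \<epsilon> j \<theta> e) *
      (mps_var (S i \<epsilon>) * mps_var (T j \<theta>)) ^ (i * j div e)) m = 0"
    if e: "e dvd gcd i j" for e
  proof (rule ccontr)
    assume "\<not> ?thesis"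
    moreover have "mps_homogeneous (0 + (i * j div e) * (Suc 0 + Suc 0))
       (mps_const (c i \<epsilon> j \<theta> e) * (mps_var (S i \<epsilon>) * mps_var (T j \<theta>)) ^ (i * j div e))"
      by (intro mps_homogeneous_mult mps_homogeneous_power mps_homogeneous_const
          mps_homogeneous_var)
    ultimately have "size m = (i * j div e) * 2"
      by (auto simp: mps_homogeneous_def)
    moreover obtain a b where ab: "i = e * a" "j = e * b"
      using e by (auto elim!: dvdE)
    then have "i * j div e = e * a * b"
      using ij by (auto simp: ac_simps)
    moreover have "e * a \<le> e * a * b" "e * b \<le> e * a * b"
      using ij ab by auto
    ultimately show False
      using less ab by auto
  qed
  then have "mps_coeff ?F m = 0"
    by (auto simp: mps_coeff_sum)
  with nz show False by simp
qed

lemma rhs_locally_finite: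
  "mps_locally_finite {((i, \<epsilon>), (j, \<theta>)). 1 \<le> i \<and> 1 \<le> j} (\<lambda>((i, \<epsilon>), (j, \<theta>)).
     \<Sum>e | e dvd gcd i j. mps_const (c i \<epsilon> j \<theta> e)
       * (mps_var (S i \<epsilon>) * mps_var (T j \<theta>)) ^ (i * j div e))"
  (is "mps_locally_finite ?I ?F")
  unfolding mps_locally_finite_def
proof
  fix m
  have UNIV: "UNIV = {Pos, Neg}"
    using z2class.exhaust by auto
  have "{p \<in> ?I. mps_coeff (?F p) m \<noteq> 0} \<subseteq> ({..size m} \<times> UNIV) \<times> ({..size m} \<times> UNIV)"
  proof
    fix p assume p: "p \<in> {p \<in> ?I. mps_coeff (?F p) m \<noteq> 0}"
    obtain i \<epsilon> j \<theta> where [simp]: "p = ((i, \<epsilon>), (j, \<theta>))"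
      by (metis prod.exhaust)
    have "max i j \<le> size m"
      by (rule rhs_degree[of c i \<epsilon> j \<theta>]) (use p in auto)
    then show "p \<in> ({..size m} \<times> UNIV) \<times> ({..size m} \<times> UNIV)"
      by simp
  qed
  then show "finite {p \<in> ?I. mps_coeff (?F p) m \<noteq> 0}"
    by (rule finite_subset) (simp add: UNIV)
qed

lemma rhs_no_constant_term:
  "mps_coeff (mps_sum {((i, \<epsilon>), (j, \<theta>)). 1 \<le> i \<and> 1 \<le> j} (\<lambda>((i, \<epsilon>), (j, \<theta>)).
     \<Sum>e | e dvd gcd i j. mps_const (c i \<epsilon> j \<theta> e)
       * (mps_var (S i \<epsilon>) * mps_var (T j \<theta>)) ^ (i * j div e))) {#} = 0"
  (is "mps_coeff (mps_sum ?I ?F) {#} = 0")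
  unfolding mps_sum_def mps_coeff_Abs
proof (rule sum.neutral, rule ballI)
  fix p assume p: "p \<in> {p \<in> ?I. mps_coeff (?F p) {#} \<noteq> 0}"
  obtain i \<epsilon> j \<theta> where [simp]: "p = ((i, \<epsilon>), (j, \<theta>))"
    by (metis prod.exhaust)
  have "max i j \<le> size ({#} :: indet multiset)"
    by (rule rhs_degree[of c i \<epsilon> j \<theta>]) (use p in auto)
  moreover have "1 \<le> i"
    using p by simp
  ultimately have False
    by simp
  then show "mps_coeff (?F p) {#} = 0" ..
qed

lemma mps_exp_locally_finite:
  fixes f :: "('v, complex) mps"
  assumes "mps_coeff f {#} = 0"
  shows "mps_locally_finite UNIV (\<lambda>k :: nat. mps_const (1 / fact k) * f ^ k)"
proof -
  have pow: "k \<le> size m" if "mps_coeff (f ^ k) m \<noteq> 0" for k m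
    using that
  proof (induction k arbitrary: m)
    case (Suc k)
    then have "mps_coeff (f * f ^ k) m \<noteq> 0"
      by simp
    then obtain p where p: "p \<in> {(a, b). a + b = m}"
        "(case p of (a, b) \<Rightarrow> mps_coeff f a * mps_coeff (f ^ k) b) \<noteq> 0"
      unfolding times_mps_def mps_coeff_Abs by (rule sum.not_neutral_contains_not_neutral)
    then obtain a b where ab: "a + b = m" "mps_coeff f a \<noteq> 0" "mps_coeff (f ^ k) b \<noteq> 0"
      by (cases p) fastforce
    have "0 < size a"
      using ab(2) assms by (cases "a = {#}") (auto simp: nonempty_has_size)
    then show ?case
      using Suc.IH[OF ab(3)] ab(1) by auto
  qed simp
  have *: "k \<le> size m" if nz: "mps_coeff (mps_const (1 / fact k) * f ^ k) m \<noteq> 0" for k m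
  proof -
    obtain p where p: "p \<in> {(a, b). a + b = m}"
        "(case p of (a, b) \<Rightarrow> mps_coeff (mps_const (1 / fact k)) a * mps_coeff (f ^ k) b) \<noteq> 0"
      using nz unfolding times_mps_def mps_coeff_Abs
      by (rule sum.not_neutral_contains_not_neutral)
    then show ?thesis
      using pow[of k "snd p"] by auto
  qed
  show ?thesis
    unfolding mps_locally_finite_def
  proof
    fix m
    have "{k \<in> UNIV. mps_coeff (mps_const (1 / fact k) * f ^ k) m \<noteq> 0} \<subseteq> {..size m}"
      using * by blast
    then show "finite {k \<in> UNIV. mps_coeff (mps_const (1 / fact k) * f ^ k) m \<noteq> 0}"
      by (rule finite_subset) simp
  qed
qed

end

theory Submission
  imports Defs
begin

text \<open>
  Every element of the class of \<open>\<mu>\<close> in \<open>Z(x)\<close> is \<open>k\<^sup>-\<^sup>1 g k\<close> for exactly \<open>|Z(g)|\<close> elements \<open>k\<close>, so for fixed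
  \<open>\<lambda>\<close> the left-hand side is \<open>\<Sum> \<omega>(z) s\<^sup>\<lambda> t\<^sup>z / |Z(x)|\<close>, summed over \<open>z \<in> Z(x)\<close>. This average is computed by
  induction on the set of signed cycles (blocks) of \<open>x\<close>. Fix a block with base point \<open>a\<close> in the
  transversal, of type \<open>(i, \<epsilon>)\<close>, and let \<open>z\<close> return \<open>a\<close> to its block for the first time after \<open>k\<close> steps,
  at the point \<open>q\<close>. Composing with the exchange of \<open>a\<close> and a point of another block, on which \<open>\<omega>\<close> is
  trivial, inserts that block into the cycle without changing \<open>q\<close>, the rest of \<open>z\<close> or \<open>\<omega>(z)\<close>; hence all
  values of \<open>k\<close> and \<open>q\<close> are equally likely. The sum over \<open>q\<close> is a Ramanujan sum, which produces
  \<open>K(e)\<close>, and the resulting recursion in the multiplicity of \<open>(i, \<epsilon>)\<close> is the one that the derivation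
  \<open>s \<partial>/\<partial>s\<close>, \<open>s = s\<^sub>i\<^sub>,\<^sub>\<epsilon>\<close>, gives for the coefficients of the exponential.
\<close>

section \<open>Ramanujan sums\<close>

text \<open>The wreath product structure of a centralizer is never built. Its place is taken by
  \<open>comm w Y\<close>, the centralizer of \<open>w\<close> among the signed permutations of a
  union \<open>Y\<close> of blocks: removing a block leaves a group of the same kind, and the
  remaining entries need no renumbering. All sums are then governed by orbit-stabilizer for one
  point \<open>a\<close>.

  Origin of the constant \<open>2ij/e\<close>: a block of length \<open>l\<close> has
  \<open>2l\<close> points, so if \<open>Y\<close> has \<open>b\<close> blocks of the type of
  \<open>a\<close>, the order of \<open>comm w Y\<close> is \<open>2lb\<close> times that of
  \<open>comm w (Y - block w a)\<close>. In the logarithm put \<open>j = ke\<close>. The exponent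
  \<open>ij/e\<close> becomes \<open>ik\<close>, where \<open>k\<close> is the number of blocks in a
  cycle, and \<open>s \<partial>/\<partial>s\<close> multiplies by this exponent, which leaves the
  coefficient \<open>K(e)/2\<close>. After doubling, the equation for the derivative of the
  exponential carries the factor \<open>2ib\<close> on its left, the same as the orbit length for
  \<open>l = i\<close>.\<close>

lemma UNIV_z2class: "(UNIV :: z2class set) = {Pos, Neg}"
  using z2class.exhaust by auto

section \<open>The Moebius function on multiples of a prime and its divisor sums\<close>

lemma moebius_mu_prime_mult:
  assumes p: "prime p" and e: "e > 0"
  shows "moebius_mu (p * e) = (if p dvd e then 0 else - moebius_mu e)"
proof (cases "p dvd e")
  case True
  then have "p ^ 2 dvd p * e"
    by (simp add: power2_eq_square)
  with p True show ?thesis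
    by (auto simp: moebius_mu_def squarefree_def dest: prime_gt_1_nat)
next
  case False
  then have cop: "coprime p e"
    using p by (simp add: prime_imp_coprime)
  have "prime_factors (p * e) = insert p (prime_factors e)"
    using p e by (subst prime_factors_product) (auto simp: prime_prime_factors)
  moreover have "p \<notin> prime_factors e"
    using False by auto
  moreover have "squarefree (p * e) \<longleftrightarrow> squarefree e"
    using squarefree_mult_coprime[OF cop squarefree_prime[OF p]] squarefree_multD(2) by blast
  ultimately show ?thesis
    using False by (simp add: moebius_mu_def)
qed

text \<open>For a prime \<open>p\<close> dividing \<open>n\<close>, the divisors \<open>e\<close>
  not divisible by \<open>p\<close> pair off with the divisors \<open>p * e\<close>, and each pair
  cancels. The divisors that are left contain \<open>p\<close> twice and contribute 0.\<close>

lemma sum_moebius_mu_divisors: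
  assumes "n > 0"
  shows "(\<Sum>e | e dvd n. moebius_mu e) = (if n = 1 then 1 else 0)"
proof (cases "n = 1")
  case True
  then show ?thesis by (simp add: moebius_mu_def)
next
  case False
  then obtain p where p: "prime p" "p dvd n"
    using prime_factor_nat by blast
  have fin: "finite {e. e dvd n}"
    using assms by simp
  have split: "{e. e dvd n} = {e. e dvd n \<and> \<not> p dvd e} \<union> {e. e dvd n \<and> p dvd e}"
    by auto
  have "(\<Sum>e | e dvd n \<and> p dvd e. moebius_mu e) =
      (\<Sum>e\<in>(*) p ` {e. e dvd n \<and> \<not> p dvd e}. moebius_mu e)"
  proof (rule sum.mono_neutral_right)
    show "(*) p ` {e. e dvd n \<and> \<not> p dvd e} \<subseteq> {e. e dvd n \<and> p dvd e}"
      using p by (auto intro!: divides_mult prime_imp_coprime)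
    show "\<forall>e\<in>{e. e dvd n \<and> p dvd e} - (*) p ` {e. e dvd n \<and> \<not> p dvd e}. moebius_mu e = 0"
    proof
      fix e assume e: "e \<in> {e. e dvd n \<and> p dvd e} - (*) p ` {e. e dvd n \<and> \<not> p dvd e}"
      then obtain f where f: "e = p * f"
        by auto
      have "e > 0"
        using e assms by (auto intro: Nat.gr0I)
      have "f dvd n"
        using e f by (auto dest: dvd_mult_right)
      then have "p dvd f"
        using e f by auto
      then show "moebius_mu e = 0"
        using moebius_mu_prime_mult[OF p(1), of f] f \<open>e > 0\<close> by simp
    qed
  qed (use fin in auto)
  also have "\<dots> = (\<Sum>e | e dvd n \<and> \<not> p dvd e. moebius_mu (p * e))"
    using p(1) by (subst sum.reindex) (auto simp: inj_on_def dest: prime_gt_0_nat)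
  also have "\<dots> = (\<Sum>e | e dvd n \<and> \<not> p dvd e. - moebius_mu e)"
    using p(1) assms by (intro sum.cong refl) (auto simp: moebius_mu_prime_mult intro!: Nat.gr0I)
  finally show ?thesis
    using False fin by (subst split, subst sum.union_disjoint) (auto simp: sum_negf)
qed

section \<open>Sums of powers of a primitive root of unity\<close>

definition primitive_root :: "nat \<Rightarrow> complex \<Rightarrow> bool" where
  "primitive_root d \<eta> \<longleftrightarrow> d > 0 \<and> (\<forall>m. \<eta> ^ m = 1 \<longleftrightarrow> d dvd m)"

lemma primitive_root_power:
  assumes "primitive_root (g * d) \<zeta>"
  shows "primitive_root d (\<zeta> ^ g)"
  using assms by (auto simp: primitive_root_def simp flip: power_mult)

lemma sum_all_powers:
  assumes "primitive_root d \<eta>"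
  shows "(\<Sum>r<d. \<eta> ^ r) = (if d = 1 then 1 else 0)"
proof (cases "d = 1")
  case False
  then have "\<eta> \<noteq> 1"
    using assms by (auto simp: primitive_root_def dest: spec[of _ 1])
  moreover have "\<eta> ^ d = 1"
    using assms by (auto simp: primitive_root_def)
  ultimately show ?thesis
    using False by (simp add: sum_gp_strict)
qed auto

lemma sum_if_lessThan:
  fixes f :: "nat \<Rightarrow> 'a :: comm_monoid_add"
  shows "(\<Sum>r<n. if P r then f r else 0) = (\<Sum>r | r < n \<and> P r. f r)"
  by (simp add: sum.inter_filter[symmetric])

lemma sum_lessThan_double:
  fixes f :: "nat \<Rightarrow> 'a :: comm_monoid_add"
  shows "(\<Sum>r<2 * n. f r) = (\<Sum>r<n. f r + f (r + n))"
proof -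
  have "(\<Sum>r<2 * n. f r) = (\<Sum>r<n. f r) + (\<Sum>r\<in>{n..<2 * n}. f r)"
    by (subst sum.union_disjoint[symmetric]) (auto intro!: sum.cong)
  also have "(\<Sum>r\<in>{n..<2 * n}. f r) = (\<Sum>r<n. f (r + n))"
    by (rule sum.reindex_bij_witness[where i = "\<lambda>r. r + n" and j = "\<lambda>r. r - n"]) auto
  finally show ?thesis by (simp add: sum.distrib)
qed

lemma gcd_mult_coprime:
  "coprime r d \<Longrightarrow> gcd (g * r) (d * g) = (g :: nat)"
  by (metis coprime_imp_gcd_eq_1 gcd_mult_distrib_nat mult.commute mult.right_neutral)

text \<open>Read \<open>r\<close> as the fraction \<open>r / n\<close>: its reduced form has a
  denominator \<open>d\<close> dividing \<open>n\<close> and a numerator coprime to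
  \<open>d\<close>. The value \<open>r = 0\<close> is the fraction \<open>0 / 1\<close>, since 0 is
  coprime to 1.\<close>

lemma sum_by_gcd:
  fixes f :: "nat \<Rightarrow> 'a :: comm_monoid_add"
  assumes "n > 0"
  shows "(\<Sum>r<n. f r) = (\<Sum>d | d dvd n. \<Sum>r | r < d \<and> coprime r d. f (n div d * r))"
proof -
  have "(\<Sum>d | d dvd n. \<Sum>r | r < d \<and> coprime r d. f (n div d * r)) =
      (\<Sum>(d, r)\<in>(SIGMA d:{d. d dvd n}. {r. r < d \<and> coprime r d}). f (n div d * r))"
    using assms by (subst sum.Sigma) auto
  also have "\<dots> = (\<Sum>r<n. f r)"
  proof (rule sum.reindex_bij_witness[where
        i = "\<lambda>r. (n div gcd r n, r div gcd r n)" and j = "\<lambda>(d, r). n div d * r"], goal_cases)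
    case (1 a)
    then obtain d r where a: "a = (d, r)" "d dvd n" "r < d" "coprime r d" by auto
    then obtain g where n: "n = d * g" by auto
    then have "gcd (g * r) n = g"
      using a by (simp add: gcd_mult_coprime)
    then show ?case
      using a n assms by auto
  next
    case (2 a)
    then obtain d r where a: "a = (d, r)" "d dvd n" "r < d" "coprime r d" by auto
    then obtain g where n: "n = d * g" by auto
    then show ?case
      using a assms by (auto simp: mult.commute)
  next
    case (3 r)
    define g where "g = gcd r n"
    have "g > 0" "g dvd r" "g dvd n" using assms by (auto simp: g_def)
    then obtain r' n' where "r = g * r'" "n = g * n'" by (auto elim!: dvdE)
    then show ?case
      unfolding g_def[symmetric] using assms \<open>g > 0\<close> by simp
  next
    case (4 r)
    define g where "g = gcd r n"
    have "g > 0" "g dvd r" "g dvd n" using assms by (auto simp: g_def)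
    then obtain r' n' where *: "r = g * r'" "n = g * n'" by (auto elim!: dvdE)
    moreover have "coprime (r div g) (n div g)"
      unfolding g_def using assms by (intro div_gcd_coprime) auto
    ultimately show ?case
      unfolding g_def[symmetric] using 4 assms \<open>g > 0\<close> by simp
  next
    case (5 a)
    then show ?case by auto
  qed
  finally show ?thesis ..
qed

text \<open>Both sides have the same divisor sums, 1 at \<open>d = 1\<close> and 0 otherwise: on the
  left by grouping all powers of \<eta> with \<open>sum_by_gcd\<close>, on the right by Moebius
  cancellation. Strong induction cancels the proper divisors \<open>e\<close>, for which
  \<open>\<eta> ^ (d div e)\<close> is primitive of order \<open>e\<close>.\<close>

lemma sum_primitive_powers:
  assumes "primitive_root d \<eta>"
  shows "(\<Sum>r | r < d \<and> coprime r d. \<eta> ^ r) = of_int (moebius_mu d)"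
  using assms
proof (induction d arbitrary: \<eta> rule: less_induct)
  case (less d)
  then have d: "d > 0" by (simp add: primitive_root_def)
  let ?c = "\<lambda>e \<eta>. \<Sum>r | r < e \<and> coprime r e. \<eta> ^ r :: complex"
  have ins: "{e. e dvd d} = insert d {e. e dvd d \<and> e < d}"
    using d by (auto dest: dvd_imp_le)
  have "(if d = 1 then 1 else 0) = (\<Sum>r<d. \<eta> ^ r)"
    using less.prems by (rule sum_all_powers[symmetric])
  also have "\<dots> = (\<Sum>e | e dvd d. ?c e (\<eta> ^ (d div e)))"
    using d by (subst sum_by_gcd) (auto simp: power_mult)
  also have "\<dots> = ?c d \<eta> + (\<Sum>e | e dvd d \<and> e < d. ?c e (\<eta> ^ (d div e)))"
    using d by (subst ins, subst sum.insert) auto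
  also have "(\<Sum>e | e dvd d \<and> e < d. ?c e (\<eta> ^ (d div e))) =
      (\<Sum>e | e dvd d \<and> e < d. of_int (moebius_mu e))"
    using less.prems by (intro sum.cong refl less.IH primitive_root_power) auto
  finally have 1: "(if d = 1 then 1 else 0) =
      ?c d \<eta> + of_int (\<Sum>e | e dvd d \<and> e < d. moebius_mu e)" by simp
  have "(if d = 1 then 1 else 0) = moebius_mu d + (\<Sum>e | e dvd d \<and> e < d. moebius_mu e)"
    using sum_moebius_mu_divisors[OF d] d by (subst (asm) ins, subst (asm) sum.insert) auto
  then have "of_int (if d = 1 then 1 else 0) =
      of_int (moebius_mu d) + (of_int (\<Sum>e | e dvd d \<and> e < d. moebius_mu e) :: complex)"
    by (simp only: of_int_add)
  with 1 show ?case by (simp only: of_int_0 of_int_1 if_distrib[of of_int] add_right_cancel)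
qed

lemma moebius_mu_double:
  "e > 0 \<Longrightarrow> moebius_mu (2 * e) = (if even e then 0 else - moebius_mu e)"
  by (rule moebius_mu_prime_mult) auto

text \<open>The pair \<open>r\<close>, \<sigma> stands for the point
  \<open>(- 1) ^ \<sigma> * (w ^^ r) a\<close> of a block of class \<open>Pos\<close>, and
  \<open>d = i div gcd r i\<close> is the length of the rotation to it. The exponents
  \<open>r\<close> with a given \<open>d\<close> sum to \<mu>(d). For even \<open>d\<close> both
  signs give class \<open>Pos\<close>, and \<mu>(2d) = 0, so the coefficient is 2\<mu>(d). For odd
  \<open>d\<close> each class arises from one sign, and \<mu>(2d) = -\<mu>(d) makes both values of
  \<open>K\<close> equal to \<mu>(d).\<close>

lemma character_sum_Pos:
  fixes h :: "nat \<Rightarrow> z2class \<Rightarrow> complex"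
  assumes "primitive_root i \<zeta>"
  shows "(\<Sum>r<i. \<Sum>\<sigma><2. \<zeta> ^ r * h (i div gcd r i) (if odd (\<sigma> * (i div gcd r i)) then Neg else Pos))
    = (\<Sum>d | d dvd i. \<Sum>\<theta>\<in>UNIV. K Pos \<theta> d * h d \<theta>)" (is "?L = ?R")
proof -
  let ?H = "\<lambda>d. (\<Sum>\<sigma><2. h d (if odd (\<sigma> * d) then Neg else Pos))"
  have i: "i > 0" using assms by (simp add: primitive_root_def)
  have eq: "i div gcd (i div d * r) i = d" if d: "d dvd i" "coprime r d" for d r
  proof -
    obtain g where n: "i = d * g" using d by auto
    then have "gcd (g * r) i = g"
      using d by (simp add: gcd_mult_coprime)
    then show ?thesis using n i by auto
  qed
  have "?L = (\<Sum>d | d dvd i. \<Sum>r | r < d \<and> coprime r d. (\<zeta> ^ (i div d)) ^ r *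
      ?H d)"
    unfolding sum_by_gcd[OF i] by (intro sum.cong refl) (auto simp: eq sum_distrib_left power_mult)
  also have "\<dots> = (\<Sum>d | d dvd i. of_int (moebius_mu d) *
      ?H d)"
    using assms by (intro sum.cong refl, subst sum_distrib_right[symmetric], subst sum_primitive_powers)
      (auto intro: primitive_root_power)
  also have "\<dots> = ?R"
  proof (intro sum.cong refl)
    fix d assume "d \<in> {d. d dvd i}"
    then have "d > 0" using i by (auto intro!: Nat.gr0I)
    moreover have "(\<Sum>\<sigma><2. f \<sigma>) = f 0 + f (Suc 0)" for f :: "nat \<Rightarrow> complex"
      by (simp add: numeral_2_eq_2)
    ultimately show "of_int (moebius_mu d) * ?H d =
        (\<Sum>\<theta>\<in>UNIV. K Pos \<theta> d * h d \<theta>)"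
      by (cases "even d") (simp_all add: K_def UNIV_z2class moebius_mu_double distrib_left)
  qed
  finally show ?thesis .
qed

text \<open>In class \<open>Neg\<close> the powers \<open>w ^^ r\<close> with
  \<open>r < 2 * i\<close> already reach the whole block, and \<open>r\<close> and
  \<open>r + i\<close> have the same gcd with \<open>i\<close>. For a fixed \<open>d\<close> this
  leaves the exponents below \<open>2 * d\<close> coprime to \<open>d\<close>, for a root of order
  \<open>2 * d\<close>. The odd ones are coprime to \<open>2 * d\<close>, have class
  \<open>Neg\<close> and sum to \<mu>(2d). Even ones exist only for odd \<open>d\<close>; they are
  powers of the square of the root, of order \<open>d\<close>, and sum to \<mu>(d) =
  -\<mu>(2d).\<close>

lemma character_sum_Neg:
  fixes h :: "nat \<Rightarrow> z2class \<Rightarrow> complex"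
  assumes "primitive_root (2 * i) \<zeta>"
  shows "(\<Sum>r<2 * i. \<zeta> ^ r * h (i div gcd r i) (if odd (r div gcd r i) then Neg else Pos))
    = (\<Sum>d | d dvd i. \<Sum>\<theta>\<in>UNIV. K Neg \<theta> d * h d \<theta>)" (is "?L = ?R")
proof -
  have i: "i > 0" using assms by (simp add: primitive_root_def)
  have eq: "gcd (i div d * r) i = i div d" if d: "d dvd i" "coprime r d" for d r
  proof -
    obtain g where n: "i = d * g" using d by auto
    then show ?thesis
      using d i by (simp add: gcd_mult_coprime)
  qed
  let ?s = "\<lambda>r. if odd r then Neg else Pos"
  have "?L = (\<Sum>r<i. \<zeta> ^ r * h (i div gcd r i) (?s (r div gcd r i)) +
       \<zeta> ^ (r + i) * h (i div gcd r i) (?s (r div gcd r i + i div gcd r i)))"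
    by (subst sum_lessThan_double) (auto intro!: sum.cong simp: div_plus_div_distrib_dvd_right)
  also have "\<dots> = (\<Sum>d | d dvd i. \<Sum>r | r < d \<and> coprime r d.
       (\<zeta> ^ (i div d)) ^ r * h d (?s r) + (\<zeta> ^ (i div d)) ^ (r + d) * h d (?s (r + d)))"
    unfolding sum_by_gcd[OF i]
  proof (intro sum.cong refl, goal_cases)
    case (1 d r)
    then obtain g where g: "i = d * g" "g > 0" "d > 0" using i by auto
    have "gcd (g * r) (d * g) = g"
      using eq[of d r] 1 g by simp
    then show ?case
      using g by (simp add: power_mult[symmetric] power_add algebra_simps)
  qed
  also have "\<dots> = ?R"
  proof (intro sum.cong refl)
    fix d assume "d \<in> {d. d dvd i}"
    then have d: "d > 0" and prim: "primitive_root (2 * d) (\<zeta> ^ (i div d))" (is "primitive_root _ ?\<eta>")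
      using i assms by (auto intro!: Nat.gr0I primitive_root_power simp: mult.left_commute[of _ 2])
    have "(\<Sum>r | r < d \<and> coprime r d. ?\<eta> ^ r * h d (?s r) + ?\<eta> ^ (r + d) * h d (?s (r + d))) =
      (\<Sum>r<2 * d. if coprime r d then ?\<eta> ^ r * h d (?s r) else 0)"
      unfolding sum_if_lessThan[symmetric] sum_lessThan_double
      by (intro sum.cong refl) (auto simp: coprime_iff_gcd_eq_1)
    also have "\<dots> = (\<Sum>r | r < 2 * d \<and> coprime r (2 * d). ?\<eta> ^ r) * h d Neg +
       (\<Sum>r<2 * d. if coprime r d \<and> even r then ?\<eta> ^ r * h d Pos else 0)"
    proof -
      have "(\<Sum>r | r < 2 * d \<and> coprime r (2 * d). ?\<eta> ^ r) * h d Neg =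
        (\<Sum>r<2 * d. if coprime r (2 * d) then ?\<eta> ^ r * h d Neg else 0)"
        unfolding sum_if_lessThan[symmetric] sum_distrib_right by (intro sum.cong refl) simp
      then show ?thesis
        by (simp only: sum.distrib[symmetric]) (intro sum.cong refl, auto)
    qed
    also have "(\<Sum>r<2 * d. if coprime r d \<and> even r then ?\<eta> ^ r * h d Pos else 0) =
       (\<Sum>r<d. if coprime (2 * r) d then ?\<eta> ^ (2 * r) * h d Pos else 0)"
    proof -
      have "(\<Sum>r<2 * d. if coprime r d \<and> even r then ?\<eta> ^ r * h d Pos else 0) =
        (\<Sum>r\<in>(*) 2 ` {..<d}. if coprime r d \<and> even r then ?\<eta> ^ r * h d Pos else 0)"
        by (rule sum.mono_neutral_right) (auto elim!: evenE)
      then show ?thesis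
        by (subst (asm) sum.reindex) (auto simp: inj_on_def)
    qed
    also have "\<dots> = (if even d then 0 else \<Sum>r | r < d \<and> coprime r d. (?\<eta> ^ 2) ^ r) * h d Pos"
      unfolding sum_if_lessThan[symmetric]
      by (cases "even d") (auto simp: sum_distrib_right power_mult intro!: sum.cong)
    also have "(\<Sum>r | r < d \<and> coprime r d. (?\<eta> ^ 2) ^ r) = of_int (moebius_mu d)"
      using primitive_root_power[of 2 d, OF prim] by (rule sum_primitive_powers)
    also have "(\<Sum>r | r < 2 * d \<and> coprime r (2 * d). ?\<eta> ^ r) = of_int (moebius_mu (2 * d))"
      using prim by (rule sum_primitive_powers)
    finally show "(\<Sum>r | r < d \<and> coprime r d. ?\<eta> ^ r * h d (?s r) + ?\<eta> ^ (r + d) * h d (?s (r + d))) =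
        (\<Sum>\<theta>\<in>UNIV. K Neg \<theta> d * h d \<theta>)"
      using d by (simp add: K_def UNIV_z2class moebius_mu_double)
  qed
  finally show ?thesis .
qed

section \<open>Monomials, the Euler derivations and the exponential\<close>

lemma mps_coeff_simps [simp]:
  "mps_coeff 0 m = 0"
  "mps_coeff (f + g) m = mps_coeff f m + mps_coeff g m"
  by (simp_all add: zero_mps_def plus_mps_def)

definition mps_monom :: "'v multiset \<Rightarrow> ('v, 'a :: comm_ring_1) mps" where
  "mps_monom M = Abs_mps (\<lambda>m. if m = M then 1 else 0)"

lemma mps_coeff_mult: "mps_coeff (f * g) m = (\<Sum>(a, b)\<in>{(a, b). a + b = m}. mps_coeff f a * mps_coeff g b)"
  by (simp add: times_mps_def)

lemma mps_coeff_monom_mult: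
  "mps_coeff (mps_monom M * f) m = (if M \<subseteq># m then mps_coeff f (m - M) else 0)"
proof -
  have "mps_coeff (mps_monom M * f) m =
      (\<Sum>(a, b)\<in>{(a, b). a + b = m} \<inter> {p. fst p = M}. mps_coeff f b)"
    unfolding mps_coeff_mult mps_monom_def
    by (rule sum.mono_neutral_cong_right) (auto split: if_splits)
  also have "{(a, b). a + b = m} \<inter> {p. fst p = M} = (if M \<subseteq># m then {(M, m - M)} else {})"
    by auto
  finally show ?thesis
    by auto
qed

lemma mps_coeff_const_mult [simp]:
  fixes f :: "('v, 'a :: comm_ring_1) mps"
  shows "mps_coeff (mps_const c * f) m = c * mps_coeff f m"
proof -
  have "mps_coeff (mps_const c * f) m = (\<Sum>(a, b)\<in>{({#} :: 'v multiset, m)}. c * mps_coeff f b)"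
    unfolding mps_coeff_mult mps_const_def
    by (rule sum.mono_neutral_cong_right) (auto split: if_splits)
  then show ?thesis by simp
qed

lemma mps_const_mult: "mps_const (a * b) = mps_const a * mps_const b"
  by (rule mps_eqI, subst mps_coeff_const_mult) (simp add: mps_const_def)

lemma mps_const_1 [simp]: "mps_const 1 = 1"
  by (simp add: mps_const_def one_mps_def)

lemma mps_monom_mult: "mps_monom (A + B) = mps_monom A * mps_monom B"
  by (rule mps_eqI, subst mps_coeff_monom_mult)
    (auto simp: mps_monom_def subset_mset.add_diff_inverse)

lemma mps_monom_empty [simp]: "mps_monom {#} = 1"
  by (simp add: mps_monom_def one_mps_def)

lemma mps_var_eq_monom: "mps_var v = mps_monom {#v#}"
  by (simp add: mps_var_def mps_monom_def)

lemma mps_monom_power: "mps_monom A ^ k = mps_monom (repeat_mset k A)"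
  by (induction k) (auto simp: mps_monom_mult)

lemma mps_monom_prod: "(\<Prod>i\<in>I. mps_monom (A i)) = mps_monom (\<Sum>i\<in>I. A i)"
  by (induction I rule: infinite_finite_induct) (auto simp: mps_monom_mult)

lemma mps_of_nat: "of_nat k = mps_const (of_nat k)"
proof (induction k)
  case (Suc k)
  then show ?case
    by (auto intro!: mps_eqI simp: mps_const_def one_mps_def)
qed (auto intro!: mps_eqI simp: mps_const_def)

text \<open>The Euler operator \<open>v \<partial>/\<partial>v\<close>. It is diagonal on monomials,
  so coefficient comparisons are not shifted as they would be for the partial derivative.\<close>

definition mps_deriv :: "'v \<Rightarrow> ('v, 'a :: comm_ring_1) mps \<Rightarrow> ('v, 'a) mps" where
  "mps_deriv v f = Abs_mps (\<lambda>m. of_nat (count m v) * mps_coeff f m)"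

lemma mps_coeff_deriv [simp]: "mps_coeff (mps_deriv v f) m = of_nat (count m v) * mps_coeff f m"
  by (simp add: mps_deriv_def)

lemma mps_deriv_mult: "mps_deriv v (f * g) = mps_deriv v f * g + f * mps_deriv v g"
  by (rule mps_eqI, simp only: mps_coeff_simps mps_coeff_deriv mps_coeff_mult sum_distrib_left
      sum.distrib[symmetric], rule sum.cong) (auto simp: algebra_simps)

lemma mps_deriv_power: "mps_deriv v (f ^ Suc k) = of_nat (Suc k) * mps_deriv v f * f ^ k"
proof (induction k)
  case (Suc k)
  then show ?case
    by (subst power_Suc, subst mps_deriv_mult) (simp add: algebra_simps)
qed simp

lemma mps_coeff_power_eq_0:
  assumes "mps_coeff f {#} = 0" "size m < k"
  shows "mps_coeff (f ^ k) m = 0"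
  using assms(2)
proof (induction k arbitrary: m)
  case (Suc k)
  have "mps_coeff f a * mps_coeff (f ^ k) b = 0" if "a + b = m" for a b
  proof (cases "a = {#}")
    case False
    then have "size b < k" using Suc.prems that by (auto simp: nonempty_has_size)
    then show ?thesis using Suc.IH by simp
  qed (use assms in simp)
  then show ?case
    by (auto simp: mps_coeff_mult intro!: sum.neutral)
qed simp

lemma mps_coeff_mps_sum_superset:
  assumes "finite J" "{i \<in> I. mps_coeff (F i) m \<noteq> 0} \<subseteq> J" "J \<subseteq> I"
  shows "mps_coeff (mps_sum I F) m = (\<Sum>i\<in>J. mps_coeff (F i) m)"
  using assms unfolding mps_sum_def mps_coeff_Abs by (intro sum.mono_neutral_left) auto

text \<open>Without a constant term, \<open>f ^ k\<close> starts in degree \<open>k\<close>, so any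
  cutoff beyond the degree of \<open>m\<close> is exact.\<close>

lemma mps_coeff_exp:
  assumes "mps_coeff f {#} = 0" "size m < N"
  shows "mps_coeff (mps_exp f) m = (\<Sum>k<N. mps_coeff (f ^ k) m / fact k)"
proof -
  have "mps_coeff (mps_exp f) m = (\<Sum>k<N. mps_coeff (mps_const (1 / fact k) * f ^ k) m)"
    unfolding mps_exp_def
    using assms(2) mps_coeff_power_eq_0[OF assms(1), of m]
    by (intro mps_coeff_mps_sum_superset) (auto intro: leI less_le_trans simp: linorder_not_less[symmetric])
  then show ?thesis by simp
qed

lemma mps_deriv_exp:
  fixes f :: "('v, complex) mps"
  assumes "mps_coeff f {#} = 0"
  shows "mps_deriv v (mps_exp f) = mps_deriv v f * mps_exp f"
proof (rule mps_eqI)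
  fix m :: "'v multiset"
  \<comment> \<open>The exponential is cut off at \<open>Suc N\<close>. The derivation kills the
    term \<open>k = 0\<close>, and shifting the index leaves a cutoff at \<open>N\<close>.\<close>
  define N where "N = size m"
  have "mps_coeff (mps_deriv v (mps_exp f)) m =
      (\<Sum>k<Suc N. mps_coeff (mps_deriv v (f ^ k)) m / fact k)"
    by (simp add: mps_coeff_exp[OF assms, of m "Suc N"] N_def sum_distrib_left
        del: sum.lessThan_Suc)
  also have "\<dots> = (\<Sum>k<N. mps_coeff (mps_deriv v (f ^ Suc k)) m / fact (Suc k))"
    by (subst sum.lessThan_Suc_shift) (simp add: one_mps_def)
  also have "\<dots> = (\<Sum>k<N. mps_coeff (mps_deriv v f * f ^ k) m / fact k)"
  proof (intro sum.cong refl)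
    fix k
    have "mps_deriv v (f ^ Suc k) = mps_const (of_nat (Suc k)) * (mps_deriv v f * f ^ k)"
      by (simp only: mps_deriv_power mps_of_nat mult.assoc)
    then show "mps_coeff (mps_deriv v (f ^ Suc k)) m / fact (Suc k) = mps_coeff (mps_deriv v f * f ^ k) m / fact k"
      by (simp only: mps_coeff_const_mult fact_Suc of_nat_mult) (simp del: of_nat_Suc)
  qed
  also have "\<dots> = (\<Sum>(a, b)\<in>{(a, b). a + b = m}. mps_coeff (mps_deriv v f) a *
      (\<Sum>k<N. mps_coeff (f ^ k) b / fact k))"
    unfolding mps_coeff_mult sum_divide_distrib
    by (subst sum.swap) (auto intro!: sum.cong simp: sum_distrib_left)
  also have "\<dots> = mps_coeff (mps_deriv v f * mps_exp f) m"
    unfolding mps_coeff_mult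
  proof (intro sum.cong refl, clarify)
    fix a b assume ab: "m = a + b"
    show "mps_coeff (mps_deriv v f) a * (\<Sum>k<N. mps_coeff (f ^ k) b / fact k) =
      mps_coeff (mps_deriv v f) a * mps_coeff (mps_exp f) b"
    \<comment> \<open>The derivation removes the constant term, so only nonempty \<open>a\<close>
      matter; then \<open>b\<close> has degree below \<open>N\<close> and the cutoff at
      \<open>N\<close> is exact for it.\<close>
    proof (cases "a = {#}")
      case False
      then have "size b < N" using ab by (auto simp: N_def nonempty_has_size)
      then show ?thesis by (simp add: mps_coeff_exp[OF assms, of b N])
    qed simp
  qed
  finally show "mps_coeff (mps_deriv v (mps_exp f)) m = mps_coeff (mps_deriv v f * mps_exp f) m" .
qed

lemma mps_coeff_exp_empty:
  assumes "mps_coeff f {#} = 0"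
  shows "mps_coeff (mps_exp f) {#} = 1"
  by (simp add: mps_coeff_exp[OF assms, of _ 1] one_mps_def)

section \<open>The right-hand side and its components of fixed type\<close>

definition log_series :: "(indet, complex) mps" where
  "log_series = mps_sum {((i, \<epsilon>), (j, \<theta>)). 1 \<le> i \<and> 1 \<le> j} (\<lambda>((i, \<epsilon>), (j, \<theta>)).
     \<Sum>e | e dvd gcd i j. mps_const (K \<epsilon> \<theta> e / (2 * of_nat i * of_nat j / of_nat e))
       * (mps_var (S i \<epsilon>) * mps_var (T j \<theta>)) ^ (i * j div e))"

definition exp_series :: "(indet, complex) mps" where
  "exp_series = mps_exp log_series"

lemma mps_coeff_log_series_empty: "mps_coeff log_series {#} = 0"
  unfolding log_series_def
  using rhs_no_constant_term[of "\<lambda>i \<epsilon> j \<theta> e. K \<epsilon> \<theta> e / (2 * of_nat i * of_nat j / of_nat e)"] by simp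

abbreviation st_monomial :: "nat \<Rightarrow> z2class \<Rightarrow> nat \<Rightarrow> z2class \<Rightarrow> nat \<Rightarrow> indet multiset" where
  "st_monomial i \<epsilon> j \<theta> c \<equiv> replicate_mset c (S i \<epsilon>) + replicate_mset c (T j \<theta>)"

lemma st_power_eq:
  "(mps_var (S i \<epsilon>) * mps_var (T j \<theta>)) ^ c = mps_monom (st_monomial i \<epsilon> j \<theta> c)"
  by (simp add: mps_var_eq_monom mps_monom_mult[symmetric] mps_monom_power add.commute)

text \<open>By \<open>rhs_degree\<close> the degree of a monomial bounds both indices of a summand
  that contains it, which makes the locally finite sum finite.\<close>

lemma mps_coeff_log_series:
  assumes "size m \<le> N"
  shows "mps_coeff log_series m = (\<Sum>i\<in>{1..N}. \<Sum>\<epsilon>\<in>UNIV. \<Sum>j\<in>{1..N}. \<Sum>\<theta>\<in>UNIV. \<Sum>e | e dvd gcd i j.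
    if m = st_monomial i \<epsilon> j \<theta> (i * j div e)
    then K \<epsilon> \<theta> e / (2 * of_nat i * of_nat j / of_nat e) else 0)"
proof -
  let ?F = "\<lambda>((i, \<epsilon>), (j, \<theta>)).
     \<Sum>e | e dvd gcd i j. mps_const (K \<epsilon> \<theta> e / (2 * of_nat i * of_nat j / of_nat e))
       * (mps_var (S i \<epsilon>) * mps_var (T j \<theta>)) ^ (i * j div e)"
  let ?J = "({1..N} \<times> UNIV) \<times> ({1..N} \<times> UNIV) :: ((nat \<times> z2class) \<times> (nat \<times> z2class)) set"
  have fin: "finite (UNIV :: z2class set)"
    by (simp add: UNIV_z2class)
  have "mps_coeff log_series m = (\<Sum>p\<in>?J. mps_coeff (?F p) m)"
    unfolding log_series_def
  proof (rule mps_coeff_mps_sum_superset)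
    show "{p \<in> {((i, \<epsilon>), (j, \<theta>)). 1 \<le> i \<and> 1 \<le> j}. mps_coeff (?F p) m \<noteq> 0} \<subseteq> ?J"
    proof
      fix p assume p: "p \<in> {p \<in> {((i, \<epsilon>), (j, \<theta>)). 1 \<le> i \<and> 1 \<le> j}. mps_coeff (?F p) m \<noteq> 0}"
      obtain i \<epsilon> j \<theta> where [simp]: "p = ((i, \<epsilon>), (j, \<theta>))"
        by (metis prod.exhaust)
      have "max i j \<le> size m"
        by (rule rhs_degree[of "\<lambda>i \<epsilon> j \<theta> e. K \<epsilon> \<theta> e / (2 * of_nat i * of_nat j / of_nat e)" i \<epsilon> j \<theta>])
          (use p in auto)
      then show "p \<in> ?J"
        using p assms by auto
    qed
  qed (use fin in auto)
  also have "\<dots> = (\<Sum>((i, \<epsilon>), (j, \<theta>))\<in>?J. \<Sum>e | e dvd gcd i j.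
    if m = st_monomial i \<epsilon> j \<theta> (i * j div e)
    then K \<epsilon> \<theta> e / (2 * of_nat i * of_nat j / of_nat e) else 0)"
    by (intro sum.cong refl) (auto simp: mps_coeff_sum st_power_eq mps_monom_def intro!: sum.cong)
  also have "\<dots> = (\<Sum>(i, \<epsilon>)\<in>{1..N} \<times> UNIV. \<Sum>(j, \<theta>)\<in>{1..N} \<times> UNIV. \<Sum>e | e dvd gcd i j.
    if m = st_monomial i \<epsilon> j \<theta> (i * j div e)
    then K \<epsilon> \<theta> e / (2 * of_nat i * of_nat j / of_nat e) else 0)"
    by (subst sum.cartesian_product[symmetric]) (auto intro!: sum.cong)
  finally show ?thesis
    by (simp only: sum.cartesian_product[symmetric])
qed

lemma mps_coeff_log_series_nonzero:
  assumes "mps_coeff log_series m \<noteq> 0"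
  obtains i \<epsilon> j \<theta> c where "m = st_monomial i \<epsilon> j \<theta> c" "i dvd c" "c > 0"
proof -
  have "\<exists>i \<epsilon> j \<theta> c. m = st_monomial i \<epsilon> j \<theta> c \<and> i dvd c \<and> c > 0"
  proof (rule ccontr)
    assume *: "\<nexists>i \<epsilon> j \<theta> c. m = st_monomial i \<epsilon> j \<theta> c \<and> i dvd c \<and> c > 0"
    have "m \<noteq> st_monomial i \<epsilon> j \<theta> (i * j div e)" if "e dvd gcd i j" "i > 0" "j > 0" for i j \<epsilon> \<theta> e
    proof -
      have "i * j div e = i * (j div e)" "j div e > 0"
        using that by (auto simp: div_mult_swap elim!: dvdE)
      then have "i dvd i * j div e" "i * j div e > 0"
        using that by simp_all
      then show ?thesis using * by blast
    qed
    then have "mps_coeff log_series m = 0"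
      unfolding mps_coeff_log_series[OF order_refl] by (intro sum.neutral ballI) auto
    with assms show False by simp
  qed
  then show thesis using that by blast
qed

fun is_S :: "indet \<Rightarrow> bool" where
  "is_S (S _ _) = True"
| "is_S (T _ _) = False"

text \<open>Deriving in a variable of \<open>m\<close> splits \<open>m\<close> into a monomial of
  the logarithm and a monomial of the exponential of smaller degree, so both properties are
  inherited from the logarithm. The divisibility makes the s-exponents those of a bipartition; the
  second property makes the component of the empty bipartition equal to 1.\<close>

lemma exp_series_support:
  assumes "mps_coeff exp_series m \<noteq> 0"
  shows "(\<forall>i \<epsilon>. i dvd count m (S i \<epsilon>)) \<and> (filter_mset is_S m = {#} \<longrightarrow> m = {#})"
  using assms
proof (induction "size m" arbitrary: m rule: less_induct)
  case less
  show ?case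
  proof (cases "m = {#}")
    case False
    then obtain v where v: "v \<in># m" by auto
    have "mps_coeff (mps_deriv v exp_series) m \<noteq> 0"
      using v less.prems by auto
    then have "mps_coeff (mps_deriv v log_series * exp_series) m \<noteq> 0"
      using mps_deriv_exp[OF mps_coeff_log_series_empty] by (simp add: exp_series_def)
    then obtain p where p: "p \<in> {(a, b). a + b = m}"
        "(case p of (a, b) \<Rightarrow> mps_coeff (mps_deriv v log_series) a * mps_coeff exp_series b) \<noteq> 0"
      unfolding mps_coeff_mult by (rule sum.not_neutral_contains_not_neutral)
    then obtain a b where ab: "m = a + b" "mps_coeff log_series a \<noteq> 0" "mps_coeff exp_series b \<noteq> 0"
      by (cases p) fastforce
    obtain i \<epsilon> j \<theta> c where a: "a = st_monomial i \<epsilon> j \<theta> c" "i dvd c" "c > 0"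
      using mps_coeff_log_series_nonzero[OF ab(2)] .
    have "\<forall>i \<epsilon>. i dvd count b (S i \<epsilon>)"
      using less.hyps[OF _ ab(3)] ab(1) a by simp
    then show ?thesis
      using ab(1) a by auto
  qed auto
qed

section \<open>Components with a fixed s-monomial and their recursion\<close>

definition s_component :: "indet multiset \<Rightarrow> (indet, complex) mps \<Rightarrow> (indet, complex) mps" where
  "s_component A f = Abs_mps (\<lambda>m. if filter_mset is_S m = A then mps_coeff f m else 0)"

lemma mps_coeff_s_component:
  "mps_coeff (s_component A f) m = (if filter_mset is_S m = A then mps_coeff f m else 0)"
  by (simp add: s_component_def)

lemma s_component_empty: "s_component {#} exp_series = 1"
proof (rule mps_eqI)
  fix m
  show "mps_coeff (s_component {#} exp_series) m = mps_coeff 1 m"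
    using exp_series_support[of m] mps_coeff_exp_empty[OF mps_coeff_log_series_empty]
    by (auto simp: mps_coeff_s_component one_mps_def exp_series_def)
qed

text \<open>For positive \<open>i\<close> and \<open>k\<close>, twice the part of
  \<open>s \<partial>/\<partial>s\<close> of the logarithm in which \<open>s\<close>, the variable
  \<open>S i \<epsilon>\<close>, has exponent \<open>i * k\<close>. On the side of the centralizer
  it is the contribution of a cycle through \<open>k\<close> blocks, summed over all return
  points.\<close>

definition cycle_series :: "nat \<Rightarrow> z2class \<Rightarrow> nat \<Rightarrow> (indet, complex) mps" where
  "cycle_series i \<epsilon> k = (\<Sum>d | d dvd i. \<Sum>\<theta>\<in>UNIV.
     mps_const (K \<epsilon> \<theta> d) * mps_monom (st_monomial i \<epsilon> (k * d) \<theta> (i * k)))"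

lemma le_of_mult_le: "e > 0 \<Longrightarrow> k * e \<le> N \<Longrightarrow> k \<le> (N :: nat)"
  by (cases e) auto

lemma filter_mset_is_S_replicate [simp]:
  "filter_mset is_S (replicate_mset n (S i \<epsilon>)) = replicate_mset n (S i \<epsilon>)"
  "filter_mset is_S (replicate_mset n (T i \<epsilon>)) = {#}"
  by (induction n) auto

lemma sum_divisors_swap:
  fixes f :: "nat \<Rightarrow> nat \<Rightarrow> 'a :: comm_monoid_add"
  assumes "i > 0"
  shows "(\<Sum>j\<in>{1..N}. \<Sum>e | e dvd gcd i j. f j e) =
    (\<Sum>e | e dvd i. \<Sum>k | 1 \<le> k \<and> k * e \<le> N. f (k * e) e)"
proof -
  have fin: "finite {k. 1 \<le> k \<and> k * e \<le> N}" if "e dvd i" for e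
  proof (rule finite_subset[of _ "{..N}"])
    have "e > 0" using that assms by (auto intro!: Nat.gr0I)
    then show "{k. 1 \<le> k \<and> k * e \<le> N} \<subseteq> {..N}" 
      using le_of_mult_le by auto
  qed simp
  have "(\<Sum>j\<in>{1..N}. \<Sum>e | e dvd gcd i j. f j e) =
     (\<Sum>(j, e)\<in>(SIGMA j:{1..N}. {e. e dvd gcd i j}). f j e)"
    using assms by (subst sum.Sigma) auto
  also have "\<dots> = (\<Sum>(e, k)\<in>(SIGMA e:{e. e dvd i}. {k. 1 \<le> k \<and> k * e \<le> N}). f (k * e) e)"
    by (rule sum.reindex_bij_witness[where j = "\<lambda>(j, e). (e, j div e)" and i = "\<lambda>(e, k). (k * e, e)"])
      (use assms in \<open>auto simp: Suc_le_eq intro!: Nat.gr0I\<close>)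
  also have "\<dots> = (\<Sum>e | e dvd i. \<Sum>k | 1 \<le> k \<and> k * e \<le> N. f (k * e) e)"
    using assms fin by (subst sum.Sigma) auto
  finally show ?thesis .
qed

text \<open>The derivation multiplies a term by its exponent \<open>i * j div e\<close>, which
  cancels the denominator up to the factor 2. With \<open>j = k * e\<close> the exponent is
  \<open>i * k\<close>, and the bound on \<open>count\<close> leaves only
  \<open>k \<le> a\<close>.\<close>

lemma mps_coeff_deriv_log_series:
  assumes i: "i > 0" and m: "count m (S i \<epsilon>) \<le> i * a"
  shows "mps_coeff (mps_deriv (S i \<epsilon>) log_series) m =
     mps_coeff (\<Sum>k\<in>{1..a}. mps_const (1 / 2) * cycle_series i \<epsilon> k) m"
proof -
  have fin: "finite (UNIV :: z2class set)"
    by (simp add: UNIV_z2class)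
  \<comment> \<open>Large enough for the degree of \<open>m\<close>, for the index \<open>i\<close>
    itself, and for all \<open>k * e\<close> with \<open>k \<le> a\<close> and
    \<open>e \<le> i\<close>.\<close>
  define N where "N = size m + i * a + i"
  let ?v = "S i \<epsilon>"
  let ?g = "\<lambda>k \<theta> e. if m = st_monomial i \<epsilon> (k * e) \<theta> (i * k) then K \<epsilon> \<theta> e / 2 else 0"
  let ?f = "\<lambda>j \<theta> e. if m = st_monomial i \<epsilon> j \<theta> (i * j div e) then K \<epsilon> \<theta> e / 2 else 0"
  have *: "of_nat (count m ?v) * (if m = st_monomial i' \<epsilon>' j \<theta> (i' * j div e)
      then K \<epsilon>' \<theta> e / (2 * of_nat i' * of_nat j / of_nat e) else 0) =
      (if i' = i then if \<epsilon>' = \<epsilon> then ?f j \<theta> e else 0 else 0)"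
    if "j \<ge> 1" "e dvd gcd i' j" for i' \<epsilon>' j \<theta> e
  proof (cases "i' = i \<and> \<epsilon>' = \<epsilon>")
    case True
    have "e dvd i * j" "e > 0" using that True i by (auto intro!: Nat.gr0I)
    then have "of_nat (i * j div e) = (of_nat i * of_nat j / of_nat e :: complex)"
      by (auto elim!: dvdE simp: field_simps simp flip: of_nat_mult)
    then show ?thesis
      using True i that \<open>e > 0\<close> by (auto simp: field_simps)
  qed auto
  have "mps_coeff (mps_deriv ?v log_series) m =
     (\<Sum>i'\<in>{1..N}. \<Sum>\<epsilon>'\<in>UNIV. \<Sum>j\<in>{1..N}. \<Sum>\<theta>\<in>UNIV. \<Sum>e | e dvd gcd i' j.
       (if i' = i then if \<epsilon>' = \<epsilon> then ?f j \<theta> e else 0 else 0))"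
    unfolding mps_coeff_deriv
    by (subst mps_coeff_log_series[of _ N]) (auto simp: N_def sum_distrib_left * intro!: sum.cong)
  also have "\<dots> = (\<Sum>j\<in>{1..N}. \<Sum>\<theta>\<in>UNIV. \<Sum>e | e dvd gcd i j.
       ?f j \<theta> e)"
  proof -
    have delta: "(\<Sum>i'\<in>I. \<Sum>\<epsilon>'\<in>UNIV. \<Sum>j\<in>J. \<Sum>\<theta>\<in>UNIV. \<Sum>e\<in>E i' j.
       if i' = i then if \<epsilon>' = \<epsilon> then f j \<theta> e else 0 else 0) =
       (\<Sum>j\<in>J. \<Sum>\<theta>\<in>UNIV. \<Sum>e\<in>E i j. f j \<theta> e)" if "finite I" "i \<in> I"
      for I J :: "nat set" and E and f :: "nat \<Rightarrow> z2class \<Rightarrow> nat \<Rightarrow> complex"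
    proof -
      have "(\<Sum>i'\<in>I. \<Sum>\<epsilon>'\<in>UNIV. \<Sum>j\<in>J. \<Sum>\<theta>\<in>UNIV. \<Sum>e\<in>E i' j.
         if i' = i then if \<epsilon>' = \<epsilon> then f j \<theta> e else 0 else 0) =
         (\<Sum>i'\<in>I. if i' = i then \<Sum>\<epsilon>'\<in>UNIV. if \<epsilon>' = \<epsilon> then \<Sum>j\<in>J. \<Sum>\<theta>\<in>UNIV. \<Sum>e\<in>E i j. f j \<theta> e else 0 else 0)"
        by (intro sum.cong refl) (auto intro!: sum.cong)
      then show ?thesis
        using that fin by simp
    qed
    show ?thesis
      by (rule delta) (use i in \<open>auto simp: N_def\<close>)
  qed
  also have "\<dots> = (\<Sum>j\<in>{1..N}. \<Sum>e | e dvd gcd i j.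
       \<Sum>\<theta>\<in>UNIV. ?f j \<theta> e)"
    by (intro sum.cong refl sum.swap)
  also have "\<dots> = (\<Sum>e | e dvd i. \<Sum>k | 1 \<le> k \<and> k * e \<le> N.
       \<Sum>\<theta>\<in>UNIV. if m = st_monomial i \<epsilon> (k * e) \<theta> (i * (k * e) div e) then K \<epsilon> \<theta> e / 2 else 0)"
    by (rule sum_divisors_swap[OF i])
  also have "\<dots> = (\<Sum>e | e dvd i. \<Sum>k\<in>{1..a}.
       \<Sum>\<theta>\<in>UNIV. ?g k \<theta> e)"
  proof (rule sum.cong[OF refl])
    fix e assume "e \<in> {e. e dvd i}"
    then have e: "e > 0" "e \<le> i"
      using i by (auto intro!: Nat.gr0I dvd_imp_le)
    have eq: "i * (k * e) div e = i * k" for k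
      using e by (simp flip: mult.assoc)
    have "k * e \<le> N" if "k \<le> a" for k
      using mult_mono[OF that e(2)] by (simp add: N_def mult.commute)
    moreover have "k \<le> N" if "k * e \<le> N" for k
      using e(1) that by (rule le_of_mult_le)
    moreover have "k \<le> a" if "m = st_monomial i \<epsilon> (k * e) \<theta> (i * k)" for k \<theta>
      using m i that by auto
    ultimately show "(\<Sum>k | 1 \<le> k \<and> k * e \<le> N.
        \<Sum>\<theta>\<in>UNIV. if m = st_monomial i \<epsilon> (k * e) \<theta> (i * (k * e) div e) then K \<epsilon> \<theta> e / 2 else 0) =
      (\<Sum>k\<in>{1..a}. \<Sum>\<theta>\<in>UNIV. ?g k \<theta> e)"
      unfolding eq
      by (intro sum.mono_neutral_right) (auto intro!: sum.neutral finite_subset[of _ "{..N}"])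
  qed
  also have "\<dots> = (\<Sum>k\<in>{1..a}. \<Sum>e | e dvd i.
       \<Sum>\<theta>\<in>UNIV. ?g k \<theta> e)"
    by (rule sum.swap)
  also have "\<dots> = mps_coeff (\<Sum>k\<in>{1..a}. mps_const (1 / 2) * cycle_series i \<epsilon> k) m"
    by (auto simp: mps_coeff_sum cycle_series_def mps_monom_def sum_distrib_left intro!: sum.cong)
  finally show ?thesis .
qed

lemma mps_coeff_cycle_series_mult:
  "mps_coeff (cycle_series i \<epsilon> k * f) m = (\<Sum>d | d dvd i. \<Sum>\<theta>\<in>UNIV.
     if st_monomial i \<epsilon> (k * d) \<theta> (i * k) \<subseteq># m
     then K \<epsilon> \<theta> d * mps_coeff f (m - st_monomial i \<epsilon> (k * d) \<theta> (i * k)) else 0)"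
  by (auto simp: cycle_series_def sum_distrib_right mps_coeff_sum mult.assoc mps_coeff_monom_mult
      intro!: sum.cong)

text \<open>Compare in \<open>mps_deriv_exp\<close> the coefficients with s-part \<open>A\<close>:
  the derivation acts on them as multiplication by \<open>i * a\<close>, and doubling clears the
  halves. A term of the logarithm with exponent \<open>i * k\<close> is complemented by a monomial
  whose s-part is \<open>A\<close> with that many copies of the variable taken away.\<close>

lemma s_component_exp_series_rec:
  assumes i: "i > 0" and A: "count A (S i \<epsilon>) = i * a"
  shows "mps_const (2 * of_nat (i * a)) * s_component A exp_series =
     (\<Sum>k\<in>{1..a}. cycle_series i \<epsilon> k * s_component (A - replicate_mset (i * k) (S i \<epsilon>)) exp_series)"
proof (rule mps_eqI)
  fix m
  let ?v = "S i \<epsilon>"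
  let ?M = "\<lambda>k d \<theta>. st_monomial i \<epsilon> (k * d) \<theta> (i * k)"
  have comp: "mps_coeff (s_component (A - replicate_mset (i * k) ?v) exp_series) (m - ?M k d \<theta>) =
      (if filter_mset is_S m = A then mps_coeff exp_series (m - ?M k d \<theta>) else 0)"
    if "k \<in> {1..a}" "?M k d \<theta> \<subseteq># m" for k d \<theta>
  proof -
    have "filter_mset is_S m = replicate_mset (i * k) ?v + filter_mset is_S (m - ?M k d \<theta>)"
      using arg_cong[OF subset_mset.add_diff_inverse[OF that(2)], of "filter_mset is_S"] by simp
    moreover have "A = replicate_mset (i * k) ?v + (A - replicate_mset (i * k) ?v)"
      using that(1) A by (intro subset_mset.add_diff_inverse[symmetric])
        (simp add: count_le_replicate_mset_subset_eq[symmetric])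
    ultimately show ?thesis
      by (metis (no_types, lifting) add_left_cancel mps_coeff_s_component)
  qed
  show "mps_coeff (mps_const (2 * of_nat (i * a)) * s_component A exp_series) m = mps_coeff
     (\<Sum>k\<in>{1..a}. cycle_series i \<epsilon> k * s_component (A - replicate_mset (i * k) (S i \<epsilon>)) exp_series) m"
  proof (cases "filter_mset is_S m = A")
    case False
    then show ?thesis
      by (auto simp: mps_coeff_s_component[of A] mps_coeff_sum mps_coeff_cycle_series_mult comp
          intro!: sum.neutral)
  next
    case True
    then have m: "count m ?v = i * a"
      using A by auto
    have "mps_coeff (mps_const (2 * of_nat (i * a)) * s_component A exp_series) m =
        2 * mps_coeff (mps_deriv ?v exp_series) m"
      using True m by (simp add: mps_coeff_s_component)
    also have "mps_deriv ?v exp_series = mps_deriv ?v log_series * exp_series"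
      using mps_deriv_exp[OF mps_coeff_log_series_empty] by (simp add: exp_series_def)
    also have "mps_coeff (mps_deriv ?v log_series * exp_series) m =
        mps_coeff ((\<Sum>k\<in>{1..a}. mps_const (1 / 2) * cycle_series i \<epsilon> k) * exp_series) m"
      unfolding mps_coeff_mult
    proof (rule sum.cong[OF refl], clarify)
      fix x y assume "m = x + y"
      then have "mps_coeff (mps_deriv ?v log_series) x =
          mps_coeff (\<Sum>k\<in>{1..a}. mps_const (1 / 2) * cycle_series i \<epsilon> k) x"
        using i m by (intro mps_coeff_deriv_log_series) auto
      then show "mps_coeff (mps_deriv ?v log_series) x * mps_coeff exp_series y =
          mps_coeff (\<Sum>k\<in>{1..a}. mps_const (1 / 2) * cycle_series i \<epsilon> k) x * mps_coeff exp_series y"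
        by simp
    qed
    also have "2 * \<dots> = (\<Sum>k\<in>{1..a}. mps_coeff (cycle_series i \<epsilon> k * exp_series) m)"
      by (simp add: sum_distrib_right mps_coeff_sum sum_distrib_left mult.assoc)
    also have "\<dots> = (\<Sum>k\<in>{1..a}. mps_coeff (cycle_series i \<epsilon> k *
        s_component (A - replicate_mset (i * k) (S i \<epsilon>)) exp_series) m)"
      by (intro sum.cong refl) (auto simp: mps_coeff_cycle_series_mult comp True intro!: sum.cong)
    finally show ?thesis
      by (simp add: mps_coeff_sum)
  qed
qed

section \<open>Cycles of signed permutations\<close>

text \<open>Periodicity at every point stands in for a finite support, so \<open>w\<close>, the
  elements centralizing it and their restrictions are covered alike without naming the set that they
  permute.\<close>

locale signed_perm =
  fixes w :: "int \<Rightarrow> int"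
  assumes neg: "w (- p) = - w p"
    and inj: "inj w"
    and periodic: "\<exists>m>0. (w ^^ m) p = p"

text \<open>Returning up to sign gives the length of the signed cycle in both classes, half the size
  of its support, so the classes can be handled together.\<close>

definition cyc_len :: "(int \<Rightarrow> int) \<Rightarrow> int \<Rightarrow> nat" where
  "cyc_len w p = (LEAST m. 0 < m \<and> ((w ^^ m) p = p \<or> (w ^^ m) p = - p))"

definition cyc_class :: "(int \<Rightarrow> int) \<Rightarrow> int \<Rightarrow> z2class" where
  "cyc_class w p = (if (w ^^ cyc_len w p) p = - p then Neg else Pos)"

definition block :: "(int \<Rightarrow> int) \<Rightarrow> int \<Rightarrow> int set" where
  "block w p = {c * (w ^^ m) p | c m. c \<in> {1, - 1}}"

lemma class_sign_cases: "class_sign \<epsilon> \<in> {1, - 1}"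
  by (cases \<epsilon>) auto

lemma sign_power_cases: "c \<in> {1, - 1} \<Longrightarrow> c ^ r \<in> {1, - 1 :: int}"
  by (induction r) auto

context signed_perm
begin

lemma eq_iff: "w p = w q \<longleftrightarrow> p = q"
  using inj by (auto dest: injD)

lemma sign: "c \<in> {1, - 1} \<Longrightarrow> w (c * p) = c * w p"
  using neg by auto

lemma pow_sign: "c \<in> {1, - 1} \<Longrightarrow> (w ^^ m) (c * p) = c * (w ^^ m) p"
  by (induction m) (simp_all only: funpow.simps comp_apply id_apply sign)

lemma pow_neg: "(w ^^ m) (- p) = - (w ^^ m) p"
  using pow_sign[of "- 1"] by simp

lemma pow_eq_iff: "(w ^^ m) p = (w ^^ m) q \<longleftrightarrow> p = q"
  by (induction m) (auto simp: eq_iff)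

lemma cyc_len: "0 < cyc_len w p" "(w ^^ cyc_len w p) p = class_sign (cyc_class w p) * p"
proof -
  have "\<exists>m>0. (w ^^ m) p = p \<or> (w ^^ m) p = - p"
    using periodic by blast
  then have *: "0 < cyc_len w p \<and> ((w ^^ cyc_len w p) p = p \<or> (w ^^ cyc_len w p) p = - p)"
    unfolding cyc_len_def by (rule LeastI_ex)
  then show "0 < cyc_len w p" "(w ^^ cyc_len w p) p = class_sign (cyc_class w p) * p"
    by (auto simp: cyc_class_def)
qed

lemma pow_cyc_len_mult: "(w ^^ (cyc_len w p * r)) p = class_sign (cyc_class w p) ^ r * p"
proof (induction r)
  case (Suc r)
  then show ?case
    using cyc_len(2)[of p] by (simp add: funpow_add pow_sign[OF sign_power_cases[OF class_sign_cases]])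
qed simp

text \<open>Divide \<open>m\<close> by \<open>cyc_len w p\<close>: the full turns only contribute
  signs, and a nonzero remainder would bring \<open>p\<close> back up to sign too early.\<close>

lemma pow_eq_sign_iff:
  assumes "p \<noteq> 0" "c \<in> {1, - 1}"
  shows "(w ^^ m) p = c * p \<longleftrightarrow> cyc_len w p dvd m \<and> class_sign (cyc_class w p) ^ (m div cyc_len w p) = c"
proof
  let ?l = "cyc_len w p" and ?s = "class_sign (cyc_class w p)"
  assume *: "(w ^^ m) p = c * p"
  have "(w ^^ m) p = (w ^^ (m mod ?l + ?l * (m div ?l))) p"
    by simp
  also have "\<dots> = ?s ^ (m div ?l) * (w ^^ (m mod ?l)) p"
    unfolding funpow_add comp_apply pow_cyc_len_mult
    by (rule pow_sign) (rule sign_power_cases[OF class_sign_cases])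
  finally have eq: "c * p = ?s ^ (m div ?l) * (w ^^ (m mod ?l)) p"
    using * by simp
  then have "(w ^^ (m mod ?l)) p = p \<or> (w ^^ (m mod ?l)) p = - p"
    using assms(2) sign_power_cases[OF class_sign_cases, of "cyc_class w p" "m div ?l"] by auto
  then have "\<not> 0 < m mod ?l"
    using not_less_Least[of "m mod ?l" "\<lambda>m. 0 < m \<and> ((w ^^ m) p = p \<or> (w ^^ m) p = - p)"]
      cyc_len(1)[of p] by (auto simp flip: cyc_len_def)
  then have "?l dvd m" by auto
  moreover have "?s ^ (m div ?l) = c"
    using eq assms \<open>\<not> 0 < m mod ?l\<close> by simp
  ultimately show "?l dvd m \<and> ?s ^ (m div ?l) = c" ..
next
  assume "cyc_len w p dvd m \<and> class_sign (cyc_class w p) ^ (m div cyc_len w p) = c"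
  then show "(w ^^ m) p = c * p"
    using pow_cyc_len_mult[of p "m div cyc_len w p"] by simp
qed

lemma cyc_lenI:
  assumes "0 < l" "(w ^^ l) p = class_sign \<epsilon> * p" "p \<noteq> 0"
    and "\<And>m. 0 < m \<Longrightarrow> (w ^^ m) p = p \<or> (w ^^ m) p = - p \<Longrightarrow> l \<le> m"
  shows "cyc_len w p = l" "cyc_class w p = \<epsilon>"
proof -
  have pm: "(w ^^ l) p = p \<or> (w ^^ l) p = - p"
    using assms(2) by (cases \<epsilon>) auto
  show l: "cyc_len w p = l"
    unfolding cyc_len_def using assms pm by (intro Least_equality) auto
  show "cyc_class w p = \<epsilon>"
    unfolding cyc_class_def l using assms(2,3) by (cases \<epsilon>) auto
qed

lemma pow_eq_pow_iff:
  assumes "p \<noteq> 0" "c \<in> {1, - 1}" "c' \<in> {1, - 1}" "m \<le> m'"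
  shows "c * (w ^^ m) p = c' * (w ^^ m') p \<longleftrightarrow> (w ^^ (m' - m)) p = (c * c') * p"
proof -
  have "(w ^^ m') p = (w ^^ m) ((w ^^ (m' - m)) p)"
    using assms(4) by (simp flip: funpow_add comp_apply[of "w ^^ m"])
  moreover have "c * (w ^^ m) p = c' * (w ^^ m) q \<longleftrightarrow> (w ^^ m) (c * c' * p) = (w ^^ m) q" for q
    using assms(2,3) by (auto simp: pow_neg)
  ultimately show ?thesis
    by (simp only: pow_eq_iff eq_commute[of "c * c' * p"])
qed

lemma block_pow: "c \<in> {1, - 1} \<Longrightarrow> c * (w ^^ m) p \<in> block w p"
  unfolding block_def by blast

lemma block_self: "p \<in> block w p"
  using block_pow[of 1 0 p] by simp

lemma blockE:
  assumes "r \<in> block w p"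
  obtains c m where "c \<in> {1, - 1}" "r = c * (w ^^ m) p"
  using assms unfolding block_def by blast

lemma pow_periodic: "\<exists>k>m. (w ^^ k) p = p"
proof -
  have "(w ^^ (cyc_len w p * (2 * Suc m))) p = p"
    unfolding pow_cyc_len_mult power_mult using class_sign_cases[of "cyc_class w p"] by auto
  moreover have "m < cyc_len w p * (2 * Suc m)"
    using cyc_len(1)[of p] by (cases "cyc_len w p") auto
  ultimately show ?thesis by blast
qed

lemma block_sym: "r \<in> block w p \<Longrightarrow> p \<in> block w r"
proof -
  assume "r \<in> block w p"
  then obtain c m where r: "c \<in> {1, - 1}" "r = c * (w ^^ m) p"
    by (rule blockE)
  obtain k where k: "k > m" "(w ^^ k) p = p"
    using pow_periodic by blast
  have "p = (w ^^ (k - m)) ((w ^^ m) p)"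
    using k by (simp flip: funpow_add comp_apply[of "w ^^ (k - m)"])
  also have "\<dots> = c * (w ^^ (k - m)) r"
    using r pow_sign[OF r(1), of "k - m" "(w ^^ m) p"] by auto
  finally show "p \<in> block w r"
    using block_pow[OF r(1)] by metis
qed

lemma block_trans: "q \<in> block w r \<Longrightarrow> r \<in> block w p \<Longrightarrow> q \<in> block w p"
proof (elim blockE)
  fix c m c' m'
  assume "c \<in> {1, - 1 :: int}" "c' \<in> {1, - 1 :: int}" and q: "q = c * (w ^^ m) r" and r: "r = c' * (w ^^ m') p"
  then have "q = (c * c') * (w ^^ (m + m')) p"
    by (simp only: pow_sign funpow_add comp_apply mult.assoc)
  moreover have "c * c' \<in> {1, - 1}"
    using \<open>c \<in> _\<close> \<open>c' \<in> _\<close> by auto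
  ultimately show "q \<in> block w p"
    using block_pow by blast
qed

lemma block_eq: "r \<in> block w p \<Longrightarrow> block w r = block w p"
  by (intro equalityI subsetI) (blast intro: block_trans block_sym)+

lemma block_w: "w r \<in> block w p \<longleftrightarrow> r \<in> block w p"
proof -
  have "w r \<in> block w r"
    using block_pow[of 1 1 r] by simp
  from block_eq[OF this] show ?thesis
    using block_eq[of _ p] block_self by blast
qed

lemma block_neg: "- r \<in> block w p \<longleftrightarrow> r \<in> block w p"
proof -
  have "- r \<in> block w r"
    using block_pow[of "- 1" 0 r] by simp
  from block_eq[OF this] show ?thesis
    using block_eq[of _ p] block_self by blast
qed

lemma zero: "w 0 = 0"
  using neg[of 0] by simp

lemma pow_zero: "(w ^^ m) 0 = 0"
  by (induction m) (auto simp: zero)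

lemma zero_notin_block: "p \<noteq> 0 \<Longrightarrow> 0 \<notin> block w p"
proof
  assume "p \<noteq> 0" "0 \<in> block w p"
  then have "p \<in> block w 0" by (simp add: block_sym)
  then have "p = 0"
    by (elim blockE) (simp add: pow_zero)
  with \<open>p \<noteq> 0\<close> show False by simp
qed

lemma block_eq_image:
  "block w p = (\<lambda>(c, m). c * (w ^^ m) p) ` ({1, - 1} \<times> {..<cyc_len w p})"
proof (intro equalityI subsetI)
  fix r assume "r \<in> block w p"
  then obtain c m where r: "c \<in> {1, - 1}" "r = c * (w ^^ m) p"
    by (rule blockE)
  let ?l = "cyc_len w p" and ?s = "class_sign (cyc_class w p)"
  have "(w ^^ m) p = (w ^^ (m mod ?l + ?l * (m div ?l))) p"
    by simp
  also have "\<dots> = ?s ^ (m div ?l) * (w ^^ (m mod ?l)) p"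
    unfolding funpow_add comp_apply pow_cyc_len_mult
    by (rule pow_sign) (rule sign_power_cases[OF class_sign_cases])
  finally have "r = (c * ?s ^ (m div ?l)) * (w ^^ (m mod ?l)) p"
    using r by simp
  moreover have "c * ?s ^ (m div ?l) \<in> {1, - 1}"
    using r(1) sign_power_cases[OF class_sign_cases, of "cyc_class w p" "m div ?l"] by auto
  ultimately show "r \<in> (\<lambda>(c, m). c * (w ^^ m) p) ` ({1, - 1} \<times> {..<?l})"
    using cyc_len(1)[of p] by (intro image_eqI[of _ _ "(c * ?s ^ (m div ?l), m mod ?l)"]) auto
next
  fix r assume "r \<in> (\<lambda>(c, m). c * (w ^^ m) p) ` ({1, - 1} \<times> {..<cyc_len w p})"
  then obtain a where "r = (\<lambda>(c, m). c * (w ^^ m) p) a" "a \<in> {1, - 1} \<times> {..<cyc_len w p}"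
    by (rule imageE)
  then show "r \<in> block w p"
    using block_pow[of "fst a" "snd a"] by (simp add: case_prod_unfold mem_Times_iff)
qed

lemma inj_on_block_image:
  assumes "p \<noteq> 0"
  shows "inj_on (\<lambda>(c, m). c * (w ^^ m) p) ({1, - 1} \<times> {..<cyc_len w p})"
proof -
  have *: "c = c' \<and> m = m'" if "c * (w ^^ m) p = c' * (w ^^ m') p" "m \<le> m'" "m' < cyc_len w p"
    "c \<in> {1, - 1}" "c' \<in> {1, - 1}" for c m c' m'
  proof -
    have "(w ^^ (m' - m)) p = (c * c') * p"
      using that assms by (subst (asm) pow_eq_pow_iff) auto
    moreover have cc: "c * c' \<in> {1, - 1}"
      using that by auto
    ultimately have "cyc_len w p dvd m' - m \<and> class_sign (cyc_class w p) ^ ((m' - m) div cyc_len w p) = c * c'"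
      using pow_eq_sign_iff[OF assms cc, of "m' - m"] by blast
    then show ?thesis
      using that by (auto dest: dvd_imp_le)
  qed
  show ?thesis
  proof (rule inj_onI, clarify)
    fix c m c' m'
    assume "c \<in> {1, - 1}" "c' \<in> {1, - 1}" "m < cyc_len w p" "m' < cyc_len w p"
      "c * (w ^^ m) p = c' * (w ^^ m') p"
    then show "c = c' \<and> m = m'"
      using *[of c m c' m'] *[of c' m' c m] by (cases "m \<le> m'") simp_all
  qed
qed

lemma finite_block [simp]: "finite (block w p)"
  by (simp add: block_eq_image)

lemma card_block: "p \<noteq> 0 \<Longrightarrow> card (block w p) = 2 * cyc_len w p"
  by (simp add: block_eq_image card_image inj_on_block_image card_cartesian_product)

end

text \<open>Send \<open>c * (w ^^ m) p\<close> to \<open>c * (z ^^ m) q\<close>. Which of these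
  expressions coincide is decided by length and class alone, so the map is well defined and
  injective.\<close>

lemma block_transport:
  assumes "signed_perm w" "signed_perm z" "p \<noteq> 0" "q \<noteq> 0"
    and type: "cyc_len w p = cyc_len z q" "cyc_class w p = cyc_class z q"
  obtains f where "bij_betw f (block w p) (block z q)" "f p = q"
    "\<And>r. r \<in> block w p \<Longrightarrow> f (w r) = z (f r)" "\<And>r. r \<in> block w p \<Longrightarrow> f (- r) = - f r"
proof -
  interpret w: signed_perm w by fact
  interpret z: signed_perm z by fact
  have eq: "c * (w ^^ m) p = c' * (w ^^ m') p \<longleftrightarrow> c * (z ^^ m) q = c' * (z ^^ m') q"
    if c: "c \<in> {1, - 1}" "c' \<in> {1, - 1}" for c c' m m'
  proof -
    have *: "c * (w ^^ m) p = c' * (w ^^ m') p \<longleftrightarrow> c * (z ^^ m) q = c' * (z ^^ m') q"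
      if c: "c \<in> {1, - 1}" "c' \<in> {1, - 1}" and "m \<le> m'" for c c' m m'
    proof -
      have cc: "c * c' \<in> {1, - 1}" using c by auto
      show ?thesis
        by (simp only: w.pow_eq_pow_iff[OF assms(3) that] z.pow_eq_pow_iff[OF assms(4) that]
            w.pow_eq_sign_iff[OF assms(3) cc] z.pow_eq_sign_iff[OF assms(4) cc] type)
    qed
    show ?thesis
      using *[of c c' m m'] *[of c' c m' m] c by (cases "m \<le> m'") auto
  qed
  \<comment> \<open>Any representation of \<open>r\<close> may be chosen, since by \<open>eq\<close>
    the value is the same for all of them.\<close>
  define f where "f r = (SOME s. \<exists>c m. c \<in> {1, - 1} \<and> r = c * (w ^^ m) p \<and> s = c * (z ^^ m) q)" for r
  have f: "f (c * (w ^^ m) p) = c * (z ^^ m) q" if "c \<in> {1, - 1}" for c m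
  proof -
    have "\<exists>s c' m'. c' \<in> {1, - 1} \<and> c * (w ^^ m) p = c' * (w ^^ m') p \<and> s = c' * (z ^^ m') q"
      using that by blast
    from someI_ex[OF this] obtain c' m' where "c' \<in> {1, - 1}" "c * (w ^^ m) p = c' * (w ^^ m') p"
        "f (c * (w ^^ m) p) = c' * (z ^^ m') q"
      unfolding f_def[symmetric] by blast
    then show ?thesis
      using eq[OF that, of c' m m'] by simp
  qed
  show thesis
  proof
    show "f p = q"
      using f[of 1 0] by simp
    show "f (w r) = z (f r)" if "r \<in> block w p" for r
    proof -
      obtain c m where r: "c \<in> {1, - 1}" "r = c * (w ^^ m) p"
        using w.blockE \<open>r \<in> block w p\<close> .
      then have "w r = c * (w ^^ Suc m) p"
        using w.sign[OF r(1)] by simp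
      then show ?thesis
        using r f[OF r(1)] z.sign[OF r(1)] by (metis comp_apply funpow.simps(2))
    qed
    show "f (- r) = - f r" if "r \<in> block w p" for r
    proof -
      obtain c m where r: "c \<in> {1, - 1}" "r = c * (w ^^ m) p"
        using w.blockE \<open>r \<in> block w p\<close> .
      then show ?thesis
        using f[of c m] f[of "- c" m] by auto
    qed
    show "bij_betw f (block w p) (block z q)"
      unfolding bij_betw_def
    proof
      show "inj_on f (block w p)"
      proof (rule inj_onI)
        fix r r' assume "r \<in> block w p" "r' \<in> block w p" "f r = f r'"
        then show "r = r'"
          using f eq by (elim w.blockE) metis
      qed
      show "f ` block w p = block z q"
      proof (intro equalityI subsetI)
        fix s assume "s \<in> block z q"
        then obtain c m where "c \<in> {1, - 1}" "s = c * (z ^^ m) q"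
          by (rule z.blockE)
        then show "s \<in> f ` block w p"
          using f w.block_pow by (metis image_eqI)
      next
        fix s assume "s \<in> f ` block w p"
        then obtain r where "r \<in> block w p" "s = f r" by blast
        then show "s \<in> block z q"
          using f z.block_pow by (elim w.blockE) metis
      qed
    qed
  qed
qed

section \<open>Centralizers supported on stable sets\<close>

definition signed_perms :: "int set \<Rightarrow> (int \<Rightarrow> int) set" where
  "signed_perms X = {w. w permutes X \<and> (\<forall>i. w (- i) = - w i)}"

text \<open>These are the finite unions of blocks of nonzero points. Equivalences in place of
  closure conditions make the notion pass to set differences.\<close>

definition stable :: "(int \<Rightarrow> int) \<Rightarrow> int set \<Rightarrow> bool" where
  "stable w Y \<longleftrightarrow> finite Y \<and> 0 \<notin> Y \<and> (\<forall>r. w r \<in> Y \<longleftrightarrow> r \<in> Y) \<and> (\<forall>r. - r \<in> Y \<longleftrightarrow> r \<in> Y)"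

text \<open>Commutation is with \<open>w\<close> on all integers rather than with its restriction to
  \<open>Y\<close>. Hence the groups of nested sets are nested as sets of functions, and their
  elements can be composed directly.\<close>

definition comm :: "(int \<Rightarrow> int) \<Rightarrow> int set \<Rightarrow> (int \<Rightarrow> int) set" where
  "comm w Y = {z \<in> signed_perms Y. \<forall>r. z (w r) = w (z r)}"

definition same_type :: "(int \<Rightarrow> int) \<Rightarrow> int \<Rightarrow> int \<Rightarrow> bool" where
  "same_type w p q \<longleftrightarrow> cyc_len w p = cyc_len w q \<and> cyc_class w p = cyc_class w q"

lemma signed_permI:
  assumes "w \<in> signed_perms X" "finite X"
  shows "signed_perm w"
proof
  have w: "w permutes X" "permutation w"
    using assms by (auto simp: signed_perms_def permutation_permutes)
  show "inj w"
    using permutes_inj[OF w(1)] .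
  show "\<exists>m>0. (w ^^ m) p = p" for p
    using permutation_self[OF w(2), of p] by metis
  show "w (- p) = - w p" for p
    using assms by (simp add: signed_perms_def)
qed

lemma stable_Diff: "stable w Y \<Longrightarrow> stable w Z \<Longrightarrow> stable w (Y - Z)"
  by (auto simp: stable_def)

lemma stable_Un: "stable w Y \<Longrightarrow> stable w Z \<Longrightarrow> stable w (Y \<union> Z)"
  by (auto simp: stable_def)

lemma comm_mono: "Y \<subseteq> Z \<Longrightarrow> comm w Y \<subseteq> comm w Z"
  by (auto simp: comm_def signed_perms_def intro: permutes_subset)

lemma comm_id: "id \<in> comm w Y"
  by (auto simp: comm_def signed_perms_def permutes_id)

lemma comm_comp: "y \<in> comm w Y \<Longrightarrow> z \<in> comm w Y \<Longrightarrow> y \<circ> z \<in> comm w Y"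
  by (auto simp: comm_def signed_perms_def intro: permutes_compose)

lemma comm_inv:
  assumes "z \<in> comm w Y"
  shows "inv_into UNIV z \<in> comm w Y"
proof -
  have z: "z permutes Y" "\<And>r. z (- r) = - z r" "\<And>r. z (w r) = w (z r)"
    using assms by (auto simp: comm_def signed_perms_def)
  have "inv_into UNIV z (- r) = - inv_into UNIV z r" "inv_into UNIV z (w r) = w (inv_into UNIV z r)" for r
    using z(2)[of "inv_into UNIV z r"] z(3)[of "inv_into UNIV z r"] permutes_inverses[OF z(1)] by metis+
  then show ?thesis
    using permutes_inv[OF z(1)] by (auto simp: comm_def signed_perms_def)
qed

lemma finite_comm: "finite Y \<Longrightarrow> finite (comm w Y)"
  by (rule finite_subset[OF _ finite_permutations[of Y]]) (auto simp: comm_def signed_perms_def)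

lemma comm_signed_perm: "z \<in> comm w Y \<Longrightarrow> finite Y \<Longrightarrow> signed_perm z"
  by (auto simp: comm_def intro: signed_permI)

lemma commD:
  assumes "z \<in> comm w Y"
  shows "z permutes Y" "z (- r) = - z r" "z (w r) = w (z r)"
  using assms by (auto simp: comm_def signed_perms_def)

text \<open>An equivariant injection carries the relations that return \<open>p\<close> up to sign
  to those of \<open>h p\<close>, and back. In the applications \<open>h\<close> is a centralizing
  element, a power of \<open>w\<close> up to sign, or a conjugating permutation.\<close>

lemma cyc_type_transfer:
  assumes "inj h" "\<And>r. h (- r) = - h r" "\<And>r. h (w r) = z (h r)"
  shows "cyc_len z (h p) = cyc_len w p" "cyc_class z (h p) = cyc_class w p"
proof -
  have pow: "(z ^^ m) (h p) = h ((w ^^ m) p)" for m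
    by (induction m) (auto simp: assms(3))
  have "h q = h p \<longleftrightarrow> q = p" "h q = - h p \<longleftrightarrow> q = - p" for q
    using assms(1) by (auto simp flip: assms(2) dest: injD)
  then show "cyc_len z (h p) = cyc_len w p" "cyc_class z (h p) = cyc_class w p"
    by (simp_all add: cyc_len_def cyc_class_def pow)
qed

lemma comm_same_type:
  assumes "z \<in> comm w Y"
  shows "same_type w (z p) p"
  using cyc_type_transfer[of z w w p] commD[OF assms] permutes_inj[OF commD(1)[OF assms]]
  by (auto simp: same_type_def)

lemma comm_perm_restrict:
  assumes z: "z \<in> comm w Y" and U: "stable w U" "\<And>r. z r \<in> U \<longleftrightarrow> r \<in> U"
  shows "perm_restrict z U \<in> comm w U"
proof -
  have inj: "inj z"
    using permutes_inj[OF commD(1)[OF z]] .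
  have "bij_betw (perm_restrict z U) U U"
  proof (rule bij_betw_imageI)
    show inj': "inj_on (perm_restrict z U) U"
      using inj by (auto simp: inj_on_def perm_restrict_def dest: injD)
    have "perm_restrict z U ` U \<subseteq> U"
      using U by (auto simp: perm_restrict_def)
    then show "perm_restrict z U ` U = U"
      using inj' U(1) by (intro card_subset_eq) (auto simp: card_image stable_def)
  qed
  then have "perm_restrict z U permutes U"
    by (rule bij_imp_permutes) (simp add: perm_restrict_def)
  then show ?thesis
    using U commD(2,3)[OF z] by (auto simp: comm_def signed_perms_def perm_restrict_def stable_def)
qed

context signed_perm
begin

text \<open>One-sided closure is enough: by periodicity \<open>r\<close> is a forward iterate of
  \<open>w r\<close>.\<close>

lemma stableI:
  assumes "finite Y" "0 \<notin> Y" "\<And>r. r \<in> Y \<Longrightarrow> w r \<in> Y" "\<And>r. r \<in> Y \<Longrightarrow> - r \<in> Y"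
  shows "stable w Y"
proof -
  have pow: "(w ^^ m) r \<in> Y" if "r \<in> Y" for m r
    using that assms(3) by (induction m) auto
  have "r \<in> Y" if "w r \<in> Y" for r
  proof -
    obtain m where "m > 0" "(w ^^ m) r = r"
      using periodic by blast
    then have "r = (w ^^ (m - 1)) (w r)"
      by (cases m) (auto simp: funpow_swap1)
    then show ?thesis using pow[OF that] by metis
  qed
  moreover have "r \<in> Y" if "- r \<in> Y" for r
    using assms(4)[OF that] by simp
  ultimately show ?thesis
    unfolding stable_def using assms by blast
qed

lemma stable_block: "p \<noteq> 0 \<Longrightarrow> stable w (block w p)"
  by (simp add: stable_def zero_notin_block block_w block_neg)

lemma block_subset:
  assumes "stable w Y" "p \<in> Y"
  shows "block w p \<subseteq> Y"
proof
  fix r assume "r \<in> block w p"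
  then obtain c m where r: "c \<in> {1, - 1}" "r = c * (w ^^ m) p"
    by (rule blockE)
  have "(w ^^ m) p \<in> Y"
    using assms by (induction m) (auto simp: stable_def)
  moreover have "- q \<in> Y" if "q \<in> Y" for q
    using assms(1) that unfolding stable_def by blast
  ultimately show "r \<in> Y"
    using r by auto
qed

lemma same_type_block:
  assumes "r \<in> block w p"
  shows "same_type w r p"
proof -
  obtain c m where r: "c \<in> {1, - 1}" "r = c * (w ^^ m) p"
    using assms by (rule blockE)
  have "inj (\<lambda>r. c * (w ^^ m) r)"
    using r(1) by (auto simp: inj_on_def pow_eq_iff)
  moreover have "c * (w ^^ m) (w r) = w (c * (w ^^ m) r)" for r
    using r(1) by (simp only: sign) (simp add: funpow_swap1)
  ultimately show ?thesis
    using cyc_type_transfer[of "\<lambda>r. c * (w ^^ m) r" w w p] r by (simp add: pow_neg same_type_def)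
qed

lemma comm_block_elem:
  assumes "z \<in> comm w Y" "c \<in> {1, - 1}"
  shows "z (c * (w ^^ m) r) = c * (w ^^ m) (z r)"
proof -
  have "z ((w ^^ m) r) = (w ^^ m) (z r)"
    by (induction m) (auto simp: commD[OF assms(1)])
  then show ?thesis
    using assms(2) commD(2)[OF assms(1)] by auto
qed

lemma comm_mem_block:
  assumes "z \<in> comm w Y"
  shows "z q \<in> block w (z r) \<longleftrightarrow> q \<in> block w r"
proof -
  have inj: "inj z"
    using permutes_inj[OF commD(1)[OF assms]] .
  show ?thesis
  proof
    assume "q \<in> block w r"
    then show "z q \<in> block w (z r)"
      by (elim blockE) (simp only: comm_block_elem[OF assms] block_pow)
  next
    assume "z q \<in> block w (z r)"
    then obtain c m where *: "c \<in> {1, - 1}" "z q = c * (w ^^ m) (z r)"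
      by (rule blockE)
    then have "z q = z (c * (w ^^ m) r)"
      by (simp only: comm_block_elem[OF assms])
    then have "q = c * (w ^^ m) r"
      using inj by (auto dest: injD)
    then show "q \<in> block w r"
      using * block_pow by simp
  qed
qed

lemma comm_unique:
  assumes "y \<in> comm w Y" "z \<in> comm w Y" "y a = z a" "r \<in> block w a"
  shows "y r = z r"
  using assms(4) by (elim blockE) (simp only: comm_block_elem[OF assms(1)] comm_block_elem[OF assms(2)] assms(3))

lemma comm_fixed_point:
  assumes "z \<in> comm w Y" "z p = p" "r \<in> block w p"
  shows "z r = r"
  using comm_unique[OF assms(1) comm_id _ assms(3)] assms(2) by simp

lemma comm_Diff_block:
  assumes "z \<in> comm w Y" "z p = p"
  shows "z \<in> comm w (Y - block w p)"
proof -
  have "z permutes Y - block w p"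
    by (rule permutes_superset[OF commD(1)[OF assms(1)]]) (use comm_fixed_point[OF assms] in blast)
  then show ?thesis
    using assms by (auto simp: comm_def signed_perms_def)
qed

lemma comm_extend:
  assumes B: "stable w B" and f: "bij_betw f B B" "\<And>r. r \<in> B \<Longrightarrow> f (w r) = w (f r)"
    "\<And>r. r \<in> B \<Longrightarrow> f (- r) = - f r"
  shows "(\<lambda>r. if r \<in> B then f r else r) \<in> comm w B"
proof -
  have "bij_betw (\<lambda>r. if r \<in> B then f r else r) B B"
    using f(1) by (subst bij_betw_cong[of B _ f]) auto
  then have "(\<lambda>r. if r \<in> B then f r else r) permutes B"
    by (rule bij_imp_permutes) simp
  then show ?thesis
    using B f(2,3) by (auto simp: comm_def signed_perms_def stable_def)
qed

text \<open>All points of a block have the same type, so \<open>block_transport\<close> applies to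
  the block and itself with two different base points.\<close>

lemma exists_rotation:
  assumes "a \<noteq> 0" "p \<in> block w a"
  shows "\<exists>s\<in>comm w (block w a). s a = p"
proof -
  have "p \<noteq> 0" using assms zero_notin_block by metis
  obtain f where f: "bij_betw f (block w a) (block w p)" "f a = p"
    "\<And>r. r \<in> block w a \<Longrightarrow> f (w r) = w (f r)" "\<And>r. r \<in> block w a \<Longrightarrow> f (- r) = - f r"
    using block_transport[OF signed_perm_axioms signed_perm_axioms assms(1) \<open>p \<noteq> 0\<close>]
      same_type_block[OF assms(2)] unfolding same_type_def by metis
  let ?s = "\<lambda>r. if r \<in> block w a then f r else r"
  have "?s \<in> comm w (block w a)"
    using f block_eq[OF assms(2)] stable_block[OF assms(1)] by (intro comm_extend) auto
  moreover have "?s a = p"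
    using f(2) block_self by simp
  ultimately show ?thesis
    by (intro bexI[of _ ?s])
qed

text \<open>The transport from one block to the other, glued with its inverse, commutes with
  \<open>w\<close> and with negation.\<close>

lemma exists_swap:
  assumes "a \<noteq> 0" "p \<noteq> 0" "same_type w p a" "p \<notin> block w a"
  shows "\<exists>s\<in>comm w (block w a \<union> block w p). s a = p \<and> s p = a"
proof -
  let ?A = "block w a" and ?P = "block w p"
  obtain f where f: "bij_betw f ?A ?P" "f a = p"
    "\<And>r. r \<in> ?A \<Longrightarrow> f (w r) = w (f r)" "\<And>r. r \<in> ?A \<Longrightarrow> f (- r) = - f r"
    using block_transport[OF signed_perm_axioms signed_perm_axioms assms(1,2)] assms(3)
    unfolding same_type_def by metis
  have disj: "?A \<inter> ?P = {}"
    using assms(4) block_trans block_sym by blast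
  let ?g = "the_inv_into ?A f"
  have g: "bij_betw ?g ?P ?A"
    using bij_betw_the_inv_into[OF f(1)] .
  have inj: "inj_on f ?A" and im: "f ` ?A = ?P"
    using f(1) by (auto simp: bij_betw_def)
  have g_f: "?g (f r) = r" if "r \<in> ?A" for r
    using the_inv_into_f_f[OF inj that] .
  define h where "h r = (if r \<in> ?A then f r else ?g r)" for r
  have bij: "bij_betw h (?A \<union> ?P) (?P \<union> ?A)"
    unfolding h_def using f(1) g disj by (intro bij_betw_disjoint_Un) auto
  have hw: "h (w r) = w (h r)" and hn: "h (- r) = - h r" if "r \<in> ?A \<union> ?P" for r
  proof -
    show "h (w r) = w (h r)"
    proof (cases "r \<in> ?A")
      case False
      then have "r \<in> f ` ?A"
        using that im by simp
      then obtain q where "r = f q" "q \<in> ?A"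
        by (rule imageE)
      then show ?thesis
        using False f(3)[of q] g_f[of q] g_f[of "w q"] by (simp add: h_def block_w)
    qed (simp add: h_def block_w f(3))
    show "h (- r) = - h r"
    proof (cases "r \<in> ?A")
      case False
      then have "r \<in> f ` ?A"
        using that im by simp
      then obtain q where "r = f q" "q \<in> ?A"
        by (rule imageE)
      then show ?thesis
        using False f(4)[of q] g_f[of q] g_f[of "- q"] by (simp add: h_def block_neg)
    qed (simp add: h_def block_neg f(4))
  qed
  let ?s = "\<lambda>r. if r \<in> ?A \<union> ?P then h r else r"
  have "?s \<in> comm w (?A \<union> ?P)"
    using bij hw hn assms stable_block by (intro comm_extend stable_Un) (auto simp: Un_commute)
  moreover have "?s a = p"
    using f(2) block_self by (simp add: h_def)
  moreover have "?s p = a"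
    using f(2) block_self[of p] block_self[of a] assms(4) g_f[of a] by (simp add: h_def)
  ultimately show ?thesis
    by (intro bexI[of _ ?s]) auto
qed

text \<open>The product of \<open>z\<close> with the inverse of \<open>s\<close> fixes
  \<open>p\<close>. It then fixes the whole block of \<open>p\<close>, because an element commuting
  with \<open>w\<close> and negation is determined on a block by a single value.\<close>

lemma comm_fiber:
  assumes "s \<in> comm w Y" "s a = p"
  shows "{z \<in> comm w Y. z a = p} = (\<lambda>y. y \<circ> s) ` comm w (Y - block w p)"
proof (intro equalityI subsetI)
  fix z assume "z \<in> {z \<in> comm w Y. z a = p}"
  then have z: "z \<in> comm w Y" "z a = p" by auto
  have s: "bij s"
    using commD(1)[OF assms(1)] by (rule permutes_bij)
  have "inv_into UNIV s p = a"
    using inv_f_f[OF bij_is_inj[OF s], of a] assms(2) by simp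
  then have "z \<circ> inv_into UNIV s \<in> comm w (Y - block w p)"
    using z assms by (intro comm_Diff_block comm_comp comm_inv) auto
  moreover have "z = (z \<circ> inv_into UNIV s) \<circ> s"
    using bij_is_inj[OF s] by (simp add: comp_assoc)
  ultimately show "z \<in> (\<lambda>y. y \<circ> s) ` comm w (Y - block w p)"
    by blast
next
  fix z assume "z \<in> (\<lambda>y. y \<circ> s) ` comm w (Y - block w p)"
  then obtain y where y: "y \<in> comm w (Y - block w p)" "z = y \<circ> s" by blast
  then have "y p = p"
    using permutes_not_in[OF commD(1)[OF y(1)]] block_self by blast
  moreover have "y \<in> comm w Y"
    using y comm_mono by blast
  ultimately show "z \<in> {z \<in> comm w Y. z a = p}"
    using y assms comm_comp by auto
qed

lemma sum_comm_fibers: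
  assumes "stable w Y" "a \<in> Y"
    and "\<And>p. p \<in> Y \<Longrightarrow> same_type w p a \<Longrightarrow> s p \<in> comm w Y \<and> s p a = p"
  shows "(\<Sum>z\<in>comm w Y. f z) =
    (\<Sum>p | p \<in> Y \<and> same_type w p a. \<Sum>y\<in>comm w (Y - block w p). f (y \<circ> s p))"
proof -
  let ?Q = "{p \<in> Y. same_type w p a}"
  have fin: "finite (comm w Y)" "finite ?Q"
    using assms(1) by (auto simp: stable_def intro: finite_comm)
  have "(\<lambda>z. z a) ` comm w Y \<subseteq> ?Q"
    using comm_same_type assms(2) permutes_in_image[OF commD(1)] by blast
  then have "(\<Sum>z\<in>comm w Y. f z) = (\<Sum>p\<in>?Q. \<Sum>z | z \<in> comm w Y \<and> z a = p. f z)"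
    using sum.group[OF fin, of "\<lambda>z. z a" f] by simp
  also have "\<dots> = (\<Sum>p\<in>?Q. \<Sum>y\<in>comm w (Y - block w p). f (y \<circ> s p))"
  proof (rule sum.cong[OF refl])
    fix p assume p: "p \<in> ?Q"
    then have s: "s p \<in> comm w Y" "s p a = p"
      using assms(3) by auto
    have "surj (s p)"
      using commD(1)[OF s(1)] by (rule permutes_surj)
    then have "inj_on (\<lambda>y. y \<circ> s p) (comm w (Y - block w p))"
      by (auto simp: inj_on_def fun_eq_iff surj_def) metis
    then show "(\<Sum>z | z \<in> comm w Y \<and> z a = p. f z) = (\<Sum>y\<in>comm w (Y - block w p). f (y \<circ> s p))"
      unfolding comm_fiber[OF s] by (subst sum.reindex) simp_all
  qed
  finally show ?thesis .
qed

end

section \<open>Cycles of blocks under a centralizing element\<close>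

context signed_perm
begin

lemma exists_comm_map:
  assumes "stable w Y" "a \<in> Y" "p \<in> Y" "same_type w p a"
  shows "\<exists>s\<in>comm w (block w a \<union> block w p). s a = p \<and> (p \<notin> block w a \<longrightarrow> s p = a)"
proof (cases "p \<in> block w a")
  case True
  have "a \<noteq> 0" using assms by (auto simp: stable_def)
  then obtain s where "s \<in> comm w (block w a)" "s a = p"
    using exists_rotation[OF _ True] by blast
  moreover have "comm w (block w a) \<subseteq> comm w (block w a \<union> block w p)"
    by (rule comm_mono) simp
  ultimately show ?thesis
    using True by (intro bexI[of _ s]) auto
next
  case False
  have "a \<noteq> 0" "p \<noteq> 0" using assms by (auto simp: stable_def)
  then obtain s where "s \<in> comm w (block w a \<union> block w p)" "s a = p" "s p = a"
    using exists_swap[OF _ _ assms(4) False] by blast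
  then show ?thesis
    by (intro bexI[of _ s]) auto
qed

text \<open>Both numbers count the elements that take \<open>a\<close> to \<open>p\<close>:
  \<open>comm_fiber\<close> identifies these with the centralizer on \<open>Y - block w p\<close>,
  while left multiplication by \<open>s\<close> identifies them with the elements fixing
  \<open>a\<close>.\<close>

lemma card_comm_Diff:
  assumes "stable w Y" "a \<in> Y" "p \<in> Y" "same_type w p a"
  shows "card (comm w (Y - block w p)) = card (comm w (Y - block w a))"
proof -
  obtain s where s: "s \<in> comm w (block w a \<union> block w p)" "s a = p"
    using exists_comm_map[OF assms] by blast
  then have s: "s \<in> comm w Y" "s a = p"
    using comm_mono[of "block w a \<union> block w p" Y] block_subset[OF assms(1)] assms by auto
  have bij: "bij s"
    using commD(1)[OF s(1)] by (rule permutes_bij)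
  have card: "card {z \<in> comm w Y. z a = q} = card (comm w (Y - block w q))"
    if t: "t \<in> comm w Y" "t a = q" for t q
  proof -
    have "surj t"
      using commD(1)[OF t(1)] by (rule permutes_surj)
    then have "inj_on (\<lambda>y. y \<circ> t) (comm w (Y - block w q))"
      by (auto simp: inj_on_def fun_eq_iff surj_def) metis
    then show ?thesis
      unfolding comm_fiber[OF t] by (rule card_image)
  qed
  have "{z \<in> comm w Y. z a = p} = (\<lambda>y. s \<circ> y) ` {z \<in> comm w Y. z a = a}"
  proof (intro equalityI subsetI)
    fix z assume z: "z \<in> {z \<in> comm w Y. z a = p}"
    have "z = s \<circ> (inv_into UNIV s \<circ> z)"
      using bij_is_surj[OF bij] by (auto simp: fun_eq_iff surj_f_inv_f)
    moreover have "inv_into UNIV s p = a"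
      using inv_f_f[OF bij_is_inj[OF bij], of a] s(2) by simp
    then have "inv_into UNIV s \<circ> z \<in> {z \<in> comm w Y. z a = a}"
      using z s comm_comp[OF comm_inv[OF s(1)]] by auto
    ultimately show "z \<in> (\<lambda>y. s \<circ> y) ` {z \<in> comm w Y. z a = a}"
      by blast
  qed (use s comm_comp in auto)
  moreover have "inj_on (\<lambda>y. s \<circ> y) {z \<in> comm w Y. z a = a}"
  proof (rule inj_onI, rule ext)
    fix y y' r assume "s \<circ> y = s \<circ> y'"
    then have "s (y r) = s (y' r)" by (metis comp_apply)
    then show "y r = y' r" using bij_is_inj[OF bij] by (simp add: inj_eq)
  qed
  ultimately have "card {z \<in> comm w Y. z a = p} = card {z \<in> comm w Y. z a = a}"
    by (simp add: card_image)
  then show ?thesis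
    using card[OF s] card[OF comm_id] by simp
qed

text \<open>Orbit-stabilizer for the point \<open>a\<close>, whose orbit consists of all points of
  its type.\<close>

lemma card_comm:
  assumes "stable w Y" "a \<in> Y"
  shows "card (comm w Y) = card {p \<in> Y. same_type w p a} * card (comm w (Y - block w a))"
proof -
  have "\<exists>s. s \<in> comm w Y \<and> s a = p" if p: "p \<in> {p \<in> Y. same_type w p a}" for p
  proof -
    have "comm w (block w a \<union> block w p) \<subseteq> comm w Y"
      using block_subset[OF assms(1)] assms(2) p by (intro comm_mono) auto
    then show ?thesis
      using exists_comm_map[OF assms, of p] p by blast
  qed
  then obtain s where s: "\<And>p. p \<in> Y \<Longrightarrow> same_type w p a \<Longrightarrow> s p \<in> comm w Y \<and> s p a = p"
    using bchoice[of "{p \<in> Y. same_type w p a}" "\<lambda>p s. s \<in> comm w Y \<and> s a = p"] by auto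
  have "card (comm w Y) = (\<Sum>p | p \<in> Y \<and> same_type w p a. card (comm w (Y - block w p)))"
    using sum_comm_fibers[OF assms s, of "\<lambda>_. 1 :: nat"] by simp
  also have "\<dots> = (\<Sum>p | p \<in> Y \<and> same_type w p a. card (comm w (Y - block w a)))"
    by (rule sum.cong[OF refl], rule card_comm_Diff[OF assms]) auto
  finally show ?thesis by simp
qed

section \<open>First return to a block and the cycle of blocks through it\<close>

definition ret :: "int \<Rightarrow> (int \<Rightarrow> int) \<Rightarrow> nat" where
  "ret a z = (LEAST m. 0 < m \<and> (z ^^ m) a \<in> block w a)"

definition zspan :: "int \<Rightarrow> (int \<Rightarrow> int) \<Rightarrow> int set" where
  "zspan a z = {(z ^^ m) r | m r. r \<in> block w a}"

lemma ret:
  assumes "signed_perm z"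
  shows "0 < ret a z" "(z ^^ ret a z) a \<in> block w a"
proof -
  obtain m where "m > 0" "(z ^^ m) a = a"
    using signed_perm.periodic[OF assms] by blast
  then have "0 < m \<and> (z ^^ m) a \<in> block w a"
    by (simp add: block_self)
  then have "0 < ret a z \<and> (z ^^ ret a z) a \<in> block w a"
    unfolding ret_def by (rule LeastI)
  then show "0 < ret a z" "(z ^^ ret a z) a \<in> block w a" by auto
qed

lemma ret_le: "0 < m \<Longrightarrow> (z ^^ m) a \<in> block w a \<Longrightarrow> ret a z \<le> m"
  unfolding ret_def by (rule Least_le) simp

lemma block_subset_zspan: "block w a \<subseteq> zspan a z"
proof
  fix r assume "r \<in> block w a"
  then have "(z ^^ 0) r \<in> zspan a z"
    unfolding zspan_def by blast
  then show "r \<in> zspan a z" by simp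
qed

lemma zspan_step: "r \<in> zspan a z \<Longrightarrow> z r \<in> zspan a z"
proof -
  assume "r \<in> zspan a z"
  then obtain m q where "q \<in> block w a" "r = (z ^^ m) q"
    unfolding zspan_def by blast
  moreover from this have "(z ^^ Suc m) q \<in> zspan a z"
    unfolding zspan_def by blast
  ultimately show "z r \<in> zspan a z" by simp
qed

lemma zspan_least:
  assumes "block w a \<subseteq> A" "\<And>r. r \<in> A \<Longrightarrow> z r \<in> A"
  shows "zspan a z \<subseteq> A"
proof -
  have "(z ^^ m) r \<in> A" if "r \<in> block w a" for m r
    using assms that by (induction m) auto
  then show ?thesis
    unfolding zspan_def by auto
qed

lemma zspan_iff:
  assumes "signed_perm z"
  shows "z r \<in> zspan a z \<longleftrightarrow> r \<in> zspan a z"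
proof
  assume r: "z r \<in> zspan a z"
  obtain m where m: "m > 0" "(z ^^ m) r = r"
    using signed_perm.periodic[OF assms] by blast
  have pow: "(z ^^ k) (z r) \<in> zspan a z" for k
    using r by (induction k) (auto intro: zspan_step)
  have eq: "r = (z ^^ (m - 1)) (z r)"
    using m by (cases m) (auto simp: funpow_swap1)
  show "r \<in> zspan a z"
    by (subst eq) (rule pow)
qed (rule zspan_step)

lemma zspan_subset:
  assumes "stable w Y" "a \<in> Y" "z \<in> comm w Y"
  shows "zspan a z \<subseteq> Y"
  using block_subset[OF assms(1,2)] permutes_in_image[OF commD(1)[OF assms(3)]]
  by (intro zspan_least) auto

lemma stable_zspan:
  assumes "stable w Y" "a \<in> Y" "z \<in> comm w Y"
  shows "stable w (zspan a z)"
proof (rule stableI)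
  have sub: "zspan a z \<subseteq> Y" using assms by (rule zspan_subset)
  then show "finite (zspan a z)" "0 \<notin> zspan a z"
    using assms(1) by (auto simp: stable_def dest: finite_subset)
  interpret z: signed_perm z
    using assms comm_signed_perm by (auto simp: stable_def)
  fix r assume "r \<in> zspan a z"
  then obtain m q where r: "r = (z ^^ m) q" "q \<in> block w a"
    unfolding zspan_def by blast
  have "w ((z ^^ m) q) = (z ^^ m) (w q)"
    by (induction m) (auto simp: commD(3)[OF assms(3), symmetric])
  then show "w r \<in> zspan a z"
    unfolding zspan_def using r block_w[of q a] by blast
  have "- r = (z ^^ m) (- q)"
    using r z.pow_neg by simp
  then show "- r \<in> zspan a z"
    unfolding zspan_def using r block_neg[of q a] by blast
qed

text \<open>Composing \<open>y\<close> with the exchange \<open>s\<close> inserts the block of \<open>p\<close> into the \<open>y\<close>-cycle of the block of \<open>a\<close>.\<close>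

lemma insert_block:
  assumes "finite Y" "Y \<inter> block w p = {}" "y \<in> comm w Y"
    and s: "s \<in> comm w (block w a \<union> block w p)" "s a = p" "s p = a" and p: "p \<notin> block w a"
  shows "ret a (y \<circ> s) = Suc (ret a y)"
    "((y \<circ> s) ^^ ret a (y \<circ> s)) a = (y ^^ ret a y) a"
    "zspan a (y \<circ> s) = zspan a y \<union> block w p"
    "zspan a y \<inter> block w p = {}"
    "r \<notin> zspan a (y \<circ> s) \<Longrightarrow> (y \<circ> s) r = y r"
proof -
  define z where "z = y \<circ> s"
  interpret y: signed_perm y
    using assms comm_signed_perm by blast
  have y_p: "y r = r" if "r \<in> block w p" for r
    using assms(2) that permutes_not_in[OF commD(1)[OF assms(3)]] by blast
  have y_iff: "y r \<in> block w p \<longleftrightarrow> r \<in> block w p" for r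
    using y_p y.eq_iff by metis
  have s_p: "s r \<in> block w p \<longleftrightarrow> r \<in> block w a" for r
    using comm_mem_block[OF s(1), of r a] s(2) by simp
  have s_a: "s r \<in> block w a \<longleftrightarrow> r \<in> block w p" for r
    using comm_mem_block[OF s(1), of r p] s(3) by simp
  have s_id: "s r = r" if "r \<notin> block w a" "r \<notin> block w p" for r
    using that permutes_not_in[OF commD(1)[OF s(1)]] by blast
  have a: "a \<notin> block w p"
    using p block_sym[of a p] by blast
  have not_p: "(y ^^ m) a \<notin> block w p" for m
    using a y_iff by (induction m) auto
  \<comment> \<open>Under \<open>z\<close> the point \<open>a\<close> runs through \<open>a\<close>,
    \<open>p\<close>, \<open>y a\<close> and so on: one additional step through \<open>p\<close>,
    then the path under \<open>y\<close> until it is back in the block of \<open>a\<close>. This is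
    the source of the \<open>Suc\<close> in the return time.\<close>
  have z1: "z a = p"
    using y_p[OF block_self] s(2) by (simp add: z_def)
  have z2: "z p = y a"
    using s(3) by (simp add: z_def)
  have pow: "(z ^^ Suc (Suc m)) a = (y ^^ Suc m) a" if "\<And>k. 0 < k \<Longrightarrow> k \<le> m \<Longrightarrow> (y ^^ k) a \<notin> block w a" for m
    using that
  proof (induction m)
    case 0
    then show ?case by (simp add: z1 z2)
  next
    case (Suc m)
    then have "(z ^^ Suc (Suc m)) a = (y ^^ Suc m) a" by simp
    moreover have "z ((y ^^ Suc m) a) = y ((y ^^ Suc m) a)"
      using s_id[OF Suc.prems not_p, of "Suc m"] by (simp add: z_def)
    ultimately show ?case by simp
  qed
  have ret_y: "0 < ret a y" "(y ^^ ret a y) a \<in> block w a"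
    using ret[OF y.signed_perm_axioms] by auto
  have not_a: "(y ^^ k) a \<notin> block w a" if "0 < k" "k < ret a y" for k
    using ret_le[of k y a] that by linarith
  have end_z: "(z ^^ Suc (ret a y)) a = (y ^^ ret a y) a"
    using pow[of "ret a y - 1"] not_a ret_y(1) by (cases "ret a y") auto
  have *: "ret a z = Suc (ret a y)"
    unfolding ret_def[of a z]
  proof (rule Least_equality)
    show "0 < Suc (ret a y) \<and> (z ^^ Suc (ret a y)) a \<in> block w a"
      using end_z ret_y by simp
    fix m assume m: "0 < m \<and> (z ^^ m) a \<in> block w a"
    show "Suc (ret a y) \<le> m"
    proof (rule ccontr)
      assume less: "\<not> Suc (ret a y) \<le> m"
      have "m \<noteq> 1" using m z1 p by auto
      then obtain k where k: "m = Suc (Suc k)"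
        using m by (metis Suc_pred' not0_implies_Suc One_nat_def gr0_implies_Suc)
      then have "(z ^^ m) a = (y ^^ Suc k) a"
        using less not_a by (simp only: k) (rule pow, auto)
      then show False
        using not_a[of "Suc k"] m less k by auto
    qed
  qed
  then show "ret a (y \<circ> s) = Suc (ret a y)"
    by (simp add: z_def)
  show "((y \<circ> s) ^^ ret a (y \<circ> s)) a = (y ^^ ret a y) a"
    unfolding z_def[symmetric] * by (rule end_z)
  show disj: "zspan a y \<inter> block w p = {}"
  proof -
    have "block w a \<subseteq> - block w p"
      using a block_trans block_sym[of _ a] by blast
    then show ?thesis
      using zspan_least[of a "- block w p" y] y_iff by blast
  qed
  have step: "z r \<in> zspan a y \<union> block w p" if "r \<in> zspan a y \<union> block w p" for r
  proof (cases "r \<in> block w a")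
    case True
    then have "z r = s r"
      using s_p y_p by (simp add: z_def)
    then show ?thesis using True s_p by simp
  next
    case r: False
    show ?thesis
    proof (cases "r \<in> block w p")
      case True
      then have "s r \<in> zspan a y"
        using s_a block_subset_zspan by blast
      then show ?thesis
        by (simp add: z_def zspan_step)
    next
      case False
      then show ?thesis
        using that r by (simp add: z_def s_id zspan_step)
    qed
  qed
  have "zspan a z \<subseteq> zspan a y \<union> block w p"
    using block_subset_zspan step by (intro zspan_least) auto
  moreover have p_sub: "block w p \<subseteq> zspan a z"
  proof
    fix r assume r: "r \<in> block w p"
    have "surj s"
      using commD(1)[OF s(1)] by (rule permutes_surj)
    then obtain q where q: "r = s q" by (auto simp: surj_def)
    then have "q \<in> block w a" using r s_p by simp
    then have "z q \<in> zspan a z" using block_subset_zspan zspan_step by blast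
    then show "r \<in> zspan a z" using q y_p[OF r] by (simp add: z_def)
  qed
  moreover have "zspan a y \<subseteq> zspan a z"
  \<comment> \<open>The span of \<open>z\<close> is closed under \<open>y\<close>: a point of the
    block of \<open>a\<close> is \<open>s q\<close> with \<open>q\<close> in the block of
    \<open>p\<close>, so its image under \<open>y\<close> is \<open>z q\<close>.\<close>
  proof (rule zspan_least[OF block_subset_zspan])
    fix r assume r: "r \<in> zspan a z"
    have "surj s"
      using commD(1)[OF s(1)] by (rule permutes_surj)
    then obtain q where q: "r = s q" by (auto simp: surj_def)
    consider "r \<in> block w p" | "r \<in> block w a" | "r \<notin> block w a" "r \<notin> block w p" by blast
    then show "y r \<in> zspan a z"
    proof cases
      case 1
      then show ?thesis using y_p r by simp
    next
      case 2
      then have "q \<in> block w p" using q s_a by simp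
      then have "z q \<in> zspan a z" using p_sub zspan_step by blast
      then show ?thesis using q by (simp add: z_def)
    next
      case 3
      then have "y r = z r" by (simp add: z_def s_id)
      then show ?thesis using zspan_step[OF r] by simp
    qed
  qed
  ultimately have eq: "zspan a z = zspan a y \<union> block w p" by blast
  then show "zspan a (y \<circ> s) = zspan a y \<union> block w p"
    by (simp add: z_def)
  show "(y \<circ> s) r = y r" if "r \<notin> zspan a (y \<circ> s)"
    using that eq block_subset_zspan s_id by (fastforce simp: z_def)
qed

lemma fixed_block:
  assumes "stable w Y" "a \<in> Y" "z \<in> comm w Y" "z a \<in> block w a"
  shows "ret a z = 1" "zspan a z = block w a"
proof -
  show "ret a z = 1"
    unfolding ret_def using assms(4) by (intro Least_equality) auto
  have "z r \<in> block w a" if "r \<in> block w a" for r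
    using that comm_mem_block[OF assms(3), of r a] block_eq[OF assms(4)] by simp
  then show "zspan a z = block w a"
    using block_subset_zspan zspan_least[of a "block w a" z] by blast
qed

text \<open>If \<open>p = z a\<close> lies outside the block of \<open>a\<close>, then
  \<open>z = y \<circ> s p\<close> with \<open>y\<close> supported off the block of
  \<open>p\<close>, so one block is peeled off at a time until the block of \<open>a\<close> is
  preserved. The exchanges \<open>s\<close> are a parameter because they will be chosen with
  character value 1.\<close>

lemma comm_induct:
  assumes "stable w Y" "Y \<subseteq> X" "a \<in> Y" "z \<in> comm w Y"
    and s: "\<And>p. p \<in> X \<Longrightarrow> same_type w p a \<Longrightarrow> p \<notin> block w a \<Longrightarrow>
      s p \<in> comm w (block w a \<union> block w p) \<and> s p a = p \<and> s p p = a"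
    and base: "\<And>Y z. stable w Y \<Longrightarrow> Y \<subseteq> X \<Longrightarrow> a \<in> Y \<Longrightarrow> z \<in> comm w Y \<Longrightarrow> z a \<in> block w a \<Longrightarrow> P Y z"
    and step: "\<And>Y y p. stable w Y \<Longrightarrow> Y \<subseteq> X \<Longrightarrow> a \<in> Y \<Longrightarrow> p \<in> Y \<Longrightarrow> same_type w p a \<Longrightarrow>
      p \<notin> block w a \<Longrightarrow> y \<in> comm w (Y - block w p) \<Longrightarrow> P (Y - block w p) y \<Longrightarrow> P Y (y \<circ> s p)"
  shows "P Y z"
  using assms(1-4)
proof (induction "card Y" arbitrary: Y z rule: less_induct)
  case less
  show ?case
  proof (cases "z a \<in> block w a")
    case False
    define p where "p = z a"
    have p: "p \<in> Y" "same_type w p a" "p \<notin> block w a"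
      using less.prems(3) False comm_same_type[OF less.prems(4)] permutes_in_image[OF commD(1)[OF less.prems(4)]]
      by (auto simp: p_def)
    then have p0: "p \<noteq> 0"
      using less.prems(1) by (auto simp: stable_def)
    have sp: "s p \<in> comm w (block w a \<union> block w p)" "s p a = p" "s p p = a"
      using s[of p] p less.prems(2) by auto
    have "s p \<in> comm w Y"
      using sp(1) comm_mono[of "block w a \<union> block w p" Y] block_subset[OF less.prems(1)] p(1)
        less.prems(3) by blast
    then obtain y where y: "y \<in> comm w (Y - block w p)" "z = y \<circ> s p"
      using comm_fiber[of "s p" Y a p] sp(2) less.prems(4) p_def by blast
    have "card (Y - block w p) < card Y"
      using less.prems(1) p(1) block_self by (intro psubset_card_mono) (auto simp: stable_def)
    then have "P (Y - block w p) y"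
      using less.prems p y block_sym[of a p] stable_Diff[OF less.prems(1) stable_block[OF p0]]
      by (intro less.hyps) auto
    then show ?thesis
      using y p step less.prems by blast
  qed (use less.prems base in blast)
qed

text \<open>One factor sees only the cycle through \<open>a\<close>, the other only its complement.
  The functions stay arbitrary because peeling off a block turns \<phi> into
  \<open>\<lambda>k. \<phi> (Suc k)\<close>.\<close>

definition cycle_weight :: "(nat \<Rightarrow> int \<Rightarrow> 'r) \<Rightarrow> (int set \<Rightarrow> (int \<Rightarrow> int) \<Rightarrow> 'r) \<Rightarrow> int \<Rightarrow>
    int set \<Rightarrow> (int \<Rightarrow> int) \<Rightarrow> 'r :: comm_ring_1" where
  "cycle_weight \<phi> \<Psi> a Y z = \<phi> (ret a z) ((z ^^ ret a z) a) *
     \<Psi> (Y - zspan a z) (perm_restrict z (Y - zspan a z))"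

text \<open>Split by \<open>p = z a\<close>. Inside the block of \<open>a\<close> the return time is
  1 and the return point is \<open>p\<close>. Outside, \<open>insert_block\<close> raises the return
  time by 1 and keeps the return point and the complement of the cycle.\<close>

lemma sum_cycle_weight_rec:
  assumes Y: "stable w Y" "a \<in> Y"
  shows "(\<Sum>z\<in>comm w Y. cycle_weight \<phi> \<Psi> a Y z) =
    (\<Sum>q\<in>block w a. \<phi> 1 q) * (\<Sum>y\<in>comm w (Y - block w a). \<Psi> (Y - block w a) y) +
    (\<Sum>p | p \<in> Y \<and> same_type w p a \<and> p \<notin> block w a. \<Sum>y\<in>comm w (Y - block w p).
       cycle_weight (\<lambda>k. \<phi> (Suc k)) \<Psi> a (Y - block w p) y)"
proof -
  let ?Q = "{p \<in> Y. same_type w p a}"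
  let ?R = "{p \<in> Y. same_type w p a \<and> p \<notin> block w a}"
  let ?W = "\<lambda>p y. cycle_weight (\<lambda>k. \<phi> (Suc k)) \<Psi> a (Y - block w p) y"
  have "\<forall>p\<in>?Q. \<exists>s. s \<in> comm w (block w a \<union> block w p) \<and> s a = p \<and> (p \<notin> block w a \<longrightarrow> s p = a)"
    using exists_comm_map[OF Y] by blast
  then obtain s where s: "\<And>p. p \<in> Y \<Longrightarrow> same_type w p a \<Longrightarrow>
      s p \<in> comm w (block w a \<union> block w p) \<and> s p a = p \<and> (p \<notin> block w a \<longrightarrow> s p p = a)"
    using bchoice[of ?Q "\<lambda>p s. s \<in> comm w (block w a \<union> block w p) \<and> s a = p \<and> (p \<notin> block w a \<longrightarrow> s p = a)"]
    by auto
  have sY: "s p \<in> comm w Y \<and> s p a = p" if "p \<in> Y" "same_type w p a" for p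
    using s[OF that] comm_mono[of "block w a \<union> block w p" Y] block_subset[OF Y(1)] that Y(2) by blast
  have Q: "?Q = block w a \<union> ?R"
    using same_type_block block_subset[OF Y] by blast
  have fin: "finite Y" using Y by (simp add: stable_def)
  have in_block: "cycle_weight \<phi> \<Psi> a Y (y \<circ> s p) = \<phi> 1 p * \<Psi> (Y - block w a) y"
    if p: "p \<in> block w a" and y: "y \<in> comm w (Y - block w a)" for p y
  proof -
    have pY: "p \<in> Y" "same_type w p a"
      using p Q by auto
    have bp: "block w p = block w a"
      using block_eq[OF p] .
    have sp: "s p \<in> comm w (block w a)" "s p a = p"
      using s[OF pY] bp by auto
    have z: "y \<circ> s p \<in> comm w Y"
      using y sY[OF pY] comm_mono[of "Y - block w a" Y] by (intro comm_comp) auto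
    have yp: "y r = r" if "r \<notin> Y - block w a" for r
      using permutes_not_in[OF commD(1)[OF y] that] .
    have za: "(y \<circ> s p) a = p"
      using yp[of p] p sp by simp
    have "perm_restrict (y \<circ> s p) (Y - block w a) = y"
      using yp permutes_not_in[OF commD(1)[OF sp(1)]] by (auto simp: perm_restrict_def fun_eq_iff)
    then show ?thesis
      using fixed_block[OF Y z] za p by (simp add: cycle_weight_def)
  qed
  have out_block: "cycle_weight \<phi> \<Psi> a Y (y \<circ> s p) = ?W p y"
    if p: "p \<in> Y" "same_type w p a" "p \<notin> block w a" and y: "y \<in> comm w (Y - block w p)" for p y
  proof -
    have sp: "s p \<in> comm w (block w a \<union> block w p)" "s p a = p" "s p p = a"
      using s[OF p(1,2)] p(3) by auto
    have ins: "ret a (y \<circ> s p) = Suc (ret a y)"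
      "((y \<circ> s p) ^^ ret a (y \<circ> s p)) a = (y ^^ ret a y) a"
      "zspan a (y \<circ> s p) = zspan a y \<union> block w p"
      "\<And>r. r \<notin> zspan a (y \<circ> s p) \<Longrightarrow> (y \<circ> s p) r = y r"
      using insert_block[OF finite_Diff[OF fin] _ y sp p(3)] by blast+
    have eq: "Y - zspan a (y \<circ> s p) = Y - block w p - zspan a y"
      using ins(3) by auto
    have "perm_restrict (y \<circ> s p) (Y - zspan a (y \<circ> s p)) = perm_restrict y (Y - zspan a (y \<circ> s p))"
      using ins(4) by (auto simp: perm_restrict_def fun_eq_iff)
    then show ?thesis
      unfolding cycle_weight_def ins(2) by (simp only: ins(1) eq)
  qed
  have "(\<Sum>z\<in>comm w Y. cycle_weight \<phi> \<Psi> a Y z) =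
     (\<Sum>p\<in>?Q. \<Sum>y\<in>comm w (Y - block w p). cycle_weight \<phi> \<Psi> a Y (y \<circ> s p))"
    using sum_comm_fibers[OF Y sY, of "cycle_weight \<phi> \<Psi> a Y"] by simp
  also have "\<dots> = (\<Sum>p\<in>block w a. \<Sum>y\<in>comm w (Y - block w p). cycle_weight \<phi> \<Psi> a Y (y \<circ> s p)) +
     (\<Sum>p\<in>?R.
       \<Sum>y\<in>comm w (Y - block w p). cycle_weight \<phi> \<Psi> a Y (y \<circ> s p))"
    unfolding Q by (subst sum.union_disjoint) (use fin in auto)
  also have "(\<Sum>p\<in>block w a. \<Sum>y\<in>comm w (Y - block w p). cycle_weight \<phi> \<Psi> a Y (y \<circ> s p)) =
     (\<Sum>q\<in>block w a. \<phi> 1 q) * (\<Sum>y\<in>comm w (Y - block w a). \<Psi> (Y - block w a) y)"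
    unfolding sum_product using in_block block_eq by (intro sum.cong refl) auto
  also have "(\<Sum>p\<in>?R.
       \<Sum>y\<in>comm w (Y - block w p). cycle_weight \<phi> \<Psi> a Y (y \<circ> s p)) =
     (\<Sum>p\<in>?R. \<Sum>y\<in>comm w (Y - block w p).
       ?W p y)"
    using out_block by (intro sum.cong refl) auto
  finally show ?thesis .
qed

text \<open>On average over \<open>comm w Y\<close>, the number of blocks in the cycle of the block of \<open>a\<close> is
  uniformly distributed, and so is its return point.\<close>

lemma sum_cycle_weight:
  assumes "stable w Y" "a \<in> Y" "card {p \<in> Y. same_type w p a} = 2 * cyc_len w a * b"
    and "\<And>k Z. stable w Z \<Longrightarrow> Z \<subseteq> Y \<Longrightarrow> (\<And>r. r \<in> Y - Z \<Longrightarrow> same_type w r a) \<Longrightarrow>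
      card {p \<in> Y. same_type w p a} = card {p \<in> Z. same_type w p a} + 2 * cyc_len w a * k \<Longrightarrow> 0 < k \<Longrightarrow>
      (\<Sum>y\<in>comm w Z. \<Psi> Z y) = of_nat (card (comm w Z)) * G k"
  shows "(\<Sum>z\<in>comm w Y. cycle_weight \<phi> \<Psi> a Y z) =
    of_nat (card (comm w (Y - block w a))) * (\<Sum>k\<in>{1..b}. (\<Sum>q\<in>block w a. \<phi> k q) * G k)"
  using assms
proof (induction b arbitrary: Y \<phi> G)
  case 0
  \<comment> \<open>This is impossible, as \<open>a\<close> itself belongs to the set.\<close>
  then have "{p \<in> Y. same_type w p a} = {}"
    by (auto simp: stable_def)
  then show ?case
    using 0 by (auto simp: same_type_def)
next
  case (Suc b)
  let ?c = "\<lambda>p. card (comm w (Y - block w p - block w a))"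
  let ?l = "cyc_len w a" and ?Q = "\<lambda>Y. {p \<in> Y. same_type w p a}"
  let ?R = "{p. p \<in> Y \<and> same_type w p a \<and> p \<notin> block w a}"
  note Y = Suc.prems(1,2)
  have fin: "finite Y" and a0: "a \<noteq> 0" using Y by (auto simp: stable_def)
  have l: "?l > 0" by (rule cyc_len(1))
  have card_Diff: "card (?Q Y) = card (?Q (Y - block w p)) + 2 * ?l" if "p \<in> Y" "same_type w p a" for p
  proof -
    have p0: "p \<noteq> 0" using that Y by (auto simp: stable_def)
    have "?Q Y = ?Q (Y - block w p) \<union> block w p"
      using block_subset[OF Y(1) that(1)] same_type_block[of _ p] that(2) by (auto simp: same_type_def)
    moreover have "card (block w p) = 2 * ?l"
      using that(2) card_block[OF p0] by (simp add: same_type_def)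
    moreover have "card (?Q (Y - block w p) \<union> block w p) = card (?Q (Y - block w p)) + card (block w p)"
      using fin by (intro card_Un_disjoint) auto
    ultimately show ?thesis
      by simp
  qed
  have Q_b: "card (?Q (Y - block w p)) = 2 * ?l * b" if "p \<in> Y" "same_type w p a" for p
    using card_Diff[OF that] Suc.prems(3) by simp
  have R: "?R = ?Q (Y - block w a)" by auto
  have first: "(\<Sum>y\<in>comm w (Y - block w a). \<Psi> (Y - block w a) y) =
      of_nat (card (comm w (Y - block w a))) * G 1"
    using Y card_Diff[of a] same_type_block
    by (intro Suc.prems(4) stable_Diff stable_block[OF a0]) (auto simp: same_type_def)
  have rest: "(\<Sum>y\<in>comm w (Y - block w p). cycle_weight (\<lambda>k. \<phi> (Suc k)) \<Psi> a (Y - block w p) y) =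
      of_nat ((?c p)) *
        (\<Sum>k\<in>{1..b}. (\<Sum>q\<in>block w a. \<phi> (Suc k) q) * G (Suc k))" if p: "p \<in> ?R" for p
  proof (rule Suc.IH)
    have p': "p \<in> Y" "same_type w p a" "p \<noteq> 0" using p Y by (auto simp: stable_def)
    show st: "stable w (Y - block w p)"
      using Y p' by (intro stable_Diff stable_block)
    show "a \<in> Y - block w p"
      using Y p block_sym[of a p] by blast
    show "card (?Q (Y - block w p)) = 2 * ?l * b"
      by (rule Q_b[OF p'(1,2)])
    fix k Z assume Z: "stable w Z" "Z \<subseteq> Y - block w p" "\<And>r. r \<in> Y - block w p - Z \<Longrightarrow> same_type w r a"
      "card (?Q (Y - block w p)) = card (?Q Z) + 2 * ?l * k"
    \<comment> \<open>The block of \<open>p\<close> is already gone, so taking \<open>k\<close>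
      blocks from \<open>Y - block w p\<close> means taking \<open>Suc k\<close> blocks from
      \<open>Y\<close>.\<close>
    show "(\<Sum>y\<in>comm w Z. \<Psi> Z y) = of_nat (card (comm w Z)) * G (Suc k)"
    proof (rule Suc.prems(4)[OF Z(1)])
      show "same_type w r a" if "r \<in> Y - Z" for r
        using Z(3)[of r] that same_type_block[of r p] p'(2) by (cases "r \<in> block w p") (auto simp: same_type_def)
      show "card (?Q Y) = card (?Q Z) + 2 * ?l * Suc k"
        using card_Diff[OF p'(1,2)] Z(4) by simp
    qed (use Z in auto)
  qed
  \<comment> \<open>Orbit-stabilizer on \<open>Y - block w p\<close> shows that \<open>?c p\<close>
    is the same for all \<open>p\<close> in \<open>?R\<close> and that the sum over
    \<open>?R\<close> restores the order for \<open>Y - block w a\<close>. So passing to longer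
    return times loses no weight, which is the uniformity.\<close>
  have c: "card ?R * (?c p) = card (comm w (Y - block w a))" if p: "p \<in> ?R" for p
  proof -
    have p': "p \<in> Y" "same_type w p a" "p \<noteq> 0" using p Y by (auto simp: stable_def)
    have "card ?R = card (?Q (Y - block w p))"
      unfolding R using Q_b[OF p'(1,2)] Q_b[OF Y(2)] by (simp add: same_type_def)
    moreover have "card (comm w (Y - block w p)) = card (?Q (Y - block w p)) * (?c p)"
      using Y p p' block_sym[of a p] by (intro card_comm stable_Diff stable_block) auto
    ultimately show ?thesis
      using card_comm_Diff[OF Y p'(1,2)] by simp
  qed
  have sum_c: "(\<Sum>p\<in>?R. (?c p)) = card (comm w (Y - block w a))" if "b > 0"
  proof -
    have R_pos: "card ?R > 0"
      unfolding R using Q_b[OF Y(2)] l that by (simp add: same_type_def)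
    then obtain p0 where p0: "p0 \<in> ?R"
      by (metis card_gt_0_iff ex_in_conv)
    have "(\<Sum>p\<in>?R. (?c p)) =
        (\<Sum>p\<in>?R. card (comm w (Y - block w p0 - block w a)))"
    proof (rule sum.cong[OF refl])
      fix p assume p: "p \<in> ?R"
      have "card ?R * (?c p) = card ?R * card (comm w (Y - block w p0 - block w a))"
        using c[OF p] c[OF p0] by (simp only:)
      then show "(?c p) = card (comm w (Y - block w p0 - block w a))"
        using R_pos by (simp only: mult_cancel1) simp
    qed
    then show ?thesis
      using c[OF p0] by simp
  qed
  let ?C = "of_nat (card (comm w (Y - block w a)))"
  let ?G = "\<lambda>k. (\<Sum>q\<in>block w a. \<phi> k q) * G k"
  have "(\<Sum>z\<in>comm w Y. cycle_weight \<phi> \<Psi> a Y z) =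
     (\<Sum>q\<in>block w a. \<phi> 1 q) * (?C * G 1) +
     (\<Sum>p\<in>?R. of_nat ((?c p)) * (\<Sum>k\<in>{1..b}. ?G (Suc k)))"
    unfolding sum_cycle_weight_rec[OF Y] first by (simp only: sum.cong[OF refl rest])
  also have "(\<Sum>p\<in>?R. of_nat ((?c p)) * (\<Sum>k\<in>{1..b}. ?G (Suc k))) =
     of_nat (\<Sum>p\<in>?R. (?c p)) * (\<Sum>k\<in>{1..b}. ?G (Suc k))"
    by (simp add: sum_distrib_right)
  \<comment> \<open>For \<open>b = 0\<close> both sides vanish, because the range of
    \<open>k\<close> is empty.\<close>
  also have "\<dots> = ?C * (\<Sum>k\<in>{1..b}. ?G (Suc k))"
    using sum_c by (cases "b = 0") auto
  also have "(\<Sum>k\<in>{1..b}. ?G (Suc k)) = (\<Sum>k\<in>{Suc 1..Suc b}. ?G k)"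
    by (rule sum.shift_bounds_cl_Suc_ivl[symmetric])
  also have "(\<Sum>q\<in>block w a. \<phi> 1 q) * (?C * G 1) + ?C * (\<Sum>k\<in>{Suc 1..Suc b}. ?G k) =
     ?C * (\<Sum>k\<in>{1..Suc b}. ?G k)"
    by (subst sum.atLeast_Suc_atMost[of 1 "Suc b"]) (simp_all only: distrib_left mult.assoc mult.left_commute le_add2 plus_1_eq_Suc[symmetric])
  finally show ?case .
qed

end

section \<open>Cycle types of centralizing elements\<close>

text \<open>Points are counted in place of cycles: a signed cycle of length \<open>i\<close> has
  \<open>2 * i\<close> entries, \<open>i\<close> of them positive, and so contributes
  \<open>i\<close> copies of its variable, its exponent in the monomials of the generating
  series.\<close>

definition type_mset :: "(nat \<Rightarrow> z2class \<Rightarrow> 'v) \<Rightarrow> (int \<Rightarrow> int) \<Rightarrow> int set \<Rightarrow> 'v multiset" where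
  "type_mset v w Y = image_mset (\<lambda>p. v (cyc_len w p) (cyc_class w p)) (mset_set {p \<in> Y. 0 < p})"

lemma card_positive:
  assumes "stable w Y"
  shows "card Y = 2 * card {p \<in> Y. 0 < p}"
proof -
  have fin: "finite Y" and neg: "\<And>r. - r \<in> Y \<longleftrightarrow> r \<in> Y" and "0 \<notin> Y"
    using assms by (auto simp: stable_def)
  have "r \<in> Y \<longleftrightarrow> r \<in> {p \<in> Y. 0 < p} \<union> uminus ` {p \<in> Y. 0 < p}" for r
  proof (cases "0 < r")
    case False
    then have "r \<in> uminus ` {p \<in> Y. 0 < p} \<longleftrightarrow> - r \<in> {p \<in> Y. 0 < p}"
      by (metis (no_types, lifting) add.inverse_inverse image_iff)
    then show ?thesis
      using False neg[of r] \<open>0 \<notin> Y\<close> by (cases "r = 0") auto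
  qed auto
  then have "Y = {p \<in> Y. 0 < p} \<union> uminus ` {p \<in> Y. 0 < p}"
    by blast
  then have "card Y = card ({p \<in> Y. 0 < p} \<union> uminus ` {p \<in> Y. 0 < p})"
    by simp
  also have "\<dots> = card {p \<in> Y. 0 < p} + card (uminus ` {p \<in> Y. 0 < p})"
    using fin by (intro card_Un_disjoint) auto
  also have "card (uminus ` {p \<in> Y. 0 < p}) = card {p \<in> Y. 0 < p}"
    by (intro card_image) (auto simp: inj_on_def)
  finally show ?thesis by simp
qed

lemma type_mset_Diff:
  assumes "finite Y" "Z \<subseteq> Y"
  shows "type_mset v w Y = type_mset v w (Y - Z) + type_mset v w Z"
proof -
  have "{p \<in> Y. 0 < p} = {p \<in> Y - Z. 0 < p} \<union> {p \<in> Z. 0 < p}"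
    using assms by auto
  moreover have "mset_set ({p \<in> Y - Z. 0 < p} \<union> {p \<in> Z. 0 < p}) =
      mset_set {p \<in> Y - Z. 0 < p} + mset_set {p \<in> Z. 0 < p}"
    using assms finite_subset[OF assms(2,1)] by (intro mset_set_Union) auto
  ultimately show ?thesis
    by (simp add: type_mset_def)
qed

lemma type_mset_cong:
  assumes "\<And>p. p \<in> Y \<Longrightarrow> cyc_len w p = cyc_len z p \<and> cyc_class w p = cyc_class z p"
  shows "type_mset v w Y = type_mset v z Y"
  unfolding type_mset_def
proof (rule image_mset_cong)
  fix p assume "p \<in># mset_set {p \<in> Y. 0 < p}"
  then have "p \<in> Y"
    by (metis (no_types, lifting) elem_mset_set mem_Collect_eq mset_set.infinite empty_iff set_mset_empty)
  then show "v (cyc_len w p) (cyc_class w p) = v (cyc_len z p) (cyc_class z p)"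
    using assms by simp
qed

lemma type_mset_const:
  assumes "stable x Y" "\<And>p. p \<in> Y \<Longrightarrow> cyc_len w p = l \<and> cyc_class w p = \<epsilon>" "card Y = 2 * n"
  shows "type_mset v w Y = replicate_mset n (v l \<epsilon>)"
proof -
  have "type_mset v w Y = image_mset (\<lambda>p. v l \<epsilon>) (mset_set {p \<in> Y. 0 < p})"
    unfolding type_mset_def using assms(1,2) by (intro image_mset_cong) (auto simp: stable_def)
  also have "\<dots> = replicate_mset (card {p \<in> Y. 0 < p}) (v l \<epsilon>)"
    by (simp add: image_mset_const_eq)
  finally show ?thesis
    using card_positive[OF assms(1)] assms(3) by simp
qed

context signed_perm
begin

lemma card_same_type:
  assumes "stable w Y" 
  shows "\<exists>b. card {p \<in> Y. same_type w p a} = 2 * cyc_len w a * b"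
  using assms
proof (induction "card Y" arbitrary: Y rule: less_induct)
  case less
  show ?case
  proof (cases "{p \<in> Y. same_type w p a} = {}")
    case True
    then show ?thesis by (intro exI[of _ 0]) (simp only: card.empty)
  next
    case False
    then obtain p where p: "p \<in> Y" "same_type w p a" by auto
    then have p0: "p \<noteq> 0" and fin: "finite Y" using less.prems by (auto simp: stable_def)
    have "card (Y - block w p) < card Y"
      using fin p(1) block_self[of p] by (intro psubset_card_mono) auto
    then obtain b where b: "card {q \<in> Y - block w p. same_type w q a} = 2 * cyc_len w a * b"
      using less.hyps[OF _ stable_Diff[OF less.prems stable_block[OF p0]]] by blast
    have "{p \<in> Y. same_type w p a} = {q \<in> Y - block w p. same_type w q a} \<union> block w p"
      using block_subset[OF less.prems p(1)] same_type_block[of _ p] p(2) by (auto simp: same_type_def)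
    moreover have "card ({q \<in> Y - block w p. same_type w q a} \<union> block w p) =
        card {q \<in> Y - block w p. same_type w q a} + card (block w p)"
      using fin by (intro card_Un_disjoint) auto
    ultimately have "card {p \<in> Y. same_type w p a} = 2 * cyc_len w a * Suc b"
      using b p(2) card_block[OF p0] by (simp add: same_type_def)
    then show ?thesis by blast
  qed
qed

lemma stable_same_type:
  assumes "stable w Y"
  shows "stable w {p \<in> Y. same_type w p a}"
proof (rule stableI)
  fix r assume r: "r \<in> {p \<in> Y. same_type w p a}"
  have "w r \<in> block w r" "- r \<in> block w r"
    by (simp_all add: block_w block_neg block_self)
  then have "same_type w (w r) r" "same_type w (- r) r"
    by (blast intro: same_type_block)+
  then show "w r \<in> {p \<in> Y. same_type w p a}" "- r \<in> {p \<in> Y. same_type w p a}"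
    using r assms by (auto simp: same_type_def stable_def)
qed (use assms in \<open>auto simp: stable_def\<close>)

lemma count_type_mset:
  assumes "stable w Y" "inj (case_prod v)" "card {p \<in> Y. same_type w p a} = 2 * n"
  shows "count (type_mset v w Y) (v (cyc_len w a) (cyc_class w a)) = n"
proof -
  let ?Q = "{p \<in> Y. same_type w p a}"
  have v: "v l \<epsilon> = v l' \<epsilon>' \<longleftrightarrow> l = l' \<and> \<epsilon> = \<epsilon>'" for l l' \<epsilon> \<epsilon>'
    using injD[OF assms(2), of "(l, \<epsilon>)" "(l', \<epsilon>')"] by auto
  have fin: "finite Y" using assms(1) by (simp add: stable_def)
  have "type_mset v w Y = type_mset v w (Y - ?Q) + type_mset v w ?Q"
    using fin by (intro type_mset_Diff) auto
  moreover have "type_mset v w ?Q = replicate_mset n (v (cyc_len w a) (cyc_class w a))"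
    using stable_same_type[OF assms(1), of a] assms(3)
    by (intro type_mset_const[of w]) (auto simp: same_type_def)
  moreover have "v (cyc_len w a) (cyc_class w a) \<notin># type_mset v w (Y - ?Q)"
    using fin by (auto simp: type_mset_def v same_type_def)
  ultimately show ?thesis
    by (simp add: not_in_iff)
qed

text \<open>Let \<open>k = ret a z\<close>. As \<open>z\<close> commutes with \<open>w\<close>,
  \<open>(z ^^ (k * m)) a = c ^ m * (w ^^ (r * m)) a\<close>, and \<open>a\<close> is in its block
  only at multiples of \<open>k\<close>. The first positive \<open>m\<close> with
  \<open>l dvd r * m\<close> is \<open>l div gcd r l\<close>. By then \<open>w\<close> has made
  \<open>r div gcd r l\<close> full turns, each with the sign \<open>s\<close>.\<close>

lemma cyc_type_at_return:
  assumes Y: "stable w Y" "a \<in> Y" and z: "z \<in> comm w Y"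
    and c: "c \<in> {1, - 1}" and rt: "(z ^^ ret a z) a = c * (w ^^ r) a"
  defines "l \<equiv> cyc_len w a" and "s \<equiv> class_sign (cyc_class w a)"
  shows "cyc_len z a = ret a z * (l div gcd r l)"
    and "class_sign (cyc_class z a) = c ^ (l div gcd r l) * s ^ (r div gcd r l)"
proof -
  let ?k = "ret a z"
  have a0: "a \<noteq> 0" and fin: "finite Y" using Y by (auto simp: stable_def)
  have l: "l > 0" unfolding l_def by (rule cyc_len(1))
  interpret z: signed_perm z
    using z fin by (rule comm_signed_perm)
  have k: "0 < ?k" by (rule ret(1)[OF z.signed_perm_axioms])
  have z_pow: "z ^^ m \<in> comm w Y" for m
  proof (induction m)
    case (Suc m)
    then show ?case using comm_comp[OF z Suc] by (simp only: funpow.simps)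
  qed (simp only: funpow.simps comm_id)
  have pow: "(z ^^ (?k * m)) a = c ^ m * (w ^^ (r * m)) a" for m
  proof (induction m)
    case (Suc m)
    have "(z ^^ (?k * Suc m)) a = (z ^^ ?k) ((z ^^ (?k * m)) a)"
      by (simp add: funpow_add)
    also have "\<dots> = c ^ m * (w ^^ (r * m)) ((z ^^ ?k) a)"
      unfolding Suc.IH by (rule comm_block_elem[OF z_pow sign_power_cases[OF c]])
    also have "\<dots> = c ^ m * (c * (w ^^ (r * m)) ((w ^^ r) a))"
      unfolding rt by (simp only: pow_sign[OF c])
    also have "(w ^^ (r * m)) ((w ^^ r) a) = (w ^^ (r * m + r)) a"
      by (simp only: funpow_add comp_apply)
    also have "c ^ m * (c * \<dots>) = c ^ Suc m * (w ^^ (r * Suc m)) a"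
      by (simp add: add.commute)
    finally show ?case .
  qed simp
  \<comment> \<open>Powers of \<open>z\<close> permute the blocks, so a nonzero remainder of
    \<open>m\<close> modulo \<open>?k\<close> would bring \<open>a\<close> back to its block before
    the first return.\<close>
  have in_block: "?k dvd m" if m: "(z ^^ m) a \<in> block w a" for m
  proof (rule ccontr)
    assume *: "\<not> ?k dvd m"
    let ?b = "(z ^^ (?k * (m div ?k))) a"
    have b: "?b \<in> block w a"
      unfolding pow by (rule block_pow[OF sign_power_cases[OF c]])
    have "(z ^^ m) a = (z ^^ (m mod ?k + ?k * (m div ?k))) a"
      by simp
    also have "\<dots> = (z ^^ (m mod ?k)) ?b"
      by (simp only: funpow_add comp_apply)
    finally have eq: "(z ^^ (m mod ?k)) ?b \<in> block w a"
      using m by simp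
    have "(z ^^ (m mod ?k)) ?b \<in> block w ((z ^^ (m mod ?k)) a)"
      using comm_mem_block[OF z_pow, of "m mod ?k" ?b a] b by simp
    then have "(z ^^ (m mod ?k)) a \<in> block w ((z ^^ (m mod ?k)) ?b)"
      by (rule block_sym)
    then have "(z ^^ (m mod ?k)) a \<in> block w a"
      using eq by (rule block_trans)
    moreover have "0 < m mod ?k"
      using * by (auto simp: dvd_eq_mod_eq_0)
    ultimately have "?k \<le> m mod ?k"
      by (intro ret_le)
    then show False
      using k mod_less_divisor[of ?k m] by linarith
  qed
  let ?j = "l div gcd r l"
  have j: "?j > 0"
    using l by (simp add: div_greater_zero_iff gcd_le2_nat)
  have lj: "l dvd r * m \<longleftrightarrow> ?j dvd m" for m
  proof -
    define g where "g = gcd r l"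
    have g: "g > 0" using l by (simp add: g_def)
    then obtain r' l' where lr: "r = r' * g" "l = l' * g" "coprime r' l'"
      unfolding g_def using gcd_coprime_exists[of r l] by auto
    have "l dvd r * m \<longleftrightarrow> l' * g dvd (r' * m) * g"
      unfolding lr(1,2) by (simp only: ac_simps)
    also have "\<dots> \<longleftrightarrow> l' dvd r' * m"
      using g by simp
    also have "\<dots> \<longleftrightarrow> l' dvd m"
      using lr(3) by (simp add: coprime_commute coprime_dvd_mult_right_iff)
    also have "l' = l div g"
      using lr(2) g by simp
    finally show ?thesis
      by (simp add: g_def)
  qed
  have rj: "r * ?j = l * (r div gcd r l)"
    by (simp add: div_mult_swap mult.commute)
  have val: "(z ^^ (?k * ?j)) a = (c ^ ?j * s ^ (r div gcd r l)) * a"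
    unfolding pow rj l_def[symmetric] using pow_cyc_len_mult[of a "r div gcd r l"]
    by (simp add: l_def s_def)
  have pm: "c ^ ?j * s ^ (r div gcd r l) \<in> {1, - 1}"
    using sign_power_cases[OF c, of ?j] sign_power_cases[OF class_sign_cases, of "cyc_class w a" "r div gcd r l"]
    by (auto simp: s_def)
  then obtain \<epsilon> where \<epsilon>: "class_sign \<epsilon> = c ^ ?j * s ^ (r div gcd r l)"
    using class_sign.simps(1) class_sign.simps(2) by (metis insertE singletonD)
  have min: "?k * ?j \<le> m" if m: "0 < m" "(z ^^ m) a = a \<or> (z ^^ m) a = - a" for m
  proof -
    have "(z ^^ m) a \<in> block w a"
      using m(2) block_self[of a] block_neg[of a a] by auto
    then obtain n where n: "m = ?k * n"
      using in_block by (auto elim: dvdE)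
    have "(w ^^ (r * n)) a = 1 * a \<or> (w ^^ (r * n)) a = - 1 * a"
      using m(2) sign_power_cases[OF c, of n] unfolding n pow by auto
    then have "l dvd r * n"
      using pow_eq_sign_iff[OF a0, of 1 "r * n"] pow_eq_sign_iff[OF a0, of "- 1" "r * n"]
      unfolding l_def by blast
    then have "?j \<le> n"
      using lj n m(1) by (intro dvd_imp_le) auto
    then show ?thesis
      using n by simp
  qed
  have pos: "0 < ?k * ?j"
    using k j by simp
  note val' = val[folded \<epsilon>]
  show "cyc_len z a = ?k * ?j"
    by (rule z.cyc_lenI(1)[OF pos val' a0 min])
  have "cyc_class z a = \<epsilon>"
    by (rule z.cyc_lenI(2)[OF pos val' a0 min])
  then show "class_sign (cyc_class z a) = c ^ ?j * s ^ (r div gcd r l)"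
    using \<epsilon> by simp
qed

text \<open>Every point of the span is the image of \<open>a\<close> under a power of
  \<open>z\<close> composed with a signed power of \<open>w\<close>, and these maps commute with
  both \<open>z\<close> and \<open>w\<close>.\<close>

lemma zspan_type:
  assumes Y: "stable w Y" "a \<in> Y" and z: "z \<in> comm w Y" and p: "p \<in> zspan a z"
  shows "same_type z p a" "same_type w p a"
proof -
  have fin: "finite Y" using Y by (auto simp: stable_def)
  interpret z: signed_perm z
    using z fin by (rule comm_signed_perm)
  have "zspan a z \<subseteq> {p. same_type z p a \<and> same_type w p a}"
  proof (rule zspan_least)
    show "block w a \<subseteq> {p. same_type z p a \<and> same_type w p a}"
    proof
      fix p assume p: "p \<in> block w a"
      then obtain c m where cm: "c \<in> {1, - 1}" "p = c * (w ^^ m) a"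
        by (rule blockE)
      let ?h = "\<lambda>r. c * (w ^^ m) r"
      have "inj ?h"
        using cm(1) by (auto simp: inj_on_def pow_eq_iff)
      moreover have "?h (z r) = z (?h r)" for r
        using comm_block_elem[OF z cm(1), of m r] by simp
      ultimately have "same_type z p a"
        using cyc_type_transfer[of ?h z z a] by (simp add: cm(2) pow_neg same_type_def)
      then show "p \<in> {p. same_type z p a \<and> same_type w p a}"
        using same_type_block[OF p] by simp
    qed
    fix r assume r: "r \<in> {p. same_type z p a \<and> same_type w p a}"
    have "same_type z (z r) r"
      using cyc_type_transfer[of z z z r] z.inj z.neg by (simp add: same_type_def)
    then show "z r \<in> {p. same_type z p a \<and> same_type w p a}"
      using r comm_same_type[OF z, of r] by (simp add: same_type_def)
  qed
  then show "same_type z p a" "same_type w p a"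
    using p by auto
qed

end

lemma type_mset_perm_restrict:
  assumes "\<And>r. z r \<in> V \<longleftrightarrow> r \<in> V"
  shows "type_mset v (perm_restrict z V) V = type_mset v z V"
proof (rule type_mset_cong)
  fix p assume p: "p \<in> V"
  have "((perm_restrict z V) ^^ m) p = (z ^^ m) p \<and> (z ^^ m) p \<in> V" for m
    using p assms by (induction m) (auto simp: perm_restrict_def)
  then show "cyc_len (perm_restrict z V) p = cyc_len z p \<and> cyc_class (perm_restrict z V) p = cyc_class z p"
    by (simp add: cyc_len_def cyc_class_def)
qed

section \<open>Higher Lie characters on centralizers\<close>

text \<open>Faithfulness on the cyclic group of a block is expressed by the exact order of one root
  of unity, the form that the character sums take. Working with \<open>comm\<close> lets
  \<open>X\<close> be replaced by its stable subsets during the induction.\<close>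

locale lie_character = signed_perm w for w :: "int \<Rightarrow> int" +
  fixes X Tr :: "int set" and \<omega> :: "(int \<Rightarrow> int) \<Rightarrow> complex"
  assumes stable_X: "stable w X"
    and \<omega>_comp: "y \<in> comm w X \<Longrightarrow> z \<in> comm w X \<Longrightarrow> \<omega> (y \<circ> z) = \<omega> y * \<omega> z"
    and \<omega>_uminus: "p \<in> X \<Longrightarrow> cyc_class w p = Pos \<Longrightarrow> \<omega> (perm_restrict uminus (block w p)) = 1"
    and \<omega>_cycle: "p \<in> X \<Longrightarrow> primitive_root (if cyc_class w p = Pos then cyc_len w p else 2 * cyc_len w p)
      (\<omega> (perm_restrict w (block w p)))"
    and transversal: "p \<in> X \<Longrightarrow> \<exists>!t. t \<in> Tr \<inter> block w p"
    and \<omega>_trivial: "z \<in> comm w X \<Longrightarrow> z ` Tr = Tr \<Longrightarrow> \<omega> z = 1"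
    and Tr_subset: "Tr \<subseteq> X"
begin

lemma \<omega>_id: "\<omega> id = 1"
  by (rule \<omega>_trivial) (simp_all add: comm_id)

lemma comm_X: "Y \<subseteq> X \<Longrightarrow> z \<in> comm w Y \<Longrightarrow> z \<in> comm w X"
  using comm_mono by blast

text \<open>Exchange \<open>a\<close> with the first entry \<open>t\<close> of the other block: this
  preserves \<open>Tr\<close>, so \<omega> is 1 on it. Conjugating by a rotation \<open>g\<close>
  with \<open>g t = p\<close> moves the exchanged point from \<open>t\<close> to \<open>p\<close>,
  and a character does not change under conjugation.\<close>

lemma exists_trivial_swap:
  assumes a: "a \<in> Tr" and p: "p \<in> X" "same_type w p a" "p \<notin> block w a"
  shows "\<exists>s\<in>comm w (block w a \<union> block w p). s a = p \<and> s p = a \<and> \<omega> s = 1"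
proof -
  have aX: "a \<in> X" using a Tr_subset by auto
  have nz: "a \<noteq> 0" "p \<noteq> 0" using aX p stable_X by (auto simp: stable_def)
  obtain t where t: "t \<in> Tr" "t \<in> block w p"
    using transversal[OF p(1)] by blast
  have bt: "block w t = block w p"
    using block_eq[OF t(2)] .
  have t_a: "t \<notin> block w a"
  proof
    assume "t \<in> block w a"
    then have "block w p = block w a" using block_eq bt by metis
    then show False using p(3) block_self by metis
  qed
  have t0: "t \<noteq> 0" using t Tr_subset stable_X by (auto simp: stable_def)
  have a_p: "a \<notin> block w p"
    using p(3) block_sym[of a p] by blast
  have "same_type w t a"
    using same_type_block[OF t(2)] p(2) by (simp add: same_type_def)
  then obtain s0 where s0: "s0 \<in> comm w (block w a \<union> block w p)" "s0 a = t" "s0 t = a"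
    using exists_swap[OF nz(1) t0 _ t_a] bt by auto
  obtain g where g: "g \<in> comm w (block w p)" "g t = p"
    using exists_rotation[OF t0, of p] bt block_self[of p] by auto
  have sub: "block w a \<union> block w p \<subseteq> X" "block w p \<subseteq> X"
    using block_subset[OF stable_X] aX p by auto
  have s0X: "s0 \<in> comm w X" and gX: "g \<in> comm w X"
    using comm_X sub s0 g by blast+
  \<comment> \<open>\<open>Tr\<close> meets the two blocks only in \<open>a\<close> and
    \<open>t\<close>, which \<open>s0\<close> exchanges.\<close>
  have s0_Tr: "s0 r \<in> Tr \<and> s0 (s0 r) = r" if "r \<in> Tr" for r
  proof -
    have "r = a" if "r \<in> block w a"
      using transversal[OF aX] a block_self[of a] \<open>r \<in> Tr\<close> that by blast
    moreover have "r = t" if "r \<in> block w p"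
      using transversal[OF p(1)] t \<open>r \<in> Tr\<close> that by blast
    moreover have "s0 r = r" if "r \<notin> block w a \<union> block w p"
      using permutes_not_in[OF commD(1)[OF s0(1)] that] .
    ultimately show ?thesis
      using s0 t(1) a that by (cases "r \<in> block w a \<union> block w p") auto
  qed
  then have "s0 ` Tr = Tr"
    by (auto simp: image_iff) (metis s0_Tr)
  then have \<omega>_s0: "\<omega> s0 = 1"
    using s0X by (intro \<omega>_trivial)
  have bij: "bij g"
    using commD(1)[OF g(1)] by (rule permutes_bij)
  let ?g' = "inv_into UNIV g"
  have g': "?g' \<in> comm w (block w p)"
    using g(1) by (rule comm_inv)
  have g'X: "?g' \<in> comm w X"
    using comm_X sub(2) g' by blast
  have "\<omega> (g \<circ> ?g') = 1"
    using bij_is_surj[OF bij] \<omega>_id by (simp add: surj_iff)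
  then have \<omega>g: "\<omega> g * \<omega> ?g' = 1"
    using \<omega>_comp[OF gX g'X] by simp
  let ?s = "g \<circ> (s0 \<circ> ?g')"
  have "?s \<in> comm w (block w a \<union> block w p)"
    using g(1) g' s0(1) comm_mono[of "block w p" "block w a \<union> block w p"]
    by (intro comm_comp) auto
  moreover have "?g' a = a" "g a = a"
    using permutes_not_in[OF commD(1)[OF g'] a_p] permutes_not_in[OF commD(1)[OF g(1)] a_p] by auto
  then have "?s a = p"
    using s0 g by simp
  moreover have "?g' p = t"
    using inv_f_f[OF bij_is_inj[OF bij], of t] g(2) by simp
  then have "?s p = a"
    using s0 \<open>g a = a\<close> by simp
  moreover have "\<omega> ?s = \<omega> g * (\<omega> s0 * \<omega> ?g')"
    using \<omega>_comp[OF gX comm_comp[OF s0X g'X]] \<omega>_comp[OF s0X g'X] by simp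
  then have "\<omega> ?s = 1"
    using \<omega>_s0 \<omega>g by simp
  ultimately show ?thesis
    by (intro bexI[of _ ?s]) auto
qed

text \<open>For nonzero \<open>a\<close>, the group \<open>comm w (block w a)\<close> is simply
  transitive on the block of \<open>a\<close>, so for \<open>q\<close> in this block the choice is
  forced.\<close>

definition rot :: "int \<Rightarrow> int \<Rightarrow> int \<Rightarrow> int" where
  "rot a q = (SOME g. g \<in> comm w (block w a) \<and> g a = q)"

lemma rot:
  assumes "a \<noteq> 0" "q \<in> block w a"
  shows "rot a q \<in> comm w (block w a)" "rot a q a = q"
proof -
  have "\<exists>g. g \<in> comm w (block w a) \<and> g a = q"
    using exists_rotation[OF assms] by blast
  then have "rot a q \<in> comm w (block w a) \<and> rot a q a = q"
    unfolding rot_def by (rule someI_ex)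
  then show "rot a q \<in> comm w (block w a)" "rot a q a = q" by auto
qed

lemma rot_unique:
  assumes "a \<noteq> 0" "g \<in> comm w (block w a)"
  shows "rot a (g a) = g"
proof
  fix r
  have "g a \<in> block w a"
    using permutes_in_image[OF commD(1)[OF assms(2)]] block_self by blast
  note rt = rot[OF assms(1) this]
  show "rot a (g a) r = g r"
  proof (cases "r \<in> block w a")
    case True
    show ?thesis
      using rt(1) assms(2) rt(2) True by (rule comm_unique)
  next
    case False
    then show ?thesis
      using permutes_not_in[OF commD(1)[OF rt(1)]] permutes_not_in[OF commD(1)[OF assms(2)]] by simp
  qed
qed

lemma \<omega>_split:
  assumes Y: "stable w Y" "Y \<subseteq> X" and z: "z \<in> comm w Y"
    and U: "stable w U" "U \<subseteq> Y" "\<And>r. z r \<in> U \<longleftrightarrow> r \<in> U"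
  shows "\<omega> z = \<omega> (perm_restrict z U) * \<omega> (perm_restrict z (Y - U))"
    "perm_restrict z (Y - U) \<in> comm w (Y - U)" "perm_restrict z U \<in> comm w U"
proof -
  show 1: "perm_restrict z U \<in> comm w U"
    using comm_perm_restrict[OF z U(1,3)] .
  have "z r \<in> Y - U \<longleftrightarrow> r \<in> Y - U" for r
    using U(3) permutes_in_image[OF commD(1)[OF z]] by simp
  then show 2: "perm_restrict z (Y - U) \<in> comm w (Y - U)"
    using comm_perm_restrict[OF z stable_Diff[OF Y(1) U(1)]] by simp
  have "z = perm_restrict z U \<circ> perm_restrict z (Y - U)"
    using U(3) permutes_in_image[OF commD(1)[OF z]] permutes_not_in[OF commD(1)[OF z]]
    by (auto simp: perm_restrict_def fun_eq_iff)
  then show "\<omega> z = \<omega> (perm_restrict z U) * \<omega> (perm_restrict z (Y - U))"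
    using \<omega>_comp[of "perm_restrict z U" "perm_restrict z (Y - U)"] 1 2
      comm_X[of U] comm_X[of "Y - U"] Y(2) U(2) by auto
qed

text \<open>Inserting a block composes with an exchange of character value 1, keeps the return point
  and the complement of the cycle, and adds one block to the span. By \<open>comm_induct\<close> it
  remains to treat a \<open>z\<close> that preserves the block of \<open>a\<close>, whose
  restriction to that block is the rotation itself.\<close>

lemma \<omega>_factor:
  assumes "stable w Y" "Y \<subseteq> X" "a \<in> Y" "a \<in> Tr" "z \<in> comm w Y"
  shows "\<omega> z = \<omega> (rot a ((z ^^ ret a z) a)) * \<omega> (perm_restrict z (Y - zspan a z)) \<and>
    card (zspan a z) = 2 * (cyc_len w a * ret a z)"
proof -
  have a0: "a \<noteq> 0" using assms by (auto simp: stable_def)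
  have "\<forall>p\<in>{p \<in> X. same_type w p a \<and> p \<notin> block w a}. \<exists>s. s \<in> comm w (block w a \<union> block w p) \<and>
      s a = p \<and> s p = a \<and> \<omega> s = 1"
    using exists_trivial_swap[OF assms(4)] by blast
  from bchoice[OF this] obtain s where s: "\<And>p. p \<in> X \<Longrightarrow> same_type w p a \<Longrightarrow> p \<notin> block w a \<Longrightarrow>
      s p \<in> comm w (block w a \<union> block w p) \<and> s p a = p \<and> s p p = a \<and> \<omega> (s p) = 1"
    by auto
  have s': "s p \<in> comm w (block w a \<union> block w p) \<and> s p a = p \<and> s p p = a"
    if "p \<in> X" "same_type w p a" "p \<notin> block w a" for p
    using s that by blast
  let ?P = "\<lambda>Y z. \<omega> z = \<omega> (rot a ((z ^^ ret a z) a)) * \<omega> (perm_restrict z (Y - zspan a z)) \<and>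
    card (zspan a z) = 2 * (cyc_len w a * ret a z)"
  show ?thesis
  proof (rule comm_induct[where P = ?P and s = s, OF assms(1-3,5) s'])
    fix Y z
    assume fixed: "stable w Y" "Y \<subseteq> X" "a \<in> Y" "z \<in> comm w Y" "z a \<in> block w a"
    note fb = fixed_block[OF fixed(1,3,4,5)]
    have iff: "z r \<in> block w a \<longleftrightarrow> r \<in> block w a" for r
      using comm_mem_block[OF fixed(4), of r a] block_eq[OF fixed(5)] by simp
    note split = \<omega>_split[OF fixed(1,2,4) stable_block[OF a0] block_subset[OF fixed(1,3)] iff]
    have "perm_restrict z (block w a) a = z a"
      using block_self by (simp add: perm_restrict_def)
    then have "rot a (z a) = perm_restrict z (block w a)"
      using rot_unique[OF a0 split(3)] by simp
    then show "?P Y z"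
      using split(1) by (simp add: fb card_block[OF a0])
  next
    fix Y y p
    assume insert: "stable w Y" "Y \<subseteq> X" "a \<in> Y" "p \<in> Y" "same_type w p a" "p \<notin> block w a"
      "y \<in> comm w (Y - block w p)" "?P (Y - block w p) y"
    have pX: "p \<in> X" using insert by auto
    note sp = s[OF pX insert(5,6)]
    have fin: "finite (Y - block w p)" using insert(1) by (simp add: stable_def)
    have disj: "(Y - block w p) \<inter> block w p = {}" by blast
    have sp1: "s p \<in> comm w (block w a \<union> block w p)" "s p a = p" "s p p = a"
      using sp by auto
    note ins = insert_block[OF fin disj insert(7) sp1 insert(6)]
    have eq: "Y - zspan a (y \<circ> s p) = Y - block w p - zspan a y"
      using ins(3) by auto
    have "perm_restrict (y \<circ> s p) (Y - zspan a (y \<circ> s p)) = perm_restrict y (Y - zspan a (y \<circ> s p))"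
      using ins(5) by (auto simp: perm_restrict_def fun_eq_iff)
    then have restr: "perm_restrict (y \<circ> s p) (Y - zspan a (y \<circ> s p)) = perm_restrict y (Y - block w p - zspan a y)"
      unfolding eq .
    have sub: "block w a \<union> block w p \<subseteq> X"
      using block_subset[OF stable_X] pX insert(2,3) by auto
    have "\<omega> (y \<circ> s p) = \<omega> y"
      using \<omega>_comp[OF comm_X[OF _ insert(7)] comm_X[OF sub sp1(1)]] sp insert(2) by auto
    moreover have "finite (zspan a y)"
      using stable_zspan[OF stable_Diff[OF insert(1) stable_block] _ insert(7)] pX insert(3,6) stable_X block_sym[of a p]
      by (auto simp: stable_def)
    then have "card (zspan a (y \<circ> s p)) = card (zspan a y) + card (block w p)"
      unfolding ins(3) using ins(4) by (intro card_Un_disjoint) auto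
    moreover have "p \<noteq> 0"
      using pX stable_X by (auto simp: stable_def)
    then have "card (block w p) = 2 * cyc_len w a"
      using card_block[of p] insert(5) by (simp add: same_type_def)
    ultimately show "?P Y (y \<circ> s p)"
      using insert(8) unfolding ins(2) restr by (simp add: ins(1))
  qed
qed

definition comm_monomial :: "int set \<Rightarrow> (int \<Rightarrow> int) \<Rightarrow> (indet, complex) mps" where
  "comm_monomial Y z = mps_const (\<omega> z) * mps_monom (type_mset S w Y + type_mset T z Y)"

text \<open>A cycle through \<open>k\<close> blocks with return point \<open>q\<close> has the class
  of the rotation to \<open>q\<close> and \<open>k\<close> times its length, which explains the
  index of the t-variable.\<close>

definition cycle_monomial :: "int \<Rightarrow> nat \<Rightarrow> int \<Rightarrow> (indet, complex) mps" where
  "cycle_monomial a k q = mps_const (\<omega> (rot a q)) *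
     mps_monom (st_monomial (cyc_len w a) (cyc_class w a) (k * cyc_len (rot a q) a)
       (cyc_class (rot a q) a) (cyc_len w a * k))"

text \<open>The element \<open>z\<close> and the rotation to its return point have the same return
  point, with return times \<open>ret a z\<close> and 1. Hence \<open>cyc_type_at_return\<close>
  gives both the same class, and lengths in the ratio of the return times.\<close>

lemma comm_monomial_eq_cycle_weight:
  assumes Y: "stable w Y" "Y \<subseteq> X" "a \<in> Y" "a \<in> Tr" and z: "z \<in> comm w Y"
  shows "comm_monomial Y z = cycle_weight (cycle_monomial a) comm_monomial a Y z"
proof -
  have a0: "a \<noteq> 0" and fin: "finite Y" using Y by (auto simp: stable_def)
  interpret z: signed_perm z
    using z fin by (rule comm_signed_perm)
  let ?k = "ret a z" and ?U = "zspan a z"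
  let ?q = "(z ^^ ?k) a"
  let ?g = "rot a ?q"
  have q: "?q \<in> block w a"
    by (rule ret(2)[OF z.signed_perm_axioms])
  note g = rot[OF a0 q]
  obtain c r where c: "c \<in> {1, - 1}" and cr: "?q = c * (w ^^ r) a"
    using q by (rule blockE)
  have st_a: "stable w (block w a)"
    using stable_block[OF a0] .
  have ret_g: "ret a ?g = 1"
    using fixed_block(1)[OF st_a block_self g(1)] g(2) q by simp
  note type_z = cyc_type_at_return[OF Y(1,3) z c cr]
  have "(?g ^^ ret a ?g) a = c * (w ^^ r) a"
    using ret_g g(2) cr by simp
  note type_g = cyc_type_at_return[OF st_a block_self g(1) c this]
  have len: "cyc_len z a = ?k * cyc_len ?g a"
    using type_z(1) type_g(1) ret_g by simp
  have "class_sign (cyc_class z a) = class_sign (cyc_class ?g a)"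
    using type_z(2) type_g(2) by simp
  then have cls: "cyc_class z a = cyc_class ?g a"
    by (cases "cyc_class z a"; cases "cyc_class ?g a") auto
  have U: "?U \<subseteq> Y" "stable w ?U"
    using zspan_subset[OF Y(1,3) z] stable_zspan[OF Y(1,3) z] by auto
  have card: "card ?U = 2 * (cyc_len w a * ?k)"
    and \<omega>: "\<omega> z = \<omega> ?g * \<omega> (perm_restrict z (Y - ?U))"
    using \<omega>_factor[OF Y z] by auto
  have S_U: "type_mset S w ?U = replicate_mset (cyc_len w a * ?k) (S (cyc_len w a) (cyc_class w a))"
    using zspan_type(2)[OF Y(1,3) z] card by (intro type_mset_const[OF U(2)]) (auto simp: same_type_def)
  have T_U: "type_mset T z ?U = replicate_mset (cyc_len w a * ?k) (T (?k * cyc_len ?g a) (cyc_class ?g a))"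
    using zspan_type(1)[OF Y(1,3) z] card len cls by (intro type_mset_const[OF U(2)]) (auto simp: same_type_def)
  have "z r \<in> Y - ?U \<longleftrightarrow> r \<in> Y - ?U" for r
    using zspan_iff[OF z.signed_perm_axioms] permutes_in_image[OF commD(1)[OF z]] by simp
  then have T_rest: "type_mset T (perm_restrict z (Y - ?U)) (Y - ?U) = type_mset T z (Y - ?U)"
    by (rule type_mset_perm_restrict)
  have "type_mset S w Y + type_mset T z Y =
    st_monomial (cyc_len w a) (cyc_class w a) (?k * cyc_len ?g a) (cyc_class ?g a) (cyc_len w a * ?k) +
    (type_mset S w (Y - ?U) + type_mset T (perm_restrict z (Y - ?U)) (Y - ?U))"
    unfolding T_rest type_mset_Diff[OF fin U(1), of S] type_mset_Diff[OF fin U(1), of T] S_U T_U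
    by (simp only: ac_simps)
  then show ?thesis
    unfolding comm_monomial_def cycle_weight_def cycle_monomial_def \<omega>
    by (simp only: mps_const_mult mps_monom_mult ac_simps)
qed

end

context signed_perm
begin

lemma sum_block:
  fixes f :: "int \<Rightarrow> 'a :: comm_monoid_add"
  assumes "a \<noteq> 0"
  shows "(\<Sum>q\<in>block w a. f q) = (\<Sum>r<cyc_len w a. f ((w ^^ r) a) + f (- (w ^^ r) a))"
proof -
  have "(\<Sum>q\<in>block w a. f q) = (\<Sum>(c, r)\<in>{1, - 1} \<times> {..<cyc_len w a}. f (c * (w ^^ r) a))"
    unfolding block_eq_image by (subst sum.reindex[OF inj_on_block_image[OF assms]]) (simp add: case_prod_unfold)
  also have "\<dots> = (\<Sum>c\<in>{1, - 1}. \<Sum>r<cyc_len w a. f (c * (w ^^ r) a))"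
    by (rule sum.cartesian_product[symmetric])
  finally show ?thesis
    by (simp add: sum.distrib)
qed

lemma sum_block_Pos:
  fixes f :: "int \<Rightarrow> 'a :: comm_monoid_add"
  assumes "a \<noteq> 0"
  shows "(\<Sum>q\<in>block w a. f q) = (\<Sum>r<cyc_len w a. \<Sum>\<sigma><2. f ((- 1) ^ \<sigma> * (w ^^ r) a))"
  unfolding sum_block[OF assms] by (simp add: numeral_2_eq_2)

lemma sum_block_Neg:
  fixes f :: "int \<Rightarrow> 'a :: comm_monoid_add"
  assumes "a \<noteq> 0" "cyc_class w a = Neg"
  shows "(\<Sum>q\<in>block w a. f q) = (\<Sum>r<2 * cyc_len w a. f ((w ^^ r) a))"
proof -
  have "(w ^^ (r + cyc_len w a)) a = - (w ^^ r) a" for r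
    using cyc_len(2)[of a] assms(2) by (simp add: funpow_add pow_neg)
  then show ?thesis
    unfolding sum_block[OF assms(1)] sum_lessThan_double by simp
qed

lemma comm_w_restrict:
  assumes "stable w B"
  shows "perm_restrict w B \<in> comm w B"
proof -
  have sub: "w ` B \<subseteq> B" using assms by (auto simp: stable_def)
  have "inj_on w B" using inj by (rule inj_on_subset) simp
  then have "bij_betw w B B"
    using sub assms by (intro bij_betw_imageI card_subset_eq) (auto simp: stable_def card_image)
  then show ?thesis
    using comm_extend[OF assms, of w] neg by (simp add: perm_restrict_def[abs_def])
qed

lemma restrict_block_pow:
  assumes "a \<noteq> 0"
  shows "(perm_restrict w (block w a) ^^ r) \<in> comm w (block w a)"
    "(perm_restrict w (block w a) ^^ r) a = (w ^^ r) a"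
proof -
  let ?B = "block w a"
  let ?\<rho> = "perm_restrict w ?B"
  note \<rho> = comm_w_restrict[OF stable_block[OF assms]]
  have "(?\<rho> ^^ r) \<in> comm w ?B \<and> (?\<rho> ^^ r) a = (w ^^ r) a"
  proof (induction r)
    case 0
    show ?case
      using comm_id by (simp only: funpow.simps simp_thms)
  next
    case (Suc r)
    have "(w ^^ r) a \<in> ?B"
      using block_pow[of 1 r a] by simp
    then have "(?\<rho> \<circ> (?\<rho> ^^ r)) a = (w ^^ Suc r) a"
      using Suc by (simp add: perm_restrict_simps)
    moreover have "?\<rho> \<circ> (?\<rho> ^^ r) \<in> comm w ?B"
      using Suc \<rho> by (intro comm_comp) auto
    ultimately show ?case
      by (simp only: funpow.simps simp_thms)
  qed
  then show "(?\<rho> ^^ r) \<in> comm w ?B" "(?\<rho> ^^ r) a = (w ^^ r) a" by auto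
qed

lemma comm_uminus_restrict:
  assumes "stable w B"
  shows "perm_restrict uminus B \<in> comm w B"
proof -
  have "bij_betw uminus B B"
    using assms by (intro bij_betwI[where g = uminus]) (auto simp: stable_def)
  then show ?thesis
    using comm_extend[OF assms, of uminus] neg by (simp add: perm_restrict_def[abs_def])
qed

end

context lie_character
begin

lemma rot_type:
  assumes "a \<noteq> 0" "c \<in> {1, - 1}"
  defines "l \<equiv> cyc_len w a"
  shows "cyc_len (rot a (c * (w ^^ r) a)) a = l div gcd r l"
    "class_sign (cyc_class (rot a (c * (w ^^ r) a)) a) =
      c ^ (l div gcd r l) * class_sign (cyc_class w a) ^ (r div gcd r l)"
proof -
  let ?q = "c * (w ^^ r) a"
  have q: "?q \<in> block w a"
    using block_pow[OF assms(2)] .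
  note g = rot[OF assms(1) q]
  have st_a: "stable w (block w a)"
    using stable_block[OF assms(1)] .
  have ret_g: "ret a (rot a ?q) = 1"
    using fixed_block(1)[OF st_a block_self g(1)] g(2) q by simp
  then have "(rot a ?q ^^ ret a (rot a ?q)) a = c * (w ^^ r) a"
    using g(2) by simp
  note type_g = cyc_type_at_return[OF st_a block_self g(1) assms(2) this]
  show "cyc_len (rot a ?q) a = l div gcd r l"
    "class_sign (cyc_class (rot a ?q) a) = c ^ (l div gcd r l) * class_sign (cyc_class w a) ^ (r div gcd r l)"
    using type_g ret_g by (simp_all add: l_def)
qed

text \<open>The rotation to \<open>(w ^^ r) a\<close> is a power of \<open>w\<close> restricted to
  the block. For the opposite point it is multiplied by the negation of the block, on which \<omega>
  is 1 in class \<open>Pos\<close>.\<close>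

lemma \<omega>_rot:
  assumes a: "a \<in> X"
  shows "\<omega> (rot a ((w ^^ r) a)) = \<omega> (perm_restrict w (block w a)) ^ r"
    and "cyc_class w a = Pos \<Longrightarrow> \<omega> (rot a (- (w ^^ r) a)) = \<omega> (perm_restrict w (block w a)) ^ r"
proof -
  let ?B = "block w a"
  let ?\<rho> = "perm_restrict w ?B" and ?\<nu> = "perm_restrict uminus ?B"
  have a0: "a \<noteq> 0" using a stable_X by (auto simp: stable_def)
  have B: "stable w ?B" "?B \<subseteq> X"
    using stable_block[OF a0] block_subset[OF stable_X a] by auto
  note \<rho> = comm_w_restrict[OF B(1)] and \<nu> = comm_uminus_restrict[OF B(1)]
  note pow = restrict_block_pow[OF a0]
  have "\<omega> (?\<rho> ^^ r) = \<omega> ?\<rho> ^ r"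
  proof (induction r)
    case 0
    show ?case
      using \<omega>_id by (simp only: funpow.simps power_0)
  next
    case (Suc r)
    have "\<omega> (?\<rho> \<circ> (?\<rho> ^^ r)) = \<omega> ?\<rho> * \<omega> (?\<rho> ^^ r)"
      using pow \<rho> comm_X[OF B(2)] by (intro \<omega>_comp) auto
    then show ?case
      using Suc by (simp only: funpow.simps power_Suc)
  qed
  then have \<rho>_pow: "(?\<rho> ^^ r) \<in> comm w ?B \<and> (?\<rho> ^^ r) a = (w ^^ r) a \<and> \<omega> (?\<rho> ^^ r) = \<omega> ?\<rho> ^ r"
    using pow by simp
  then show "\<omega> (rot a ((w ^^ r) a)) = \<omega> ?\<rho> ^ r"
    using rot_unique[OF a0, of "?\<rho> ^^ r"] by simp
  assume pos: "cyc_class w a = Pos"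
  have "(w ^^ r) a \<in> ?B"
    using block_pow[of 1 r a] by simp
  then have "(?\<nu> \<circ> (?\<rho> ^^ r)) a = - (w ^^ r) a"
    using \<rho>_pow by (simp add: perm_restrict_simps)
  moreover have "?\<nu> \<circ> (?\<rho> ^^ r) \<in> comm w ?B"
    using \<rho>_pow \<nu> by (intro comm_comp) auto
  ultimately have "rot a (- (w ^^ r) a) = ?\<nu> \<circ> (?\<rho> ^^ r)"
    using rot_unique[OF a0, of "?\<nu> \<circ> (?\<rho> ^^ r)"] by simp
  moreover have "\<omega> (?\<nu> \<circ> (?\<rho> ^^ r)) = \<omega> ?\<nu> * \<omega> (?\<rho> ^^ r)"
    using \<rho>_pow \<nu> comm_X[OF B(2)] by (intro \<omega>_comp) auto
  ultimately show "\<omega> (rot a (- (w ^^ r) a)) = \<omega> ?\<rho> ^ r"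
    using \<rho>_pow \<omega>_uminus[OF a pos] by simp
qed

lemma class_signD: "class_sign \<epsilon> = class_sign \<theta> \<Longrightarrow> \<epsilon> = \<theta>"
  by (cases \<epsilon>; cases \<theta>) auto

text \<open>Numbering the points of the block by powers of \<open>w\<close> and signs,
  \<open>rot_type\<close> and \<open>\<omega>_rot\<close> express each coefficient through the
  exponent and the sign, and what results is one of the two character sums.\<close>

lemma sum_cycle_monomial:
  assumes a: "a \<in> X"
  shows "(\<Sum>q\<in>block w a. cycle_monomial a k q) = cycle_series (cyc_len w a) (cyc_class w a) k"
proof (rule mps_eqI)
  fix m
  have a0: "a \<noteq> 0" using a stable_X by (auto simp: stable_def)
  let ?l = "cyc_len w a" and ?\<epsilon> = "cyc_class w a"
  let ?\<zeta> = "\<omega> (perm_restrict w (block w a))"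
  define h :: "nat \<Rightarrow> z2class \<Rightarrow> complex" where
    "h d \<theta> = mps_coeff (mps_monom (st_monomial ?l ?\<epsilon> (k * d) \<theta> (?l * k))) m" for d \<theta>
  have coeff: "mps_coeff (cycle_monomial a k q) m = \<omega> (rot a q) * h (cyc_len (rot a q) a) (cyc_class (rot a q) a)" for q
    by (simp add: cycle_monomial_def h_def)
  have rhs: "mps_coeff (cycle_series ?l ?\<epsilon> k) m = (\<Sum>d | d dvd ?l. \<Sum>\<theta>\<in>UNIV. K ?\<epsilon> \<theta> d * h d \<theta>)"
    by (simp add: cycle_series_def mps_coeff_sum h_def)
  show "mps_coeff (\<Sum>q\<in>block w a. cycle_monomial a k q) m = mps_coeff (cycle_series ?l ?\<epsilon> k) m"
  proof (cases ?\<epsilon>)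
    case Pos
    have prim: "primitive_root ?l ?\<zeta>"
      using \<omega>_cycle[OF a] Pos by simp
    have "mps_coeff (\<Sum>q\<in>block w a. cycle_monomial a k q) m =
       (\<Sum>r<?l. \<Sum>\<sigma><2. mps_coeff (cycle_monomial a k ((- 1) ^ \<sigma> * (w ^^ r) a)) m)"
      unfolding mps_coeff_sum by (rule sum_block_Pos[OF a0])
    also have "\<dots> = (\<Sum>r<?l. \<Sum>\<sigma><2. ?\<zeta> ^ r * h (?l div gcd r ?l) (if odd (\<sigma> * (?l div gcd r ?l)) then Neg else Pos))"
    proof (intro sum.cong refl)
      fix r \<sigma> :: nat
      let ?q = "(- 1) ^ \<sigma> * (w ^^ r) a" and ?j = "?l div gcd r ?l"
      have c: "(- 1) ^ \<sigma> \<in> {1, - 1 :: int}"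
        by (rule sign_power_cases) simp
      have "\<omega> (rot a ?q) = ?\<zeta> ^ r"
        using \<omega>_rot[OF a, of r] Pos by (cases "even \<sigma>") auto
      moreover have "cyc_class (rot a ?q) a = (if odd (\<sigma> * ?j) then Neg else Pos)"
        using rot_type(2)[OF a0 c, of r] Pos by (intro class_signD) (auto simp flip: power_mult)
      ultimately show "mps_coeff (cycle_monomial a k ?q) m = ?\<zeta> ^ r * h ?j (if odd (\<sigma> * ?j) then Neg else Pos)"
        unfolding coeff rot_type(1)[OF a0 c] by simp
    qed
    also have "\<dots> = (\<Sum>d | d dvd ?l. \<Sum>\<theta>\<in>UNIV. K Pos \<theta> d * h d \<theta>)"
      by (rule character_sum_Pos[OF prim])
    finally show ?thesis
      unfolding rhs by (simp only: Pos)
  next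
    case Neg
    have prim: "primitive_root (2 * ?l) ?\<zeta>"
      using \<omega>_cycle[OF a] Neg by simp
    have "mps_coeff (\<Sum>q\<in>block w a. cycle_monomial a k q) m =
       (\<Sum>r<2 * ?l. mps_coeff (cycle_monomial a k ((w ^^ r) a)) m)"
      unfolding mps_coeff_sum by (rule sum_block_Neg[OF a0 Neg])
    also have "\<dots> = (\<Sum>r<2 * ?l. ?\<zeta> ^ r * h (?l div gcd r ?l) (if odd (r div gcd r ?l) then Neg else Pos))"
    proof (intro sum.cong refl)
      fix r :: nat
      have c: "1 \<in> {1, - 1 :: int}" by simp
      note rt = rot_type[OF a0 c, of r, unfolded mult_1]
      have "cyc_class (rot a ((w ^^ r) a)) a = (if odd (r div gcd r ?l) then Neg else Pos)"
        using rt(2) Neg by (intro class_signD) auto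
      then show "mps_coeff (cycle_monomial a k ((w ^^ r) a)) m =
          ?\<zeta> ^ r * h (?l div gcd r ?l) (if odd (r div gcd r ?l) then Neg else Pos)"
        unfolding coeff rt(1) using \<omega>_rot(1)[OF a, of r] by simp
    qed
    also have "\<dots> = (\<Sum>d | d dvd ?l. \<Sum>\<theta>\<in>UNIV. K Neg \<theta> d * h d \<theta>)"
      by (rule character_sum_Neg[OF prim])
    finally show ?thesis
      unfolding rhs by (simp only: Neg)
  qed
qed

theorem sum_comm_monomial:
  assumes "stable w Y" "Y \<subseteq> X"
  shows "(\<Sum>z\<in>comm w Y. comm_monomial Y z) =
    of_nat (card (comm w Y)) * s_component (type_mset S w Y) exp_series"
  using assms
proof (induction "card Y" arbitrary: Y rule: less_induct)
  case less
  have fin: "finite Y" using less.prems by (simp add: stable_def)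
  show ?case
  proof (cases "Y = {}")
    case True
    have "comm w {} = {id}"
      using comm_id by (auto simp: comm_def signed_perms_def)
    then show ?thesis
      using True by (simp add: comm_monomial_def \<omega>_id type_mset_def s_component_empty)
  next
    case False
    then obtain p where p: "p \<in> Y" by auto
    then obtain a where a: "a \<in> Tr" "a \<in> block w p"
      using transversal less.prems by blast
    then have aY: "a \<in> Y"
      using block_subset[OF less.prems(1) p] by auto
    then have aX: "a \<in> X" using less.prems by auto
    have a0: "a \<noteq> 0" using aX stable_X by (auto simp: stable_def)
    let ?l = "cyc_len w a" and ?\<epsilon> = "cyc_class w a" and ?A = "type_mset S w Y"
    let ?G = "\<lambda>k. s_component (?A - replicate_mset (?l * k) (S ?l ?\<epsilon>)) exp_series"
    let ?C = "card (comm w (Y - block w a))"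
    obtain b where b: "card {p \<in> Y. same_type w p a} = 2 * ?l * b"
      using card_same_type[OF less.prems(1)] by blast
    have injS: "inj (case_prod S)"
      by (auto simp: inj_def)
    have A: "count ?A (S ?l ?\<epsilon>) = ?l * b"
      using count_type_mset[OF less.prems(1) injS, of a "?l * b"] b by simp
    \<comment> \<open>The induction hypothesis in the shape that \<open>sum_cycle_weight\<close>
      requires: taking away \<open>k\<close> blocks of the type of \<open>a\<close> removes
      \<open>?l * k\<close> copies of its variable from the s-monomial.\<close>
    have G: "(\<Sum>y\<in>comm w Z. comm_monomial Z y) = of_nat (card (comm w Z)) * ?G k"
      if Z: "stable w Z" "Z \<subseteq> Y" "\<And>r. r \<in> Y - Z \<Longrightarrow> same_type w r a"
        "card {p \<in> Y. same_type w p a} = card {p \<in> Z. same_type w p a} + 2 * ?l * k" "0 < k" for k Z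
    proof -
      have "{p \<in> Y. same_type w p a} = {p \<in> Z. same_type w p a} \<union> (Y - Z)"
        using Z(2,3) by auto
      moreover have "card ({p \<in> Z. same_type w p a} \<union> (Y - Z)) = card {p \<in> Z. same_type w p a} + card (Y - Z)"
        using fin Z(2) finite_subset[OF Z(2) fin] by (intro card_Un_disjoint) auto
      ultimately have card: "card (Y - Z) = 2 * (?l * k)"
        using Z(4) by simp
      have "type_mset S w (Y - Z) = replicate_mset (?l * k) (S ?l ?\<epsilon>)"
        using Z(3) card
        by (intro type_mset_const[OF stable_Diff[OF less.prems(1) Z(1)]]) (auto simp: same_type_def)
      then have "type_mset S w Z = ?A - replicate_mset (?l * k) (S ?l ?\<epsilon>)"
        using type_mset_Diff[OF fin Z(2), of S w] by simp
      moreover have "card Z < card Y"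
        using card Z(2,5) cyc_len(1)[of a] fin by (intro psubset_card_mono) auto
      ultimately show ?thesis
        using less.hyps[OF _ Z(1)] Z(2) less.prems(2) by simp
    qed
    have "(\<Sum>z\<in>comm w Y. comm_monomial Y z) = (\<Sum>z\<in>comm w Y. cycle_weight (cycle_monomial a) comm_monomial a Y z)"
      using comm_monomial_eq_cycle_weight[OF less.prems aY a(1)] by (intro sum.cong refl)
    also have "\<dots> = of_nat ?C * (\<Sum>k\<in>{1..b}. (\<Sum>q\<in>block w a. cycle_monomial a k q) * ?G k)"
      using less.prems(1) aY b G by (rule sum_cycle_weight)
    also have "\<dots> = of_nat ?C * (mps_const (2 * of_nat (?l * b)) * s_component ?A exp_series)"
      unfolding sum_cycle_monomial[OF aX] using cyc_len(1)[of a] A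
      by (subst s_component_exp_series_rec) auto
    also have "mps_const (2 * of_nat (?l * b)) = (of_nat (2 * ?l * b) :: (indet, complex) mps)"
      unfolding mps_of_nat by (simp add: mult.assoc)
    \<comment> \<open>\<open>2 * ?l * b\<close> is the orbit length of \<open>a\<close>, so
      \<open>card_comm\<close> completes \<open>?C\<close> to the order of
      \<open>comm w Y\<close>.\<close>
    also have "of_nat ?C * (of_nat (2 * ?l * b) * s_component ?A exp_series) =
        of_nat (card (comm w Y)) * s_component ?A exp_series"
      unfolding card_comm[OF less.prems(1) aY] b by (simp only: of_nat_mult ac_simps)
    finally show ?thesis .
  qed
qed

end

section \<open>Hyperoctahedral groups\<close>

abbreviation of_type :: "(int \<Rightarrow> int) \<Rightarrow> int set \<Rightarrow> nat \<Rightarrow> z2class \<Rightarrow> int set" where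
  "of_type w X i \<epsilon> \<equiv> {p \<in> X. cyc_len w p = i \<and> cyc_class w p = \<epsilon>}"

lemma stable_signed_perms:
  assumes "x \<in> signed_perms X" "finite X" "0 \<notin> X" "uminus ` X \<subseteq> X"
  shows "stable x X"
proof -
  interpret signed_perm x
    using assms(1,2) by (rule signed_permI)
  have "x permutes X"
    using assms(1) by (simp add: signed_perms_def)
  then show ?thesis
    using assms(2-4) by (intro stableI) (auto simp: permutes_in_image)
qed

lemma carrier_hyperoctahedral: "carrier (hyperoctahedral n) = signed_perms (pm_set n)"
  by (simp add: hyperoctahedral_def signed_perms_def)

lemma pm_set: "finite (pm_set n)" "0 \<notin> pm_set n" "uminus ` pm_set n \<subseteq> pm_set n"
  "{p \<in> pm_set n. 0 < p} = {1..int n}"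
  by (auto simp: pm_set_def)

lemma stable_pm_set: "x \<in> signed_perms (pm_set n) \<Longrightarrow> stable x (pm_set n)"
  using pm_set by (intro stable_signed_perms)

lemma centralizer_eq_comm: "centralizer (hyperoctahedral n) x = comm x (pm_set n)"
  unfolding centralizer_def carrier_hyperoctahedral comm_def
  by (auto simp: hyperoctahedral_def fun_eq_iff)

lemma signed_perms_comp: "y \<in> signed_perms X \<Longrightarrow> z \<in> signed_perms X \<Longrightarrow> y \<circ> z \<in> signed_perms X"
  by (auto simp: signed_perms_def intro: permutes_compose)

lemma signed_perms_inv:
  assumes "z \<in> signed_perms X"
  shows "inv_into UNIV z \<in> signed_perms X"
  using comm_inv[of z id X] assms by (simp add: comm_def)

lemma signed_perms_inv_comp:
  assumes "z \<in> signed_perms X"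
  shows "inv_into UNIV z \<circ> z = id" "z \<circ> inv_into UNIV z = id"
  using assms permutes_inv_o[of z X] by (auto simp: signed_perms_def)

lemma group_hyperoctahedral: "group (hyperoctahedral n)"
proof (rule groupI)
  show "\<one>\<^bsub>hyperoctahedral n\<^esub> \<in> carrier (hyperoctahedral n)"
    by (simp add: hyperoctahedral_def permutes_id)
  show "\<exists>y\<in>carrier (hyperoctahedral n). y \<otimes>\<^bsub>hyperoctahedral n\<^esub> z = \<one>\<^bsub>hyperoctahedral n\<^esub>"
    if "z \<in> carrier (hyperoctahedral n)" for z
    using that signed_perms_inv[of z] signed_perms_inv_comp[of z]
    unfolding carrier_hyperoctahedral by (intro bexI[of _ "inv_into UNIV z"]) (auto simp: hyperoctahedral_def)
qed (use signed_perms_comp in \<open>auto simp: hyperoctahedral_def signed_perms_def comp_assoc\<close>)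

lemma inv_hyperoctahedral:
  assumes "k \<in> signed_perms (pm_set n)"
  shows "inv\<^bsub>hyperoctahedral n\<^esub> k = inv_into UNIV k"
proof (rule group.inv_equality[OF group_hyperoctahedral])
  show "inv_into UNIV k \<otimes>\<^bsub>hyperoctahedral n\<^esub> k = \<one>\<^bsub>hyperoctahedral n\<^esub>"
    using signed_perms_inv_comp[OF assms] by (simp add: hyperoctahedral_def)
qed (use assms signed_perms_inv in \<open>auto simp: carrier_hyperoctahedral\<close>)

context signed_perm
begin

lemma orbit_eq_powers: "orbit w p = range (\<lambda>m. (w ^^ m) p)"
proof -
  obtain m where "m > 0" "(w ^^ m) p = p"
    using periodic by blast
  then have "p \<in> orbit w p"
    unfolding orbit_altdef by force
  from orbit_altdef_self_in[OF this] show ?thesis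
    by auto
qed

lemma block_eq_orbit: "block w p = orbit w p \<union> uminus ` orbit w p"
proof (intro equalityI subsetI)
  fix r assume "r \<in> block w p"
  then show "r \<in> orbit w p \<union> uminus ` orbit w p"
    unfolding orbit_eq_powers by (elim blockE) auto
next
  fix r assume "r \<in> orbit w p \<union> uminus ` orbit w p"
  then show "r \<in> block w p"
    unfolding orbit_eq_powers using block_pow[of 1 _ p] block_pow[of "- 1" _ p] by auto
qed

lemma cyc_class_eq_Neg_iff:
  assumes "p \<noteq> 0"
  shows "cyc_class w p = Neg \<longleftrightarrow> - p \<in> orbit w p"
proof
  assume "cyc_class w p = Neg"
  then have "(w ^^ cyc_len w p) p = - p"
    using cyc_len(2)[of p] by simp
  then show "- p \<in> orbit w p"
    unfolding orbit_eq_powers by (metis rangeI)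
next
  assume "- p \<in> orbit w p"
  then obtain m where "(w ^^ m) p = - 1 * p"
    unfolding orbit_eq_powers by auto
  then have "class_sign (cyc_class w p) ^ (m div cyc_len w p) = - 1"
    using pow_eq_sign_iff[OF assms, of "- 1" m] by blast
  then show "cyc_class w p = Neg"
    by (cases "cyc_class w p") auto
qed

text \<open>Orbits that meet coincide, so an orbit that contains both \<open>p\<close> and
  \<open>- p\<close> is its own negative.\<close>

lemma cycle_class_orbit:
  assumes "p \<noteq> 0"
  shows "cycle_class (orbit w p) = cyc_class w p"
proof -
  have self: "p \<in> orbit w p"
    unfolding orbit_eq_powers using rangeI[of "\<lambda>m. (w ^^ m) p" 0] by simp
  have image: "uminus ` orbit w p = orbit w (- p)"
    unfolding orbit_eq_powers by (auto simp: pow_neg image_image)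
  have "uminus ` orbit w p = orbit w p \<longleftrightarrow> - p \<in> orbit w p"
  proof
    assume neg_in: "- p \<in> orbit w p"
    have "orbit w (- p) \<subseteq> orbit w p"
      using orbit_trans[OF _ neg_in] by blast
    moreover have "p \<in> orbit w (- p)"
      using orbit_swap[OF self neg_in] .
    then have "orbit w p \<subseteq> orbit w (- p)"
      using orbit_trans[of _ w p "- p"] by blast
    ultimately show "uminus ` orbit w p = orbit w p"
      unfolding image by blast
  qed (use imageI[OF self, of uminus] in simp)
  then show ?thesis
    using cyc_class_eq_Neg_iff[OF assms] by (cases "cyc_class w p") (auto simp: cycle_class_def)
qed

end

section \<open>Cycle types as numbers of points, and conjugacy\<close>

lemma signed_cycles_eq:
  assumes "x \<in> signed_perms (pm_set n)"
  shows "signed_cycles n x \<epsilon> = block x ` {p \<in> pm_set n. cyc_class x p = \<epsilon>}"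
proof -
  interpret signed_perm x
    using assms pm_set(1) by (rule signed_permI)
  have "p \<noteq> 0" if "p \<in> pm_set n" for p
    using that pm_set(2) by auto
  then show ?thesis
    unfolding signed_cycles_def block_eq_orbit by (auto simp: cycle_class_orbit)
qed

text \<open>The points of a given type are the disjoint union of the supports of the signed cycles
  of that type, each of size \<open>2 * i\<close>.\<close>

lemma count_cycle_type:
  assumes x: "x \<in> signed_perms (pm_set n)"
  shows "card (of_type x (pm_set n) i \<epsilon>) = 2 * (i * count (cycle_type n x \<epsilon>) i)"
proof -
  interpret signed_perm x
    using x pm_set(1) by (rule signed_permI)
  let ?X = "pm_set n"
  let ?D = "{D \<in> signed_cycles n x \<epsilon>. card D div 2 = i}"
  have nz: "p \<noteq> 0" if "p \<in> ?X" for p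
    using that pm_set(2) by auto
  have fin: "finite (signed_cycles n x \<epsilon>)"
    unfolding signed_cycles_eq[OF x] using pm_set(1) by simp
  have D: "?D = block x ` of_type x ?X i \<epsilon>"
    unfolding signed_cycles_eq[OF x] using nz by (auto simp: card_block)
  have "count (cycle_type n x \<epsilon>) i = card ?D"
  proof -
    have "count (cycle_type n x \<epsilon>) i = size (filter_mset (\<lambda>D. card D div 2 = i) (mset_set (signed_cycles n x \<epsilon>)))"
      by (simp add: cycle_type_def count_conv_size_mset filter_mset_image_mset comp_def eq_commute)
    then show ?thesis
      using fin by simp
  qed
  moreover have "of_type x ?X i \<epsilon> = \<Union>?D"
  proof -
    have "block x p \<subseteq> of_type x ?X i \<epsilon>"
      if "p \<in> of_type x ?X i \<epsilon>" for p
      using block_subset[OF stable_pm_set[OF x], of p] same_type_block[of _ p] that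
      by (auto simp: same_type_def)
    then show ?thesis
      unfolding D using block_self by blast
  qed
  moreover have "card (\<Union>?D) = (\<Sum>D\<in>?D. card D)"
  proof (rule card_Union_disjoint)
    show "pairwise disjnt ?D"
    proof (rule pairwiseI)
      fix C D assume CD: "C \<in> ?D" "D \<in> ?D" "C \<noteq> D"
      then obtain p q where pq: "C = block x p" "D = block x q"
        unfolding D by blast
      have "C = D" if "r \<in> C" "r \<in> D" for r
        using that block_eq pq by metis
      then show "disjnt C D"
        using CD(3) by (auto simp: disjnt_def)
    qed
  qed (auto simp: D)
  moreover have "(\<Sum>D\<in>?D. card D) = (\<Sum>D\<in>?D. 2 * i)"
    unfolding D using nz by (intro sum.cong refl) (auto simp: card_block)
  ultimately show ?thesis
    by simp
qed

lemma zero_notin_cycle_type: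
  assumes "x \<in> signed_perms (pm_set n)"
  shows "0 \<notin># cycle_type n x \<epsilon>"
proof -
  interpret signed_perm x
    using assms pm_set(1) by (rule signed_permI)
  have "p \<noteq> 0" if "p \<in> pm_set n" for p
    using that pm_set(2) by auto
  moreover have pos: "cyc_len x p \<noteq> 0" for p
    using cyc_len(1)[of p] by simp
  ultimately show ?thesis
    using pm_set(1) unfolding cycle_type_def signed_cycles_eq[OF assms] by (auto simp: card_block pos)
qed

lemma cycle_type_eq_iff:
  assumes "x \<in> signed_perms (pm_set n)" "z \<in> signed_perms (pm_set n)"
  shows "cycle_type n x = cycle_type n z \<longleftrightarrow>
    (\<forall>i \<epsilon>. card (of_type x (pm_set n) i \<epsilon>) = card (of_type z (pm_set n) i \<epsilon>))"
proof
  assume *: "\<forall>i \<epsilon>. card (of_type x (pm_set n) i \<epsilon>) = card (of_type z (pm_set n) i \<epsilon>)"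
  show "cycle_type n x = cycle_type n z"
  proof (rule ext, rule multiset_eqI)
    fix \<epsilon> i
    \<comment> \<open>The numbers of points say nothing about a part 0, which has to be excluded
      separately.\<close>
    show "count (cycle_type n x \<epsilon>) i = count (cycle_type n z \<epsilon>) i"
      using * count_cycle_type[OF assms(1), of i \<epsilon>] count_cycle_type[OF assms(2), of i \<epsilon>]
        zero_notin_cycle_type[OF assms(1), of \<epsilon>] zero_notin_cycle_type[OF assms(2), of \<epsilon>]
      by (cases "i = 0") (auto simp: not_in_iff)
  qed
qed (simp add: count_cycle_type assms)

text \<open>Transport a block to one of the same type and continue with what remains. Two sets are
  needed: even if both are \<open>pm_set n\<close> at the start, they differ after the blocks have
  been removed.\<close>

lemma exists_conjugation:
  assumes "signed_perm w" "signed_perm z" "stable w X" "stable z Y"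
    and "\<And>i \<epsilon>. card (of_type w X i \<epsilon>) = card (of_type z Y i \<epsilon>)"
  shows "\<exists>f. bij_betw f X Y \<and> (\<forall>r\<in>X. f (w r) = z (f r) \<and> f (- r) = - f r)"
  using assms(3-5)
proof (induction "card X" arbitrary: X Y rule: less_induct)
  case less
  interpret w: signed_perm w by fact
  interpret z: signed_perm z by fact
  have finX: "finite X" and finY: "finite Y"
    using less.prems by (auto simp: stable_def)
  show ?case
  proof (cases "X = {}")
    case True
    have "Y = {}"
    proof (rule ccontr)
      assume "Y \<noteq> {}"
      then obtain q where "q \<in> Y" by blast
      then have "q \<in> of_type z Y (cyc_len z q) (cyc_class z q)" by simp
      then have "card (of_type z Y (cyc_len z q) (cyc_class z q)) \<noteq> 0"
        using finY by auto
      then show False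
        using less.prems(3)[of "cyc_len z q" "cyc_class z q"] True by simp
    qed
    then show ?thesis using True by (auto simp: bij_betw_def)
  next
    case False
    then obtain p where p: "p \<in> X" by blast
    let ?i = "cyc_len w p" and ?\<epsilon> = "cyc_class w p"
    have "p \<in> of_type w X ?i ?\<epsilon>" using p by simp
    then have "card (of_type w X ?i ?\<epsilon>) \<noteq> 0"
      using finX by auto
    then have "card (of_type z Y ?i ?\<epsilon>) \<noteq> 0"
      using less.prems(3)[of ?i ?\<epsilon>] by simp
    then have "of_type z Y ?i ?\<epsilon> \<noteq> {}"
      by (metis card.empty)
    then obtain q where q: "q \<in> Y" "cyc_len z q = ?i" "cyc_class z q = ?\<epsilon>" by blast
    have p0: "p \<noteq> 0" and q0: "q \<noteq> 0"
      using p q less.prems by (auto simp: stable_def)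
    let ?P = "block w p" and ?Q = "block z q"
    have sub: "?P \<subseteq> X" "?Q \<subseteq> Y"
      using w.block_subset[OF less.prems(1) p] z.block_subset[OF less.prems(2) q(1)] by auto
    obtain f where f: "bij_betw f ?P ?Q" "\<And>r. r \<in> ?P \<Longrightarrow> f (w r) = z (f r)"
      "\<And>r. r \<in> ?P \<Longrightarrow> f (- r) = - f r"
      using block_transport[OF assms(1,2) p0 q0 q(2,3)[symmetric]] by metis
    have card_less: "card (X - ?P) < card X"
      using finX p w.block_self[of p] by (intro psubset_card_mono) auto
    have stX: "stable w (X - ?P)" and stY: "stable z (Y - ?Q)"
      using less.prems p0 q0 w.stable_block z.stable_block by (auto intro: stable_Diff)
    have remove: "card (of_type w (X - block w p) i \<epsilon>) =
        card (of_type w X i \<epsilon>) - (if i = cyc_len w p \<and> \<epsilon> = cyc_class w p then 2 * i else 0)"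
      if "signed_perm w" "stable w X" "p \<in> X" for w X p i \<epsilon>
    proof -
      interpret signed_perm w by fact
      have "p \<noteq> 0" and fin: "finite X" using that by (auto simp: stable_def)
      show ?thesis
      proof (cases "i = cyc_len w p \<and> \<epsilon> = cyc_class w p")
        case True
        have sub: "block w p \<subseteq> of_type w X i \<epsilon>"
          using block_subset[OF that(2,3)] same_type_block[of _ p] True by (auto simp: same_type_def)
        have "of_type w (X - block w p) i \<epsilon> = of_type w X i \<epsilon> - block w p" by auto
        then show ?thesis
          using sub fin True card_block[OF \<open>p \<noteq> 0\<close>] by (simp add: card_Diff_subset)
      next
        case False
        have eq: "of_type w (X - block w p) i \<epsilon> = of_type w X i \<epsilon>"
          using same_type_block[of _ p] False by (auto simp: same_type_def)
        show ?thesis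
          unfolding eq if_not_P[OF False] by simp
      qed
    qed
    have "card (of_type w (X - ?P) i \<epsilon>) = card (of_type z (Y - ?Q) i \<epsilon>)" for i \<epsilon>
      using remove[OF assms(1) less.prems(1) p] remove[OF assms(2) less.prems(2) q(1)]
        less.prems(3)[of i \<epsilon>] q(2,3) by simp
    then obtain g where g: "bij_betw g (X - ?P) (Y - ?Q)"
      "\<forall>r\<in>X - ?P. g (w r) = z (g r) \<and> g (- r) = - g r"
      using less.hyps[OF card_less stX stY] by blast
    let ?h = "\<lambda>r. if r \<in> ?P then f r else g r"
    have "bij_betw ?h (?P \<union> (X - ?P)) (?Q \<union> (Y - ?Q))"
      using f(1) g(1) by (intro bij_betw_disjoint_Un) auto
    then have "bij_betw ?h X Y"
      using sub by (simp add: Un_absorb1)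
    moreover have "?h (w r) = z (?h r) \<and> ?h (- r) = - ?h r" if "r \<in> X" for r
      using that f(2,3) g(2) by (simp add: w.block_w w.block_neg)
    ultimately show ?thesis by blast
  qed
qed

lemma conjugate_iff_cycle_type:
  assumes w: "w \<in> signed_perms (pm_set n)" and z: "z \<in> signed_perms (pm_set n)"
  shows "(\<exists>k\<in>signed_perms (pm_set n). k \<circ> w = z \<circ> k) \<longleftrightarrow> cycle_type n w = cycle_type n z"
proof
  let ?X = "pm_set n"
  assume "cycle_type n w = cycle_type n z"
  then have "card (of_type w ?X i \<epsilon>) = card (of_type z ?X i \<epsilon>)" for i \<epsilon>
    unfolding cycle_type_eq_iff[OF w z] by blast
  then obtain f where f: "bij_betw f ?X ?X" "\<forall>r\<in>?X. f (w r) = z (f r) \<and> f (- r) = - f r"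
    using exists_conjugation[OF signed_permI[OF w pm_set(1)] signed_permI[OF z pm_set(1)]
        stable_pm_set[OF w] stable_pm_set[OF z]] by blast
  let ?k = "\<lambda>r. if r \<in> ?X then f r else r"
  have "bij_betw ?k ?X ?X"
    using f(1) by (subst bij_betw_cong[of ?X _ f]) auto
  then have "?k permutes ?X"
    by (rule bij_imp_permutes) simp
  moreover have "?k (- r) = - ?k r" "?k (w r) = z (?k r)" for r
  proof -
    have "- r \<in> ?X \<longleftrightarrow> r \<in> ?X" "w r \<in> ?X \<longleftrightarrow> r \<in> ?X"
      using stable_pm_set[OF w] by (auto simp: stable_def)
    moreover have "w r = r" "z r = r" if "r \<notin> ?X"
      using w z that by (auto simp: signed_perms_def permutes_not_in)
    ultimately show "?k (- r) = - ?k r" "?k (w r) = z (?k r)"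
      using f(2) by auto
  qed
  ultimately show "\<exists>k\<in>signed_perms ?X. k \<circ> w = z \<circ> k"
    by (intro bexI[of _ ?k]) (auto simp: signed_perms_def fun_eq_iff)
next
  let ?X = "pm_set n"
  assume "\<exists>k\<in>signed_perms ?X. k \<circ> w = z \<circ> k"
  then obtain k where k: "k permutes ?X" "\<And>r. k (- r) = - k r" "\<And>r. k (w r) = z (k r)"
    by (auto simp: signed_perms_def fun_eq_iff)
  have inj: "inj k" using k(1) by (rule permutes_inj)
  note transfer = cyc_type_transfer[where h = k and w = w and z = z, OF inj k(2,3)]
  have "k ` of_type w ?X i \<epsilon> = of_type z ?X i \<epsilon>" for i \<epsilon>
  proof (intro equalityI subsetI)
    fix q assume q: "q \<in> of_type z ?X i \<epsilon>"
    then obtain p where "q = k p" "p \<in> ?X"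
      using permutes_image[OF k(1)] by blast
    then show "q \<in> k ` of_type w ?X i \<epsilon>"
      using q transfer by auto
  qed (use transfer permutes_in_image[OF k(1)] in auto)
  then have "card (of_type w ?X i \<epsilon>) = card (of_type z ?X i \<epsilon>)" for i \<epsilon>
    using card_image[OF inj_on_subset[OF inj subset_UNIV], of "of_type w ?X i \<epsilon>"] by simp
  then show "cycle_type n w = cycle_type n z"
    unfolding cycle_type_eq_iff[OF w z] by blast
qed

text \<open>Two conjugating elements differ by a left factor from the centralizer of
  \<open>w\<close>, so they form a coset of it as soon as one exists.\<close>

lemma card_conjugators:
  assumes w: "w \<in> signed_perms (pm_set n)" and z: "z \<in> signed_perms (pm_set n)"
  shows "card {k \<in> signed_perms (pm_set n). k \<circ> z = w \<circ> k} =
    (if cycle_type n z = cycle_type n w then card (comm w (pm_set n)) else 0)"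
proof (cases "cycle_type n z = cycle_type n w")
  case True
  let ?G = "signed_perms (pm_set n)"
  obtain k where k: "k \<in> ?G" "k \<circ> z = w \<circ> k"
    using conjugate_iff_cycle_type[OF z w] True by blast
  note ki = signed_perms_inv_comp[OF k(1)]
  have "{h \<in> ?G. h \<circ> z = w \<circ> h} = (\<lambda>c. c \<circ> k) ` comm w (pm_set n)"
  proof (intro equalityI subsetI)
    fix h assume h: "h \<in> {h \<in> ?G. h \<circ> z = w \<circ> h}"
    have "h \<circ> inv_into UNIV k \<circ> w = h \<circ> inv_into UNIV k \<circ> (w \<circ> k) \<circ> inv_into UNIV k"
      using ki by (simp add: comp_assoc)
    also have "\<dots> = h \<circ> (inv_into UNIV k \<circ> k) \<circ> z \<circ> inv_into UNIV k"
      unfolding k(2)[symmetric] by (simp only: comp_assoc)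
    also have "\<dots> = (h \<circ> z) \<circ> inv_into UNIV k"
      using ki by simp
    also have "\<dots> = w \<circ> (h \<circ> inv_into UNIV k)"
      using h by (simp add: comp_assoc)
    finally have "h \<circ> inv_into UNIV k \<in> comm w (pm_set n)"
      using h signed_perms_comp[OF _ signed_perms_inv[OF k(1)], of h] by (auto simp: comm_def fun_eq_iff)
    moreover have "h = (h \<circ> inv_into UNIV k) \<circ> k"
      using ki by (simp add: comp_assoc)
    ultimately show "h \<in> (\<lambda>c. c \<circ> k) ` comm w (pm_set n)" by blast
  next
    fix h assume "h \<in> (\<lambda>c. c \<circ> k) ` comm w (pm_set n)"
    then obtain c where c: "c \<in> comm w (pm_set n)" "h = c \<circ> k" by blast
    then have "h \<in> ?G"
      using k(1) signed_perms_comp by (auto simp: comm_def)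
    moreover have "c \<circ> w = w \<circ> c"
      using c by (auto simp: comm_def fun_eq_iff)
    then have "h \<circ> z = w \<circ> h"
      using k(2) c(2) by (metis comp_assoc)
    ultimately show "h \<in> {h \<in> ?G. h \<circ> z = w \<circ> h}" by simp
  qed
  moreover have "inj_on (\<lambda>c. c \<circ> k) (comm w (pm_set n))"
  proof (rule inj_onI)
    fix c d assume "c \<circ> k = d \<circ> k"
    then have "c \<circ> (k \<circ> inv_into UNIV k) = d \<circ> (k \<circ> inv_into UNIV k)"
      by (simp only: comp_assoc[symmetric])
    then show "c = d" using ki by simp
  qed
  ultimately show ?thesis
    using True by (simp add: card_image)
next
  case False
  then have empty: "{k \<in> signed_perms (pm_set n). k \<circ> z = w \<circ> k} = {}"
    using conjugate_iff_cycle_type[OF z w] by blast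
  show ?thesis
    using False by (simp only: empty card.empty if_False)
qed

lemma higher_lie_char_div_centralizer:
  assumes x: "x \<in> signed_perms (pm_set n)" and g: "g \<in> signed_perms (pm_set n)"
  shows "higher_lie_char n x \<omega> g / of_nat (card (centralizer (hyperoctahedral n) g)) =
    (\<Sum>z | z \<in> comm x (pm_set n) \<and> cycle_type n z = cycle_type n g. \<omega> z) / of_nat (card (comm x (pm_set n)))"
proof -
  let ?G = "signed_perms (pm_set n)" and ?Z = "comm x (pm_set n)"
  let ?c = "\<lambda>k. inv_into UNIV k \<circ> g \<circ> k"
  let ?R = "(\<Sum>z | z \<in> ?Z \<and> cycle_type n z = cycle_type n g. \<omega> z)"
  let ?P = "\<lambda>z. (\<Sum>k | k \<in> {k \<in> ?G. ?c k \<in> ?Z} \<and> ?c k = z. \<omega> (?c k))"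
  let ?L = "(\<Sum>k | k \<in> ?G \<and> ?c k \<in> ?Z. \<omega> (?c k))"
  let ?N = "of_nat (card (comm g (pm_set n)))"
  have finG: "finite ?G"
    by (rule finite_subset[OF _ finite_permutations[OF pm_set(1)[of n]]]) (auto simp: signed_perms_def)
  have finZ: "finite ?Z"
    using pm_set(1) by (rule finite_comm)
  have conj: "inv\<^bsub>hyperoctahedral n\<^esub> k \<otimes>\<^bsub>hyperoctahedral n\<^esub> g \<otimes>\<^bsub>hyperoctahedral n\<^esub> k = ?c k"
    if "k \<in> ?G" for k
    using inv_hyperoctahedral[OF that] by (simp add: hyperoctahedral_def)
  have conj_iff: "?c k = z \<longleftrightarrow> k \<circ> z = g \<circ> k" if "k \<in> ?G" for k z
    using signed_perms_inv_comp[OF that] by (metis comp_assoc comp_id id_comp)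
  have gZ: "card (comm g (pm_set n)) \<noteq> 0"
    using finite_comm[OF pm_set(1)] comm_id by (metis card_0_eq empty_iff)
  have "?L = (\<Sum>z\<in>?Z. \<Sum>k | k \<in> {k \<in> ?G. ?c k \<in> ?Z} \<and> ?c k = z. \<omega> (?c k))"
    using finG finZ by (intro sum.group[symmetric]) auto
  also have "\<dots> = (\<Sum>z\<in>?Z. of_nat (card {k \<in> ?G. k \<circ> z = g \<circ> k}) * \<omega> z)"
  proof (rule sum.cong[OF refl])
    fix z assume z: "z \<in> ?Z"
    have "?P z = (\<Sum>k | k \<in> ?G \<and> k \<circ> z = g \<circ> k. \<omega> z)"
    proof (rule sum.cong)
      show "{k \<in> {k \<in> ?G. ?c k \<in> ?Z}. ?c k = z} = {k \<in> ?G. k \<circ> z = g \<circ> k}"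
      proof (rule Set.set_eqI)
        fix k
        show "k \<in> {k \<in> {k \<in> ?G. ?c k \<in> ?Z}. ?c k = z} \<longleftrightarrow> k \<in> {k \<in> ?G. k \<circ> z = g \<circ> k}"
          using z conj_iff[of k z] by (cases "k \<in> ?G") auto
      qed
      fix k assume "k \<in> {k \<in> ?G. k \<circ> z = g \<circ> k}"
      then have "?c k = z"
        using conj_iff by blast
      then show "\<omega> (?c k) = \<omega> z" by (rule arg_cong)
    qed
    then show "?P z = of_nat (card {k \<in> ?G. k \<circ> z = g \<circ> k}) * \<omega> z"
      by simp
  qed
  also have "\<dots> = (\<Sum>z\<in>?Z. if cycle_type n z = cycle_type n g then ?N * \<omega> z else 0)"
    using card_conjugators[OF g] by (intro sum.cong refl) (auto simp: comm_def)
  also have "\<dots> = ?N * ?R"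
    unfolding sum_distrib_left by (rule sum.inter_filter[OF finZ, symmetric])
  finally have "?L =
      ?N * ?R" .
  moreover have "higher_lie_char n x \<omega> g = ?L / of_nat (card ?Z)"
    unfolding higher_lie_char_def induced_char_def centralizer_eq_comm carrier_hyperoctahedral
    using conj by (intro arg_cong2[of _ _ _ _ "(/)"] sum.cong refl) auto
  ultimately show ?thesis
    using gZ by (simp add: centralizer_eq_comm)
qed

section \<open>The generating series\<close>

definition part_mset :: "(nat \<Rightarrow> z2class \<Rightarrow> indet) \<Rightarrow> bipartition \<Rightarrow> indet multiset" where
  "part_mset v lam = (\<Sum>\<epsilon>\<in>UNIV. \<Sum>i\<in>set_mset (lam \<epsilon>). replicate_mset (i * count (lam \<epsilon>) i) (v i \<epsilon>))"

lemma s_monomial_eq: "s_monomial lam = mps_monom (part_mset S lam)"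
  by (simp only: s_monomial_def part_mset_def UNIV_z2class mps_var_eq_monom mps_monom_power
      mps_monom_prod repeat_mset_replicate_mset)

lemma t_monomial_eq: "t_monomial lam = mps_monom (part_mset T lam)"
  by (simp only: t_monomial_def part_mset_def UNIV_z2class mps_var_eq_monom mps_monom_power
      mps_monom_prod repeat_mset_replicate_mset)

lemma inj_S: "inj (case_prod S)" and inj_T: "inj (case_prod T)"
  by (auto simp: inj_def)

lemma count_part_mset:
  assumes "inj (case_prod v)"
  shows "count (part_mset v lam) (v i \<epsilon>) = i * count (lam \<epsilon>) i"
proof -
  have v: "v i \<epsilon> = v i' \<epsilon>' \<longleftrightarrow> i' = i \<and> \<epsilon>' = \<epsilon>" for i' \<epsilon>'
    using injD[OF assms, of "(i', \<epsilon>')" "(i, \<epsilon>)"] by auto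
  have "count (part_mset v lam) (v i \<epsilon>) =
      (\<Sum>\<epsilon>'\<in>UNIV. \<Sum>i'\<in>set_mset (lam \<epsilon>'). if i' = i \<and> \<epsilon>' = \<epsilon> then i' * count (lam \<epsilon>') i' else 0)"
    by (simp only: part_mset_def count_sum count_replicate_mset v)
  also have "\<dots> = (\<Sum>\<epsilon>'\<in>UNIV. if \<epsilon>' = \<epsilon> then i * count (lam \<epsilon>) i else 0)"
  proof (rule sum.cong[OF refl])
    fix \<epsilon>'
    show "(\<Sum>i'\<in>set_mset (lam \<epsilon>'). if i' = i \<and> \<epsilon>' = \<epsilon> then i' * count (lam \<epsilon>') i' else 0) =
        (if \<epsilon>' = \<epsilon> then i * count (lam \<epsilon>) i else 0)"
      by (cases "\<epsilon>' = \<epsilon>") (simp_all add: count_eq_zero_iff)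
  qed
  also have "\<dots> = i * count (lam \<epsilon>) i"
    by (cases \<epsilon>) (simp_all add: UNIV_z2class)
  finally show ?thesis .
qed

lemma part_mset_elem: "u \<in># part_mset v lam \<Longrightarrow> \<exists>i \<epsilon>. u = v i \<epsilon>"
  by (auto simp: part_mset_def UNIV_z2class set_mset_sum split: if_splits)

lemma size_part_mset: "size (part_mset v lam) = sum_mset (lam Pos) + sum_mset (lam Neg)"
  by (simp add: part_mset_def size_multiset_sum UNIV_z2class sum_mset_eq_sum_count)

lemma type_mset_eq_part_mset:
  assumes x: "x \<in> signed_perms (pm_set n)" and v: "inj (case_prod v)"
  shows "type_mset v x (pm_set n) = part_mset v (cycle_type n x)"
proof (rule multiset_eqI)
  fix u
  interpret signed_perm x
    using x pm_set(1) by (rule signed_permI)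
  have elem: "\<exists>p\<in>pm_set n. u = v (cyc_len x p) (cyc_class x p)" if "u \<in># type_mset v x (pm_set n)" for u
    using that pm_set(1) by (auto simp: type_mset_def)
  show "count (type_mset v x (pm_set n)) u = count (part_mset v (cycle_type n x)) u"
  proof (cases "\<exists>i \<epsilon>. u = v i \<epsilon>")
    case False
    then have "u \<notin># type_mset v x (pm_set n)" "u \<notin># part_mset v (cycle_type n x)"
      using elem part_mset_elem by blast+
    then show ?thesis by (simp add: not_in_iff)
  next
    case True
    then obtain i \<epsilon> where u: "u = v i \<epsilon>" by blast
    note card = count_cycle_type[OF x, of i \<epsilon>]
    show ?thesis
    proof (cases "\<exists>a\<in>pm_set n. cyc_len x a = i \<and> cyc_class x a = \<epsilon>")
      case True
      then obtain a where a: "cyc_len x a = i" "cyc_class x a = \<epsilon>" by blast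
      have "count (type_mset v x (pm_set n)) (v (cyc_len x a) (cyc_class x a)) = i * count (cycle_type n x \<epsilon>) i"
        using card a by (intro count_type_mset[OF stable_pm_set[OF x] v]) (simp add: same_type_def)
      then show ?thesis
        using a u count_part_mset[OF v] by simp
    next
      case False
      have "u \<notin># type_mset v x (pm_set n)"
      proof
        assume "u \<in># type_mset v x (pm_set n)"
        then obtain p where "p \<in> pm_set n" "v i \<epsilon> = v (cyc_len x p) (cyc_class x p)"
          using elem u by blast
        then show False
          using False injD[OF v, of "(i, \<epsilon>)" "(cyc_len x p, cyc_class x p)"] by auto
      qed
      moreover have "of_type x (pm_set n) i \<epsilon> = {}"
        using False by blast
      then have "i * count (cycle_type n x \<epsilon>) i = 0"
        using card by (simp only: card.empty)
      ultimately show ?thesis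
        using u count_part_mset[OF v] by (simp add: not_in_iff)
    qed
  qed
qed

lemma cycle_type_in_bipartitions:
  assumes "x \<in> signed_perms (pm_set n)"
  shows "cycle_type n x \<in> bipartitions n"
proof -
  have "size (type_mset S x (pm_set n)) = n"
    by (simp add: type_mset_def pm_set(4))
  then show ?thesis
    using zero_notin_cycle_type[OF assms]
    unfolding type_mset_eq_part_mset[OF assms inj_S] size_part_mset by (simp add: bipartitions_def)
qed

text \<open>Let \<rho> be the restriction of \<open>x\<close> to the block. Injectivity on the
  cyclic group turns \<omega>(\<rho>)^m = 1 into \<rho>^m = id, hence into
  \<open>(x ^^ m) p = p\<close>, as one fixed point fixes the block. In class \<open>Neg\<close> one
  turn only reaches \<open>- p\<close>, which doubles the order.\<close>

lemma primitive_root_restrict_block: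
  assumes x: "x \<in> signed_perms (pm_set n)" and lin: "linear_character (hyperoctahedral n) (comm x (pm_set n)) \<omega>"
    and inj_\<omega>: "inj_on \<omega> (generate (hyperoctahedral n) {perm_restrict x (block x p)})" and p: "p \<in> pm_set n"
  shows "primitive_root (if cyc_class x p = Pos then cyc_len x p else 2 * cyc_len x p)
    (\<omega> (perm_restrict x (block x p)))"
proof -
  interpret signed_perm x
    using x pm_set(1) by (rule signed_permI)
  have p0: "p \<noteq> 0" using p pm_set(2) by auto
  let ?B = "block x p" and ?G = "hyperoctahedral n"
  let ?\<rho> = "perm_restrict x ?B"
  have sub: "comm x ?B \<subseteq> comm x (pm_set n)"
    using block_subset[OF stable_pm_set[OF x] p] by (rule comm_mono)
  note pow = restrict_block_pow[OF p0]
  have comp: "\<omega> (y \<circ> z) = \<omega> y * \<omega> z" if "y \<in> comm x (pm_set n)" "z \<in> comm x (pm_set n)" for y z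
    using lin that by (auto simp: linear_character_def hom_def hyperoctahedral_def complex_units_def)
  have nz: "\<omega> z \<noteq> 0" if "z \<in> comm x (pm_set n)" for z
    using lin that by (auto simp: linear_character_def hom_def complex_units_def Pi_def)
  have id: "\<omega> id = 1"
    using comp[OF comm_id comm_id] nz[OF comm_id] by simp
  have "?\<rho> ^^ m \<in> generate ?G {?\<rho>} \<and> \<omega> (?\<rho> ^^ m) = \<omega> ?\<rho> ^ m" for m
  proof (induction m)
    case 0
    have "id \<in> generate ?G {?\<rho>}"
      using generate.one[of ?G "{?\<rho>}"] by (simp add: hyperoctahedral_def)
    then show ?case
      using id by (simp only: funpow.simps power_0 simp_thms)
  next
    case (Suc m)
    have "?\<rho> \<circ> (?\<rho> ^^ m) \<in> generate ?G {?\<rho>}"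
      using generate.eng[OF generate.incl[of ?\<rho> "{?\<rho>}" ?G], of "?\<rho> ^^ m"] Suc by (simp add: hyperoctahedral_def)
    moreover have "\<omega> (?\<rho> \<circ> (?\<rho> ^^ m)) = \<omega> ?\<rho> * \<omega> (?\<rho> ^^ m)"
      using pow(1)[of 1] pow(1)[of m] sub by (intro comp) auto
    ultimately show ?case
      using Suc by (simp only: funpow.simps power_Suc simp_thms)
  qed
  then have gen: "?\<rho> ^^ m \<in> generate ?G {?\<rho>}" and \<omega>_pow: "\<omega> (?\<rho> ^^ m) = \<omega> ?\<rho> ^ m" for m
    by auto
  have "\<omega> ?\<rho> ^ m = 1 \<longleftrightarrow> (x ^^ m) p = 1 * p" for m
  proof -
    have "\<omega> ?\<rho> ^ m = 1 \<longleftrightarrow> \<omega> (?\<rho> ^^ m) = \<omega> (?\<rho> ^^ 0)"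
      unfolding \<omega>_pow by simp
    also have "\<dots> \<longleftrightarrow> ?\<rho> ^^ m = ?\<rho> ^^ 0"
      using inj_\<omega> gen[of m] gen[of 0] by (rule inj_on_eq_iff)
    also have "\<dots> \<longleftrightarrow> (?\<rho> ^^ m) p = p"
    proof
      assume eq: "(?\<rho> ^^ m) p = p"
      show "?\<rho> ^^ m = ?\<rho> ^^ 0"
      proof
        fix r
        show "(?\<rho> ^^ m) r = (?\<rho> ^^ 0) r"
          using comm_fixed_point[OF pow(1) eq, of r] permutes_not_in[OF commD(1)[OF pow(1)], of r m]
          by (cases "r \<in> ?B") auto
      qed
    qed simp
    finally show ?thesis
      unfolding pow(2) by simp
  qed
  also have "\<dots> m \<longleftrightarrow> (if cyc_class x p = Pos then cyc_len x p else 2 * cyc_len x p) dvd m" for m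
  proof -
    have one: "1 \<in> {1, - 1 :: int}" by simp
    have "even (m div cyc_len x p) \<longleftrightarrow> 2 * cyc_len x p dvd m" if "cyc_len x p dvd m"
      using that cyc_len(1)[of p] by (auto elim!: dvdE)
    then show ?thesis
      unfolding pow_eq_sign_iff[OF p0 one] using cyc_len(1)[of p]
      by (cases "cyc_class x p") (auto simp: uminus_power_if dest: dvd_mult_right)
  qed
  finally show ?thesis
    using cyc_len(1)[of p] by (simp add: primitive_root_def)
qed

lemma lie_character_of_higher_lie_linear:
  assumes x: "x \<in> signed_perms (pm_set n)" and \<omega>: "higher_lie_linear n x \<omega>"
  obtains Tr where "lie_character x (pm_set n) Tr \<omega>"
proof -
  let ?X = "pm_set n"
  interpret signed_perm x
    using x pm_set(1) by (rule signed_permI)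
  have lin: "linear_character (hyperoctahedral n) (comm x ?X) \<omega>"
    and um: "\<And>D. D \<in> signed_cycles n x Pos \<Longrightarrow> \<omega> (perm_restrict uminus D) = 1"
    and inj_\<omega>: "\<And>\<epsilon> D. D \<in> signed_cycles n x \<epsilon> \<Longrightarrow> inj_on \<omega> (generate (hyperoctahedral n) {perm_restrict x D})"
    using \<omega> unfolding higher_lie_linear_def centralizer_eq_comm by auto
  obtain Tr where Tr: "cycle_transversal n x Tr" "\<And>z. z \<in> comm x ?X \<Longrightarrow> z ` Tr = Tr \<Longrightarrow> \<omega> z = 1"
    using \<omega> unfolding higher_lie_linear_def centralizer_eq_comm by auto
  have block: "block x p \<in> signed_cycles n x (cyc_class x p)" if "p \<in> ?X" for p
    using that unfolding signed_cycles_eq[OF x] by blast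
  have "lie_character x ?X Tr \<omega>"
  proof unfold_locales
    show "stable x ?X"
      using x by (rule stable_pm_set)
    show "\<omega> (y \<circ> z) = \<omega> y * \<omega> z" if "y \<in> comm x ?X" "z \<in> comm x ?X" for y z
      using lin that by (auto simp: linear_character_def hom_def hyperoctahedral_def complex_units_def)
    show "\<omega> (perm_restrict uminus (block x p)) = 1" if "p \<in> ?X" "cyc_class x p = Pos" for p
      using um block[OF that(1)] that(2) by simp
    show "primitive_root (if cyc_class x p = Pos then cyc_len x p else 2 * cyc_len x p)
        (\<omega> (perm_restrict x (block x p)))" if "p \<in> ?X" for p
      using x lin inj_\<omega>[OF block[OF that]] that by (rule primitive_root_restrict_block)
    show "\<exists>!t. t \<in> Tr \<inter> block x p" if "p \<in> ?X" for p
      using Tr(1) block[OF that] unfolding cycle_transversal_def by blast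
    show "\<omega> z = 1" if "z \<in> comm x ?X" "z ` Tr = Tr" for z
      using Tr(2) that .
    show "Tr \<subseteq> ?X"
      using Tr(1) by (simp add: cycle_transversal_def)
  qed
  then show thesis by (rule that)
qed

text \<open>Cycle types partition the centralizer of \<open>x\<close>, so the sum over
  \<open>mu\<close> is an average over all of it, which \<open>sum_comm_monomial\<close> evaluates
  on the full set \<open>pm_set n\<close>.\<close>

lemma sum_higher_lie_char:
  assumes x: "x \<in> signed_perms (pm_set n)" and \<omega>: "higher_lie_linear n x \<omega>"
    and g: "\<And>mu. mu \<in> bipartitions n \<Longrightarrow> g mu \<in> signed_perms (pm_set n) \<and> cycle_type n (g mu) = mu"
  shows "(\<Sum>mu\<in>bipartitions n.
      mps_const (higher_lie_char n x \<omega> (g mu) / of_nat (card (centralizer (hyperoctahedral n) (g mu))))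
        * s_monomial (cycle_type n x) * t_monomial mu) =
    s_component (part_mset S (cycle_type n x)) exp_series"
proof -
  let ?Z = "comm x (pm_set n)"
  let ?A = "part_mset S (cycle_type n x)"
  let ?t = "\<lambda>mu. mps_const (higher_lie_char n x \<omega> (g mu) / of_nat (card (centralizer (hyperoctahedral n) (g mu))))
        * s_monomial (cycle_type n x) * t_monomial mu"
  obtain Tr where "lie_character x (pm_set n) Tr \<omega>"
    using lie_character_of_higher_lie_linear[OF x \<omega>] .
  then interpret lie_character x "pm_set n" Tr \<omega> .
  have fin: "finite ?Z"
    using pm_set(1) by (rule finite_comm)
  have card: "of_nat (card ?Z) \<noteq> (0 :: complex)"
    using fin comm_id by (auto simp: card_eq_0_iff)
  have Z: "z \<in> signed_perms (pm_set n)" if "z \<in> ?Z" for z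
    using that by (simp add: comm_def)
  have monomial: "mps_const (\<omega> z) * mps_monom ?A * mps_monom (part_mset T (cycle_type n z)) =
      comm_monomial (pm_set n) z" if "z \<in> ?Z" for z
    unfolding comm_monomial_def type_mset_eq_part_mset[OF x inj_S] type_mset_eq_part_mset[OF Z[OF that] inj_T]
    by (simp only: mps_monom_mult mult.assoc)
  have "(\<Sum>mu\<in>bipartitions n.
      ?t mu) =
      (\<Sum>mu\<in>bipartitions n. mps_const (1 / of_nat (card ?Z)) *
        (\<Sum>z | z \<in> ?Z \<and> cycle_type n z = mu. comm_monomial (pm_set n) z))"
  proof (rule sum.cong[OF refl])
    fix mu assume mu: "mu \<in> bipartitions n"
    then have gm: "g mu \<in> signed_perms (pm_set n)" "cycle_type n (g mu) = mu"
      using g by auto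
    let ?S = "{z \<in> ?Z. cycle_type n z = mu}"
    have const_sum: "mps_const (\<Sum>z\<in>I. f z) = (\<Sum>z\<in>I. mps_const (f z))" for I :: "(int \<Rightarrow> int) set" and f
      by (rule mps_eqI) (simp add: mps_coeff_sum mps_const_def)
    have "?t mu =
      mps_const (1 / of_nat (card ?Z)) * (\<Sum>z\<in>?S. mps_const (\<omega> z) * mps_monom ?A * mps_monom (part_mset T mu))"
      unfolding higher_lie_char_div_centralizer[OF x gm(1)] gm(2) s_monomial_eq t_monomial_eq
        sum_distrib_right[symmetric] const_sum[symmetric]
      by (simp only: mult.assoc[symmetric] mps_const_mult[symmetric]) simp
    also have "(\<Sum>z\<in>?S. mps_const (\<omega> z) * mps_monom ?A * mps_monom (part_mset T mu)) =
        (\<Sum>z\<in>?S. comm_monomial (pm_set n) z)"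
      using monomial by (intro sum.cong refl) auto
    finally show "?t mu =
      mps_const (1 / of_nat (card ?Z)) * (\<Sum>z | z \<in> ?Z \<and> cycle_type n z = mu. comm_monomial (pm_set n) z)" .
  qed
  also have "\<dots> = mps_const (1 / of_nat (card ?Z)) * (\<Sum>z\<in>?Z. comm_monomial (pm_set n) z)"
  proof -
    have "cycle_type n ` ?Z \<subseteq> bipartitions n"
      using cycle_type_in_bipartitions[OF Z] by auto
    from sum.group[OF fin finite_bipartitions this, of "comm_monomial (pm_set n)"] show ?thesis
      unfolding sum_distrib_left[symmetric] by simp
  qed
  also have "(\<Sum>z\<in>?Z. comm_monomial (pm_set n) z) = of_nat (card ?Z) * s_component ?A exp_series"
    using sum_comm_monomial[OF stable_pm_set[OF x] subset_refl] type_mset_eq_part_mset[OF x inj_S] by simp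
  also have "mps_const (1 / of_nat (card ?Z)) * (of_nat (card ?Z) * s_component ?A exp_series) =
      s_component ?A exp_series"
    unfolding mps_of_nat mult.assoc[symmetric] mps_const_mult[symmetric] using card by simp
  finally show ?thesis .
qed

section \<open>Reassembling the exponential from its components\<close>

lemma part_mset_S_inj:
  assumes "lam \<in> bipartitions n" "lam' \<in> bipartitions n'" "part_mset S lam = part_mset S lam'"
  shows "lam = lam'" "n = n'"
proof -
  show "lam = lam'"
  proof (rule ext, rule multiset_eqI)
    fix \<epsilon> i
    have "i * count (lam \<epsilon>) i = i * count (lam' \<epsilon>) i"
      using count_part_mset[OF inj_S] assms(3) by metis
    then show "count (lam \<epsilon>) i = count (lam' \<epsilon>) i"
      using assms(1,2) by (cases "i = 0") (auto simp: bipartitions_def not_in_iff)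
  qed
  show "n = n'"
    using arg_cong[OF assms(3), of size] assms(1,2) by (simp add: size_part_mset bipartitions_def)
qed

lemma exp_series_support_part_mset:
  assumes "mps_coeff exp_series m \<noteq> 0"
  obtains n lam where "lam \<in> bipartitions n" "part_mset S lam = filter_mset is_S m"
proof -
  have dvd: "i dvd count m (S i \<epsilon>)" for i \<epsilon>
    using exp_series_support[OF assms] by blast
  define lam :: bipartition where "lam \<epsilon> = (\<Sum>i\<in>{i. S i \<epsilon> \<in># m}. replicate_mset (count m (S i \<epsilon>) div i) i)" for \<epsilon>
  have fin: "finite {i. S i \<epsilon> \<in># m}" for \<epsilon>
    by (rule finite_imageD[of "\<lambda>i. S i \<epsilon>"]) (auto intro: finite_subset[of _ "set_mset m"] simp: inj_on_def)
  have count: "count (lam \<epsilon>) i = count m (S i \<epsilon>) div i" for \<epsilon> i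
  proof -
    have "count (lam \<epsilon>) i = (\<Sum>i'\<in>{i. S i \<epsilon> \<in># m}. if i' = i then count m (S i \<epsilon>) div i else 0)"
      unfolding lam_def count_sum by (intro sum.cong) auto
    then show ?thesis
      using fin by (auto simp: not_in_iff)
  qed
  have "part_mset S lam = filter_mset is_S m"
  proof (rule multiset_eqI)
    fix u
    show "count (part_mset S lam) u = count (filter_mset is_S m) u"
    proof (cases u)
      case (S i \<epsilon>)
      then show ?thesis
        using count_part_mset[OF inj_S, of lam i \<epsilon>] count dvd[of i \<epsilon>] by simp
    next
      case (T i \<epsilon>)
      then have "u \<notin># part_mset S lam"
        using part_mset_elem by blast
      then show ?thesis
        using T by (simp add: not_in_iff)
    qed
  qed
  \<comment> \<open>The multiplicity of the part 0 is a quotient by 0, which is 0.\<close>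
  moreover have "0 \<notin># lam \<epsilon>" for \<epsilon>
    using count[of \<epsilon> 0] by (simp add: not_in_iff)
  then have "lam \<in> bipartitions (sum_mset (lam Pos) + sum_mset (lam Neg))"
    by (simp add: bipartitions_def)
  ultimately show thesis
    using that by blast
qed

text \<open>Each monomial of the exponential lies in exactly one component: in some component
  because its s-exponents are divisible by their indices, and in only one because the s-part
  determines \<open>lam\<close> and with it \<open>n\<close>.\<close>

lemma sum_s_components: "mps_sum UNIV (\<lambda>n. \<Sum>lam\<in>bipartitions n. s_component (part_mset S lam) exp_series) = exp_series"
proof (rule mps_eqI)
  fix m
  let ?F = "\<lambda>n. \<Sum>lam\<in>bipartitions n. s_component (part_mset S lam) exp_series"
  show "mps_coeff (mps_sum UNIV ?F) m = mps_coeff exp_series m"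
  proof (cases "mps_coeff exp_series m = 0")
    case True
    then have "mps_coeff (?F n) m = 0" for n
      by (auto simp: mps_coeff_sum mps_coeff_s_component intro!: sum.neutral)
    then show ?thesis
      using True by (simp add: mps_sum_def)
  next
    case False
    then obtain n lam where lam: "lam \<in> bipartitions n" "part_mset S lam = filter_mset is_S m"
      by (rule exp_series_support_part_mset)
    have coeff: "mps_coeff (s_component (part_mset S lam') exp_series) m =
        (if lam' = lam then mps_coeff exp_series m else 0)" if "lam' \<in> bipartitions n'" for lam' n'
    proof (cases "lam' = lam")
      case False
      then have "part_mset S lam' \<noteq> filter_mset is_S m"
        using part_mset_S_inj(1)[OF that lam(1)] lam(2) by metis
      then show ?thesis
        using False by (simp add: mps_coeff_s_component)
    qed (simp add: mps_coeff_s_component lam(2))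
    have other: "n' = n" if "mps_coeff (?F n') m \<noteq> 0" for n'
    proof (rule ccontr)
      assume "n' \<noteq> n"
      then have "lam \<notin> bipartitions n'"
        using lam(1) part_mset_S_inj(2) by blast
      then have "mps_coeff (?F n') m = 0"
        by (auto simp: mps_coeff_sum coeff intro!: sum.neutral)
      with that show False by simp
    qed
    have "mps_coeff (mps_sum UNIV ?F) m = (\<Sum>n'\<in>{n}. mps_coeff (?F n') m)"
      using other by (intro mps_coeff_mps_sum_superset) auto
    also have "\<dots> = (\<Sum>lam'\<in>bipartitions n. if lam' = lam then mps_coeff exp_series m else 0)"
      by (simp add: mps_coeff_sum coeff cong: sum.cong)
    also have "\<dots> = mps_coeff exp_series m"
      using lam(1) finite_bipartitions by simp
    finally show ?thesis .
  qed
qed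

text \<open>For a fixed \<open>lam\<close> the sum over \<open>mu\<close> is a component that
  depends on \<open>lam\<close> alone, so every choice of representatives \<open>x\<close>,
  \<open>g\<close> and characters \<omega> leads to the same series.\<close>

theorem theorem4p3:
  fixes x g :: "bipartition \<Rightarrow> int \<Rightarrow> int"
    and \<omega> :: "bipartition \<Rightarrow> (int \<Rightarrow> int) \<Rightarrow> complex"
  assumes x: "\<And>n lam. lam \<in> bipartitions n \<Longrightarrow>
      x lam \<in> carrier (hyperoctahedral n) \<and> cycle_type n (x lam) = lam"
    and \<omega>: "\<And>n lam. lam \<in> bipartitions n \<Longrightarrow> higher_lie_linear n (x lam) (\<omega> lam)"
    and g: "\<And>n mu. mu \<in> bipartitions n \<Longrightarrow>
      g mu \<in> carrier (hyperoctahedral n) \<and> cycle_type n (g mu) = mu"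
  shows "mps_sum UNIV (\<lambda>n. \<Sum>lam\<in>bipartitions n. \<Sum>mu\<in>bipartitions n.
           mps_const (higher_lie_char n (x lam) (\<omega> lam) (g mu)
                        / of_nat (card (centralizer (hyperoctahedral n) (g mu))))
             * s_monomial lam * t_monomial mu)
       = mps_exp (mps_sum {((i, \<epsilon>), (j, \<theta>)). 1 \<le> i \<and> 1 \<le> j} (\<lambda>((i, \<epsilon>), (j, \<theta>)).
           \<Sum>e | e dvd gcd i j.
             mps_const (K \<epsilon> \<theta> e / (2 * of_nat i * of_nat j / of_nat e))
               * (mps_var (S i \<epsilon>) * mps_var (T j \<theta>)) ^ (i * j div e)))"
    (is "mps_sum UNIV ?L = _")
proof -
  have inner: "(\<Sum>mu\<in>bipartitions n.
      mps_const (higher_lie_char n (x lam) (\<omega> lam) (g mu)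
                        / of_nat (card (centralizer (hyperoctahedral n) (g mu))))
             * s_monomial lam * t_monomial mu) = s_component (part_mset S lam) exp_series"
    if lam: "lam \<in> bipartitions n" for n lam
    using sum_higher_lie_char[of "x lam" n "\<omega> lam" g] x[OF lam] \<omega>[OF lam] g[of _ n]
    by (simp add: carrier_hyperoctahedral)
  have "?L =
      (\<lambda>n. \<Sum>lam\<in>bipartitions n. s_component (part_mset S lam) exp_series)"
    by (rule ext, rule sum.cong[OF refl], rule inner)
  then show ?thesis
    using sum_s_components unfolding exp_series_def log_series_def by simp
qed

end
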